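(* Consider the action of $\widetilde\Gamma_1(r)$ on $\mathbf B(\dddot X_n)$ (with $r=1$) or on $\mathbf B(X_n^{\mathrm{um}})$ (with $r=2$ for $X_n\in\{B_n,C_n,F_4\}$ and $r=3$ for $X_n=G_2$). The elements of $\widetilde\Gamma_1(r)$ that induce basic involutions are precisely those which, under the canonical projection $\widetilde\Gamma_1(r)\to\Gamma_1(r)$, are mapped to elements of the form $$\begin{bmatrix}a&b\\-rb&d\end{bmatrix}.$$
   Context: **Coxeter braid groups.** The $p$-braid relation for $a,b$ is $aba\cdots=bab\cdots$ with $2,3,4,6$ factors on each side for $p=0,1,2,3$, and is empty for $p\ge4$. For a diagram $D$, $B(D)$ has one generator per node, generators of nodes joined by $p$ edges satisfying the $p$-braid relation. For a finite irreducible reduced root system of type $X_n$ with simple roots $\alpha_1,\dots,\alpha_n$ (standard labelling), nodes $i\neq j$ of the Coxeter diagram are joined by $(\alpha_i,\alpha_j^\vee)(\alpha_i^\vee,\alpha_j)$ edges; generators of $B(X_n)$ are $\mathcal T_1,\dots,\mathcal T_n$; $\mathcal T_w$ is the product of generators along any reduced expression of the Weyl group element $w$; $s_\gamma$ is the reflection in $\gamma$. **$\mathbf B(\dddot X_n)$**, $X_n\in\{A_n(n\ge1),B_n(n\ge3),C_n(n\ge2),D_n(n\ge4),E_6,E_7,E_8,F_4,G_2\}$: $\theta$ is the highest root, $\Theta=\mathcal T_{s_\theta}$. $\dddot X_n$ is the diagram $X_n$ plus three affine nodes with generators $\Theta_{01},\Theta_{02},\Theta_{03}$, pairwise joined by four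 edges, each joined to node $i$ by $(\theta,\alpha_i^\vee)(\theta^\vee,\alpha_i)$ edges. $\mathbf B(\dddot X_n)$ is the quotient of $B(\dddot X_n)$ by: (a) $\Theta_{01}\Theta_{02}\Theta_{03}\Theta$ is central; (b) only for $C_n$, $n\ge2$: $\Theta_{0i}\mathcal T_1^{-1}\Theta_{0j}\mathcal T_1=\mathcal T_1^{-1}\Theta_{0j}\mathcal T_1\Theta_{0i}$ for $(i,j)\in\{(1,2),(1,3),(2,3)\}$. **$\mathbf B(X_n^{\mathrm{um}})$**, $X_n\in\{B_n(n\ge2),C_n(n\ge2),F_4,G_2\}$: $\theta$ is the dominant short root, $\varphi$ the highest root, $\Theta=\mathcal T_{s_\theta}$, $\Phi=\mathcal T_{s_\varphi}$, $\Psi=(\mathcal T_{s_\varphi s_\theta})^{-1}$. $X_n^{\mathrm{um}}$ is the diagram $X_n$ plus two affine nodes with generators $\Theta_0,\Phi_0$, joined to node $i$ by $(\theta,\alpha_i^\vee)(\theta^\vee,\alpha_i)$, resp. $(\varphi,\alpha_i^\vee)(\varphi^\vee,\alpha_i)$ edges, and to each other by $2$ edges ($3$ for $G_2$). $\mathbf B(X_n^{\mathrm{um}})$ is the quotient of $B(X_n^{\mathrm{um}})$ by: $\Phi_0\Phi\Theta_0\Psi\Phi_0\Theta\Theta_0$ is central. **Congruence groups.** $\Gamma_1(1)=\mathrm{SL}(2,\mathbb Z)$; for $r=2,3$, $\Gamma_1(r)$ is the group of matrices in $\mathrm{SL}(2,\mathbb Z)$ congruent to $\begin{bmatrix}1&*\\0&1\end{bmatrix}$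 mod $r$. $\widetilde\Gamma_1(1)=\langle \mathfrak u_1,\mathfrak u_2\mid \mathfrak u_1\mathfrak u_2\mathfrak u_1=\mathfrak u_2\mathfrak u_1\mathfrak u_2\rangle$ with projection $\mathfrak u_1\mapsto\begin{bmatrix}1&-1\\0&1\end{bmatrix}$, $\mathfrak u_2\mapsto\begin{bmatrix}1&0\\1&1\end{bmatrix}$, and $\widetilde\Gamma_1(r)=\langle \mathfrak u_1,\mathfrak u_2^r\rangle$ (the inverse image of $\Gamma_1(r)$ in the universal cover of $\mathrm{SL}(2,\mathbb R)$). **The action** (by automorphisms fixing all $\mathcal T_i$). $\mathfrak u_1$ acts by $\mathfrak a$ and $\mathfrak u_2^r$ by $\mathfrak b$, where on $\mathbf B(\dddot X_n)$: $\mathfrak a:\Theta_{01}\mapsto\Theta_{02},\ \Theta_{02}\mapsto\Theta_{02}^{-1}\Theta_{01}\Theta_{02},\ \Theta_{03}\mapsto\Theta_{03}$; $\mathfrak b:\Theta_{01}\mapsto\Theta_{01},\ \Theta_{02}\mapsto\Theta_{03},\ \Theta_{03}\mapsto\Theta_{03}^{-1}\Theta_{02}\Theta_{03}$; and on $\mathbf B(X_n^{\mathrm{um}})$: $\mathfrak a:\Theta_0\mapsto\Phi_0\Phi\Theta_0\Phi^{-1}\Phi_0^{-1},\ \Phi_0\mapsto\Phi_0$; $\mathfrak b:\Theta_0\mapsto\Theta_0,\ \Phi_0\mapsto\Theta\Theta_0\Phi_0\Theta_0^{-1}\Theta^{-1}$. **The anti-involution $\mathfrak e$.** On $\mathbf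 B(\dddot X_n)$, $\mathfrak e$ is the group anti-automorphism fixing all $\mathcal T_i$ and $\Theta_{02}$ and exchanging $\Theta_{01},\Theta_{03}$. For umlaut diagrams, $\mathfrak e:\mathbf B(X_n^{\mathrm{um}})\to\mathbf B((X_n^{\mathfrak e})^{\mathrm{um}})$ is the anti-isomorphism with $\Theta_0\mapsto\Phi_0$, $\Phi_0\mapsto\Theta_0$, $\mathcal T_i\mapsto\mathcal T_{\mathfrak e(i)}$, where $X_n^{\mathfrak e}=X_n$ and $\mathfrak e$ is the nontrivial symmetry of the Coxeter diagram $X_n$ if $X_n$ is of type $B_2=C_2,F_4,G_2$, while $B_n^{\mathfrak e}=C_n$, $C_n^{\mathfrak e}=B_n$, $\mathfrak e(i)=i$ for $n\ge3$. **Basic involutions.** An element $\widetilde\gamma$ induces a basic (anti-)involution $\mathfrak e\widetilde\gamma$ if $\mathfrak e\,\widetilde\gamma\,\mathfrak e=\widetilde\gamma^{-1}$ as automorphisms, where $\widetilde\gamma$ on the left acts on the source group and $\widetilde\gamma^{-1}$ on the right acts on the target group of $\mathfrak e$ (these coincide except for $B_n^{\mathrm{um}},C_n^{\mathrm{um}}$, $n\ge3$). Composing the basic anti-involution $\mathfrak e\widetilde\gamma$ with $x\mapsto x^{-1}$ gives the corresponding basic involution, which maps $\mathcal T_i$ to $\mathcal T_{\mathfrak e(i)}^{-1}$. *)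

theory Defs
  imports
    "HOL-Analysis.Determinants"
    "HOL-Algebra.Bij"
    "HOL-Algebra.Generated_Groups"
    "HOL-Number_Theory.Cong"
begin

section \<open>Groups given by generators and relations\<close>

text \<open>The letter \<open>(g, True)\<close> stands for the generator \<open>g\<close>, and \<open>(g, False)\<close> for its inverse.\<close>

type_synonym 'g word = "('g \<times> bool) list"

definition words :: "'g set \<Rightarrow> 'g word set" where
  "words S = lists (S \<times> UNIV)"

definition pos :: "'g \<Rightarrow> 'g word" where
  "pos g = [(g, True)]"

definition neg :: "'g \<Rightarrow> 'g word" where
  "neg g = [(g, False)]"

definition inv_word :: "'g word \<Rightarrow> 'g word" where
  "inv_word w = rev (map (\<lambda>(g, b). (g, \<not> b)) w)"

text \<open>The least congruence on words over \<open>S\<close> that contains the pairs in \<open>R\<close> and makes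
  \<open>(g, True)\<close> and \<open>(g, False)\<close> mutually inverse. All relations \<open>R\<close> used
  below consist of words over \<open>S\<close>.\<close>

inductive pres_eq :: "'g set \<Rightarrow> ('g word \<times> 'g word) set \<Rightarrow> 'g word \<Rightarrow> 'g word \<Rightarrow> bool"
  for S R where
  refl: "w \<in> words S \<Longrightarrow> pres_eq S R w w"
| sym: "pres_eq S R u v \<Longrightarrow> pres_eq S R v u"
| trans: "pres_eq S R u v \<Longrightarrow> pres_eq S R v w \<Longrightarrow> pres_eq S R u w"
| append: "pres_eq S R u u' \<Longrightarrow> pres_eq S R v v' \<Longrightarrow> pres_eq S R (u @ v) (u' @ v')"
| cancel: "g \<in> S \<Longrightarrow> pres_eq S R [(g, b), (g, \<not> b)] []"
| relation: "(u, v) \<in> R \<Longrightarrow> pres_eq S R u v"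

definition pres_class :: "'g set \<Rightarrow> ('g word \<times> 'g word) set \<Rightarrow> 'g word \<Rightarrow> 'g word set" where
  "pres_class S R w = {v. pres_eq S R w v}"

definition presented_group :: "'g set \<Rightarrow> ('g word \<times> 'g word) set \<Rightarrow> 'g word set monoid" where
  "presented_group S R =
    \<lparr>carrier = pres_class S R ` words S,
     mult = (\<lambda>A B. {w. \<exists>u\<in>A. \<exists>v\<in>B. pres_eq S R (u @ v) w}),
     one = pres_class S R []\<rparr>"

text \<open>The word \<open>g h g \<dots>\<close> with the given number of factors.\<close>

primrec alternating :: "nat \<Rightarrow> 'g \<Rightarrow> 'g \<Rightarrow> 'g word" where
  "alternating 0 g h = []"
| "alternating (Suc k) g h = pos g @ alternating k h g"

text \<open>The number of factors on each side of the \<open>p\<close>-braid relation; for \<open>p \<ge> 4\<close> the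
  relation is empty.\<close>

definition braid_length :: "nat \<Rightarrow> nat" where
  "braid_length p =
    (if p = 0 then 2 else if p = 1 then 3 else if p = 2 then 4 else if p = 3 then 6 else 0)"

definition braid_relations ::
    "'g set \<Rightarrow> ('g \<Rightarrow> 'g \<Rightarrow> nat) \<Rightarrow> ('g word \<times> 'g word) set" where
  "braid_relations S edges =
    {(alternating (braid_length (edges g h)) g h, alternating (braid_length (edges g h)) h g)
     | g h. g \<in> S \<and> h \<in> S \<and> g \<noteq> h \<and> edges g h < 4}"

definition central_relations :: "'g set \<Rightarrow> 'g word \<Rightarrow> ('g word \<times> 'g word) set" where
  "central_relations S z = {(z @ pos g, pos g @ z) | g. g \<in> S}"


section \<open>Root systems\<close>

datatype cartan_type =
  TypeA nat | TypeB nat | TypeC nat | TypeD nat | TypeE6 | TypeE7 | TypeE8 | TypeF4 | TypeG2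

fun rank :: "cartan_type \<Rightarrow> nat" where
  "rank (TypeA n) = n"
| "rank (TypeB n) = n"
| "rank (TypeC n) = n"
| "rank (TypeD n) = n"
| "rank TypeE6 = 6"
| "rank TypeE7 = 7"
| "rank TypeE8 = 8"
| "rank TypeF4 = 4"
| "rank TypeG2 = 2"

text \<open>Each root system is realised in the coordinates and with the labelling of Bourbaki, inside
  a Euclidean space with coordinates \<open>1, \<dots>, ambient_dim\<close>. Only Weyl group
  invariant and scale invariant quantities are used.\<close>

fun ambient_dim :: "cartan_type \<Rightarrow> nat" where
  "ambient_dim (TypeA n) = n + 1"
| "ambient_dim (TypeB n) = n"
| "ambient_dim (TypeC n) = n"
| "ambient_dim (TypeD n) = n"
| "ambient_dim TypeE6 = 8"
| "ambient_dim TypeE7 = 8"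
| "ambient_dim TypeE8 = 8"
| "ambient_dim TypeF4 = 4"
| "ambient_dim TypeG2 = 3"

type_synonym vec = "nat \<Rightarrow> real"

definition unit_vec :: "nat \<Rightarrow> vec" where
  "unit_vec k = (\<lambda>j. if j = k then 1 else 0)"

definition e8_simple_root :: "nat \<Rightarrow> vec" where
  "e8_simple_root i =
    (if i = 1 then (\<lambda>j. if j = 1 \<or> j = 8 then 1/2 else if 2 \<le> j \<and> j \<le> 7 then - 1/2 else 0)
     else if i = 2 then (\<lambda>j. unit_vec 1 j + unit_vec 2 j)
     else (\<lambda>j. unit_vec (i - 1) j - unit_vec (i - 2) j))"

fun simple_root :: "cartan_type \<Rightarrow> nat \<Rightarrow> vec" where
  "simple_root (TypeA n) i = (\<lambda>j. unit_vec i j - unit_vec (i + 1) j)"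
| "simple_root (TypeB n) i =
    (if i = n then unit_vec n else (\<lambda>j. unit_vec i j - unit_vec (i + 1) j))"
| "simple_root (TypeC n) i =
    (if i = n then (\<lambda>j. 2 * unit_vec n j) else (\<lambda>j. unit_vec i j - unit_vec (i + 1) j))"
| "simple_root (TypeD n) i =
    (if i = n then (\<lambda>j. unit_vec (n - 1) j + unit_vec n j)
     else (\<lambda>j. unit_vec i j - unit_vec (i + 1) j))"
| "simple_root TypeE6 i = e8_simple_root i"
| "simple_root TypeE7 i = e8_simple_root i"
| "simple_root TypeE8 i = e8_simple_root i"
| "simple_root TypeF4 i =
    (if i = 1 then (\<lambda>j. unit_vec 2 j - unit_vec 3 j)
     else if i = 2 then (\<lambda>j. unit_vec 3 j - unit_vec 4 j)
     else if i = 3 then unit_vec 4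
     else (\<lambda>j. (unit_vec 1 j - unit_vec 2 j - unit_vec 3 j - unit_vec 4 j) / 2))"
| "simple_root TypeG2 i =
    (if i = 1 then (\<lambda>j. unit_vec 1 j - unit_vec 2 j)
     else (\<lambda>j. - 2 * unit_vec 1 j + unit_vec 2 j + unit_vec 3 j))"

definition ip :: "cartan_type \<Rightarrow> vec \<Rightarrow> vec \<Rightarrow> real" where
  "ip X x y = (\<Sum>j = 1..ambient_dim X. x j * y j)"

text \<open>\<open>pairing X x \<beta>\<close> is \<open>(x, \<beta>\<^sup>\<or>)\<close>, where
  \<open>\<beta>\<^sup>\<or> = 2\<beta> / (\<beta>, \<beta>)\<close>.\<close>

definition pairing :: "cartan_type \<Rightarrow> vec \<Rightarrow> vec \<Rightarrow> real" where
  "pairing X x \<beta> = 2 * ip X x \<beta> / ip X \<beta> \<beta>"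

definition reflection :: "cartan_type \<Rightarrow> vec \<Rightarrow> vec \<Rightarrow> vec" where
  "reflection X \<gamma> x = (\<lambda>j. x j - pairing X x \<gamma> * \<gamma> j)"

definition weyl_prod :: "cartan_type \<Rightarrow> nat list \<Rightarrow> vec \<Rightarrow> vec" where
  "weyl_prod X is = foldr (\<lambda>i f. reflection X (simple_root X i) \<circ> f) is id"

definition roots :: "cartan_type \<Rightarrow> vec set" where
  "roots X = {weyl_prod X is (simple_root X i) | is i. set is \<subseteq> {1..rank X} \<and> i \<in> {1..rank X}}"

definition highest_root :: "cartan_type \<Rightarrow> vec" where
  "highest_root X = (THE \<phi>. \<phi> \<in> roots X \<and>
    (\<forall>\<beta>\<in>roots X. \<exists>c :: nat \<Rightarrow> nat.
       \<forall>j. \<phi> j - \<beta> j = (\<Sum>i = 1..rank X. real (c i) * simple_root X i j)))"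

definition dominant_short_root :: "cartan_type \<Rightarrow> vec" where
  "dominant_short_root X = (THE \<theta>. \<theta> \<in> roots X \<and>
    (\<forall>\<beta>\<in>roots X. ip X \<theta> \<theta> \<le> ip X \<beta> \<beta>) \<and>
    (\<forall>i\<in>{1..rank X}. pairing X \<theta> (simple_root X i) \<ge> 0))"

definition bond :: "cartan_type \<Rightarrow> vec \<Rightarrow> vec \<Rightarrow> nat" where
  "bond X \<beta> \<gamma> = nat \<lfloor>pairing X \<beta> \<gamma> * pairing X \<gamma> \<beta>\<rfloor>"

definition reduced_expression :: "cartan_type \<Rightarrow> (vec \<Rightarrow> vec) \<Rightarrow> nat list \<Rightarrow> bool" where
  "reduced_expression X w is \<longleftrightarrow>
    set is \<subseteq> {1..rank X} \<and> weyl_prod X is = w \<and>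
    (\<forall>js. set js \<subseteq> {1..rank X} \<and> weyl_prod X js = w \<longrightarrow> length is \<le> length js)"


section \<open>Double affine braid groups\<close>

text \<open>\<open>Triple X\<close> is the diagram of type \<open>X\<close> with three affine nodes,
  \<open>Umlaut X\<close> the one with two affine nodes.\<close>

datatype diagram = Triple cartan_type | Umlaut cartan_type

fun admissible :: "diagram \<Rightarrow> bool" where
  "admissible (Triple (TypeA n)) = (n \<ge> 1)"
| "admissible (Triple (TypeB n)) = (n \<ge> 3)"
| "admissible (Triple (TypeC n)) = (n \<ge> 2)"
| "admissible (Triple (TypeD n)) = (n \<ge> 4)"
| "admissible (Triple X) = True"
| "admissible (Umlaut (TypeB n)) = (n \<ge> 2)"
| "admissible (Umlaut (TypeC n)) = (n \<ge> 2)"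
| "admissible (Umlaut TypeF4) = True"
| "admissible (Umlaut TypeG2) = True"
| "admissible (Umlaut X) = False"

fun finite_type :: "diagram \<Rightarrow> cartan_type" where
  "finite_type (Triple X) = X"
| "finite_type (Umlaut X) = X"

datatype gen = T nat | Theta01 | Theta02 | Theta03 | Theta0 | Phi0

fun affine_nodes :: "diagram \<Rightarrow> gen set" where
  "affine_nodes (Triple X) = {Theta01, Theta02, Theta03}"
| "affine_nodes (Umlaut X) = {Theta0, Phi0}"

definition nodes :: "diagram \<Rightarrow> gen set" where
  "nodes D = T ` {1..rank (finite_type D)} \<union> affine_nodes D"

fun theta :: "diagram \<Rightarrow> vec" where
  "theta (Triple X) = highest_root X"
| "theta (Umlaut X) = dominant_short_root X"

fun node_root :: "diagram \<Rightarrow> gen \<Rightarrow> vec" where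
  "node_root D (T i) = simple_root (finite_type D) i"
| "node_root D Phi0 = highest_root (finite_type D)"
| "node_root D _ = theta D"

fun affine_bond :: "diagram \<Rightarrow> nat" where
  "affine_bond (Triple X) = 4"
| "affine_bond (Umlaut X) = (if X = TypeG2 then 3 else 2)"

definition edges :: "diagram \<Rightarrow> gen \<Rightarrow> gen \<Rightarrow> nat" where
  "edges D g h =
    (if g \<in> affine_nodes D \<and> h \<in> affine_nodes D then affine_bond D
     else bond (finite_type D) (node_root D g) (node_root D h))"

text \<open>A word for \<open>\<T>\<^sub>w\<close>. As an element of the braid group it does not depend on the
  chosen reduced expression (Matsumoto).\<close>

definition T_word :: "cartan_type \<Rightarrow> (vec \<Rightarrow> vec) \<Rightarrow> gen word" where
  "T_word X w = concat (map (\<lambda>i. pos (T i)) (SOME is. reduced_expression X w is))"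

definition Theta_word :: "diagram \<Rightarrow> gen word" where
  "Theta_word D = T_word (finite_type D) (reflection (finite_type D) (theta D))"

definition Phi_word :: "diagram \<Rightarrow> gen word" where
  "Phi_word D =
    T_word (finite_type D) (reflection (finite_type D) (highest_root (finite_type D)))"

definition Psi_word :: "diagram \<Rightarrow> gen word" where
  "Psi_word D = inv_word (T_word (finite_type D)
    (reflection (finite_type D) (highest_root (finite_type D)) \<circ>
     reflection (finite_type D) (theta D)))"

fun central_word :: "diagram \<Rightarrow> gen word" where
  "central_word (Triple X) =
    pos Theta01 @ pos Theta02 @ pos Theta03 @ Theta_word (Triple X)"
| "central_word (Umlaut X) =
    pos Phi0 @ Phi_word (Umlaut X) @ pos Theta0 @ Psi_word (Umlaut X) @
    pos Phi0 @ Theta_word (Umlaut X) @ pos Theta0"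

fun extra_relations :: "diagram \<Rightarrow> (gen word \<times> gen word) set" where
  "extra_relations (Triple (TypeC n)) =
    {(pos g @ neg (T 1) @ pos h @ pos (T 1), neg (T 1) @ pos h @ pos (T 1) @ pos g) | g h.
     (g, h) \<in> {(Theta01, Theta02), (Theta01, Theta03), (Theta02, Theta03)}}"
| "extra_relations D = {}"

definition relations :: "diagram \<Rightarrow> (gen word \<times> gen word) set" where
  "relations D =
    braid_relations (nodes D) (edges D) \<union> central_relations (nodes D) (central_word D) \<union>
    extra_relations D"

definition braid_group :: "diagram \<Rightarrow> gen word set monoid" where
  "braid_group D = presented_group (nodes D) (relations D)"

definition elt :: "diagram \<Rightarrow> gen word \<Rightarrow> gen word set" where
  "elt D w = pres_class (nodes D) (relations D) w"


section \<open>Congruence groups\<close>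

definition SL2Z :: "(int^2^2) monoid" where
  "SL2Z = \<lparr>carrier = {A. det A = 1}, mult = (**), one = mat 1\<rparr>"

definition Gamma1 :: "nat \<Rightarrow> (int^2^2) set" where
  "Gamma1 r = {A \<in> carrier SL2Z.
    [A $ 1 $ 1 = 1] (mod int r) \<and> [A $ 2 $ 1 = 0] (mod int r) \<and> [A $ 2 $ 2 = 1] (mod int r)}"

datatype ugen = U1 | U2

definition u_relations :: "(ugen word \<times> ugen word) set" where
  "u_relations = {(pos U1 @ pos U2 @ pos U1, pos U2 @ pos U1 @ pos U2)}"

definition Gamma_tilde_1 :: "ugen word set monoid" where
  "Gamma_tilde_1 = presented_group UNIV u_relations"

definition u1 :: "ugen word set" where
  "u1 = pres_class UNIV u_relations (pos U1)"

definition u2 :: "ugen word set" where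
  "u2 = pres_class UNIV u_relations (pos U2)"

definition Gamma_tilde :: "nat \<Rightarrow> ugen word set monoid" where
  "Gamma_tilde r = subgroup_generated Gamma_tilde_1 {u1, u2 [^]\<^bsub>Gamma_tilde_1\<^esub> r}"

text \<open>The canonical projection, defined on all of \<open>Gamma_tilde_1\<close>, of which each
  \<open>Gamma_tilde r\<close> is a subgroup.\<close>

definition proj :: "ugen word set \<Rightarrow> int^2^2" where
  "proj = (THE \<pi>. \<pi> \<in> hom Gamma_tilde_1 SL2Z \<and> \<pi> \<in> extensional (carrier Gamma_tilde_1) \<and>
    \<pi> u1 = vector [vector [1, -1], vector [0, 1]] \<and>
    \<pi> u2 = vector [vector [1, 0], vector [1, 1]])"

fun level :: "diagram \<Rightarrow> nat" where
  "level (Triple X) = 1"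
| "level (Umlaut X) = (if X = TypeG2 then 3 else 2)"


section \<open>The action and the anti-involution\<close>

fun a_word :: "diagram \<Rightarrow> gen \<Rightarrow> gen word" where
  "a_word D Theta01 = pos Theta02"
| "a_word D Theta02 = neg Theta02 @ pos Theta01 @ pos Theta02"
| "a_word D Theta0 =
    pos Phi0 @ Phi_word D @ pos Theta0 @ inv_word (Phi_word D) @ neg Phi0"
| "a_word D g = pos g"

fun b_word :: "diagram \<Rightarrow> gen \<Rightarrow> gen word" where
  "b_word D Theta02 = pos Theta03"
| "b_word D Theta03 = neg Theta03 @ pos Theta02 @ pos Theta03"
| "b_word D Phi0 =
    Theta_word D @ pos Theta0 @ pos Phi0 @ neg Theta0 @ inv_word (Theta_word D)"
| "b_word D g = pos g"

text \<open>These conditions determine \<open>\<rho>\<close> on \<open>Gamma_tilde (level D)\<close>.\<close>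

definition is_action :: "diagram \<Rightarrow> (ugen word set \<Rightarrow> gen word set \<Rightarrow> gen word set) \<Rightarrow> bool" where
  "is_action D \<rho> \<longleftrightarrow>
    \<rho> \<in> hom (Gamma_tilde (level D)) (AutoGroup (braid_group D)) \<and>
    (\<forall>g\<in>nodes D. \<rho> u1 (elt D (pos g)) = elt D (a_word D g)) \<and>
    (\<forall>g\<in>nodes D. \<rho> (u2 [^]\<^bsub>Gamma_tilde_1\<^esub> level D) (elt D (pos g)) = elt D (b_word D g))"

text \<open>The target of \<open>\<ee>\<close> and its effect on the nodes of the finite diagram.
  For \<open>B\<^sub>2\<close>, \<open>C\<^sub>2\<close> and \<open>G\<^sub>2\<close> the nontrivial diagram symmetry
  exchanges 1 and 2.\<close>

fun dual :: "diagram \<Rightarrow> diagram" where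
  "dual (Umlaut (TypeB n)) = Umlaut (if n = 2 then TypeB n else TypeC n)"
| "dual (Umlaut (TypeC n)) = Umlaut (if n = 2 then TypeC n else TypeB n)"
| "dual D = D"

fun e_index :: "diagram \<Rightarrow> nat \<Rightarrow> nat" where
  "e_index (Umlaut (TypeB n)) i = (if n = 2 then 3 - i else i)"
| "e_index (Umlaut (TypeC n)) i = (if n = 2 then 3 - i else i)"
| "e_index (Umlaut TypeF4) i = 5 - i"
| "e_index (Umlaut TypeG2) i = 3 - i"
| "e_index D i = i"

fun e_gen :: "diagram \<Rightarrow> gen \<Rightarrow> gen" where
  "e_gen D (T i) = T (e_index D i)"
| "e_gen D Theta01 = Theta03"
| "e_gen D Theta02 = Theta02"
| "e_gen D Theta03 = Theta01"
| "e_gen D Theta0 = Phi0"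
| "e_gen D Phi0 = Theta0"

text \<open>These conditions determine \<open>e\<close> on the carrier of \<open>braid_group D\<close>.\<close>

definition is_anti_involution :: "diagram \<Rightarrow> (gen word set \<Rightarrow> gen word set) \<Rightarrow> bool" where
  "is_anti_involution D e \<longleftrightarrow>
    bij_betw e (carrier (braid_group D)) (carrier (braid_group (dual D))) \<and>
    (\<forall>x\<in>carrier (braid_group D). \<forall>y\<in>carrier (braid_group D).
       e (x \<otimes>\<^bsub>braid_group D\<^esub> y) = e y \<otimes>\<^bsub>braid_group (dual D)\<^esub> e x) \<and>
    (\<forall>g\<in>nodes D. e (elt D (pos g)) = elt (dual D) (pos (e_gen D g)))"

text \<open>\<open>\<gamma>\<close> induces a basic involution if \<open>e \<gamma> e = \<gamma>\<^sup>-\<^sup>1\<close> as automorphisms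
  of \<open>braid_group (dual D)\<close>. Here \<open>\<rho>\<close> and \<open>\<rho>'\<close> are the actions on the groups
  of \<open>D\<close> and \<open>dual D\<close>, and \<open>e\<close> and \<open>e'\<close> are the anti-isomorphisms
  from the group of \<open>D\<close> to that of \<open>dual D\<close> and back.\<close>

definition induces_basic_involution ::
    "diagram \<Rightarrow> (ugen word set \<Rightarrow> gen word set \<Rightarrow> gen word set) \<Rightarrow>
     (ugen word set \<Rightarrow> gen word set \<Rightarrow> gen word set) \<Rightarrow>
     (gen word set \<Rightarrow> gen word set) \<Rightarrow> (gen word set \<Rightarrow> gen word set) \<Rightarrow> ugen word set \<Rightarrow> bool" where
  "induces_basic_involution D \<rho> \<rho>' e e' \<gamma> \<longleftrightarrow>
    (\<forall>x\<in>carrier (braid_group (dual D)).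
       e (\<rho> \<gamma> (e' x)) = \<rho>' (inv\<^bsub>Gamma_tilde (level D)\<^esub> \<gamma>) x)"

end

theory Submission
  imports Defs "HOL-Algebra.Elementary_Groups"
begin

text \<open>Conjugation by \<open>\<ee>\<close> turns the action of \<open>\<uu>\<^sub>1\<close> into that of \<open>\<uu>\<^sub>2\<^sup>-\<^sup>r\<close> and vice versa, so it
  implements an automorphism \<open>\<eta>\<close> of \<open>\<Gamma>\<close>, and \<open>\<gamma>\<close> induces a basic involution if and only if \<open>\<eta>(\<gamma>)\<gamma>\<close>
  acts trivially. On matrices \<open>\<eta>(\<gamma>)\<gamma>\<close> becomes the identity exactly for the stated form.

  The two notions of triviality agree. If \<open>\<delta>\<close> acts trivially, its matrix is the identity: the braid
  group maps onto a group generated by reflections in \<open>\<alpha>\<^sub>i\<close>, \<open>\<theta> + a\<close>, \<open>\<phi> + b\<close> for imaginary \<open>a\<close>,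
  \<open>b\<close>, and the action permutes these representations through the matrix of \<open>\<delta>\<close> on \<open>(a, b)\<close>.
  Conversely, \<open>\<eta>(\<gamma>)\<gamma>\<close> has degree 0 with respect to the two generators, while a ping-pong argument
  shows that the kernel of the projection to matrices is generated by a central element of positive degree.

  That \<open>\<ee>\<close> exchanges \<open>\<Theta>\<close> and \<open>\<Phi>\<close> in the umlaut case rests on Matsumoto's theorem, since both are
  words for arbitrarily chosen reduced expressions.\<close>

section \<open>Presented groups\<close>

text \<open>\<open>Gamma_tilde r\<close> is given only as a subgroup of a braid group, so maps out
  of it cannot be prescribed on generators. The proof works in the Artin group \<open>Art\<close> on
  x and v with a relation of length 3, 4 or 6 for r = 1, 2, 3, which maps onto
  \<open>Gamma_tilde r\<close> by x -> u1, v -> u2^r. There \<eta> is x -> v^-1, v -> x^-1, and the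
  degree gives both generators weight 1, so \<eta> negates it. On matrices \<eta> is conjugation by
  J = [0 1; r 0], and J M = M^-1 J says exactly that the lower left entry is -r times the upper
  right one.

  For r = 2, 3 the product W = x v has W^r central with matrix -1 or 1, which makes ping-pong
  possible. For r = 1 the kernel is first pushed into the subgroup generated by x and v^2, an
  instance of r = 2.

  All Cartan types are treated together: the root lattice and the rescaled coroot lattice have bases
  of pairwise obtuse vectors, and short and long roots have minimal norm in them. This yields
  highest roots, the signs of roots and the pairings of \<theta> and \<phi>.\<close>

lemma words_Nil [simp]: "[] \<in> words S"
  by (simp add: words_def)

lemma words_Cons [simp]: "(g, b) # w \<in> words S \<longleftrightarrow> g \<in> S \<and> w \<in> words S"
  by (auto simp: words_def)

lemma words_append [simp]: "u @ v \<in> words S \<longleftrightarrow> u \<in> words S \<and> v \<in> words S"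
  by (auto simp: words_def)

lemma pos_in_words [simp]: "pos g \<in> words S \<longleftrightarrow> g \<in> S"
  by (simp add: pos_def)

lemma neg_in_words [simp]: "neg g \<in> words S \<longleftrightarrow> g \<in> S"
  by (simp add: neg_def)

lemma inv_word_Nil [simp]: "inv_word [] = []"
  by (simp add: inv_word_def)

lemma inv_word_Cons: "inv_word ((g, b) # w) = inv_word w @ [(g, \<not> b)]"
  by (simp add: inv_word_def)

lemma inv_word_pos [simp]: "inv_word (pos g) = neg g"
  by (simp add: inv_word_def pos_def neg_def)

lemma inv_word_neg [simp]: "inv_word (neg g) = pos g"
  by (simp add: inv_word_def pos_def neg_def)

lemma inv_word_append [simp]: "inv_word (u @ v) = inv_word v @ inv_word u"
  by (simp add: inv_word_def)

lemma inv_word_in_words [simp]: "inv_word w \<in> words S \<longleftrightarrow> w \<in> words S"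
  by (induction w) (auto simp: inv_word_Cons)

lemma word_induct [consumes 1, case_names Nil pos neg]:
  assumes "w \<in> words S" and "P []"
    and "\<And>g w. g \<in> S \<Longrightarrow> w \<in> words S \<Longrightarrow> P w \<Longrightarrow> P (pos g @ w)"
    and "\<And>g w. g \<in> S \<Longrightarrow> w \<in> words S \<Longrightarrow> P w \<Longrightarrow> P (neg g @ w)"
  shows "P w"
  using assms(1)
proof (induction w)
  case (Cons l w)
  then show ?case
    using assms(3)[of "fst l" w] assms(4)[of "fst l" w]
    by (cases l; cases "snd l") (auto simp: pos_def neg_def)
qed (rule assms(2))

definition letter :: "('a, 'b) monoid_scheme \<Rightarrow> ('g \<Rightarrow> 'a) \<Rightarrow> 'g \<times> bool \<Rightarrow> 'a" where
  "letter G f l = (if snd l then f (fst l) else inv\<^bsub>G\<^esub> f (fst l))"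

text \<open>The homomorphism from the free group that extends f, evaluated on words that need not be
  freely reduced.\<close>

definition word_value :: "('a, 'b) monoid_scheme \<Rightarrow> ('g \<Rightarrow> 'a) \<Rightarrow> 'g word \<Rightarrow> 'a" where
  "word_value G f w = foldr (\<lambda>l x. letter G f l \<otimes>\<^bsub>G\<^esub> x) w \<one>\<^bsub>G\<^esub>"

context group
begin

lemma letter_closed: "f \<in> S \<rightarrow> carrier G \<Longrightarrow> fst l \<in> S \<Longrightarrow> letter G f l \<in> carrier G"
  by (auto simp: letter_def)

lemma word_value_Nil [simp]: "word_value G f [] = \<one>"
  by (simp add: word_value_def)

lemma word_value_Cons: "word_value G f (l # w) = letter G f l \<otimes> word_value G f w"
  by (simp add: word_value_def)

lemma word_value_closed [simp]:
  "f \<in> S \<rightarrow> carrier G \<Longrightarrow> w \<in> words S \<Longrightarrow> word_value G f w \<in> carrier G"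
  by (induction w) (auto simp: word_value_Cons letter_closed)

lemma word_value_append [simp]:
  assumes f: "f \<in> S \<rightarrow> carrier G"
  shows "u \<in> words S \<Longrightarrow> v \<in> words S \<Longrightarrow>
    word_value G f (u @ v) = word_value G f u \<otimes> word_value G f v"
  by (induction u) (use f in \<open>auto simp: word_value_Cons m_assoc letter_closed\<close>)

lemma word_value_pos [simp]: "f g \<in> carrier G \<Longrightarrow> word_value G f (pos g) = f g"
  by (simp add: word_value_Cons pos_def letter_def)

lemma word_value_neg [simp]: "f g \<in> carrier G \<Longrightarrow> word_value G f (neg g) = inv f g"
  by (simp add: word_value_Cons neg_def letter_def)

lemma word_value_inv_word:
  assumes f: "f \<in> S \<rightarrow> carrier G"
  shows "w \<in> words S \<Longrightarrow> word_value G f (inv_word w) = inv (word_value G f w)"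
proof (induction w rule: word_induct)
  case (pos g w)
  then have "f g \<in> carrier G" using f by auto
  then show ?case using pos f by (simp add: inv_mult_group)
next
  case (neg g w)
  then have "f g \<in> carrier G" using f by auto
  then show ?case using neg f by (simp add: inv_mult_group)
qed simp

end

locale presentation =
  fixes S :: "'g set" and R :: "('g word \<times> 'g word) set"
  assumes relation_words: "(u, v) \<in> R \<Longrightarrow> u \<in> words S \<and> v \<in> words S"
begin

abbreviation "PG \<equiv> presented_group S R"
abbreviation "cls \<equiv> pres_class S R"

lemma pres_eq_words: "pres_eq S R u v \<Longrightarrow> u \<in> words S \<and> v \<in> words S"
  by (induction rule: pres_eq.induct) (use relation_words in auto)

lemma cls_eq_iff: "u \<in> words S \<Longrightarrow> cls u = cls v \<longleftrightarrow> pres_eq S R u v"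
  unfolding pres_class_def by (auto intro: pres_eq.intros)

lemma cls_relation: "(u, v) \<in> R \<Longrightarrow> cls u = cls v"
  using cls_eq_iff relation_words pres_eq.relation by blast

lemma cls_closed [simp]: "w \<in> words S \<Longrightarrow> cls w \<in> carrier PG"
  by (simp add: presented_group_def)

lemma cls_cases:
  assumes "x \<in> carrier PG"
  obtains w where "w \<in> words S" "x = cls w"
  using assms by (auto simp: presented_group_def)

lemma one_PG: "\<one>\<^bsub>PG\<^esub> = cls []"
  by (simp add: presented_group_def)

lemma mult_cls:
  assumes "u \<in> words S" "v \<in> words S"
  shows "cls u \<otimes>\<^bsub>PG\<^esub> cls v = cls (u @ v)"
proof -
  have "pres_eq S R (u @ v) w"
    if "pres_eq S R u u'" "pres_eq S R v v'" "pres_eq S R (u' @ v') w" for u' v' w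
    by (rule pres_eq.trans[OF pres_eq.append[OF that(1,2)] that(3)])
  then show ?thesis
    using assms by (auto simp: presented_group_def pres_class_def intro: pres_eq.refl)
qed

text \<open>Peeling the first letter off w places a cancelling pair in the middle of the word, which
  disappears before the induction hypothesis applies.\<close>

lemma cls_inv_word:
  "w \<in> words S \<Longrightarrow> cls (inv_word w @ w) = cls []"
proof (induction w)
  case (Cons l w)
  obtain g b where l: "l = (g, b)" by (cases l)
  with Cons have *: "g \<in> S" "w \<in> words S" "pres_eq S R (inv_word w @ w) []"
    using cls_eq_iff by auto
  have "pres_eq S R [(g, \<not> b), (g, \<not> \<not> b)] []"
    by (rule pres_eq.cancel) (use * in auto)
  then have "pres_eq S R (inv_word w @ ([(g, \<not> b), (g, b)] @ w)) (inv_word w @ ([] @ w))"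
    by (intro pres_eq.append pres_eq.refl) (use * in auto)
  then have "pres_eq S R (inv_word (l # w) @ (l # w)) []"
    using *(3) by (auto simp: l inv_word_Cons intro: pres_eq.trans)
  then show ?case using * l cls_eq_iff by auto
qed simp

lemma group_PG: "group PG"
proof (rule groupI)
  fix x y assume "x \<in> carrier PG" "y \<in> carrier PG"
  then show "x \<otimes>\<^bsub>PG\<^esub> y \<in> carrier PG"
    by (auto elim!: cls_cases simp: mult_cls)
next
  fix x y z assume "x \<in> carrier PG" "y \<in> carrier PG" "z \<in> carrier PG"
  then show "x \<otimes>\<^bsub>PG\<^esub> y \<otimes>\<^bsub>PG\<^esub> z = x \<otimes>\<^bsub>PG\<^esub> (y \<otimes>\<^bsub>PG\<^esub> z)"
    by (auto elim!: cls_cases simp: mult_cls)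
next
  fix x assume "x \<in> carrier PG"
  then show "\<one>\<^bsub>PG\<^esub> \<otimes>\<^bsub>PG\<^esub> x = x"
    by (auto elim!: cls_cases simp: mult_cls one_PG)
next
  fix x assume "x \<in> carrier PG"
  then obtain w where "w \<in> words S" "x = cls w" by (rule cls_cases)
  then have "cls (inv_word w) \<in> carrier PG" "cls (inv_word w) \<otimes>\<^bsub>PG\<^esub> x = \<one>\<^bsub>PG\<^esub>"
    by (simp_all add: mult_cls one_PG cls_inv_word)
  then show "\<exists>y\<in>carrier PG. y \<otimes>\<^bsub>PG\<^esub> x = \<one>\<^bsub>PG\<^esub>" by blast
qed (simp add: one_PG)

sublocale PG: group PG
  by (rule group_PG)

lemma inv_cls: "w \<in> words S \<Longrightarrow> inv\<^bsub>PG\<^esub> (cls w) = cls (inv_word w)"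
  by (rule PG.inv_equality) (simp_all add: mult_cls one_PG cls_inv_word)

lemma cls_pos_funcset [simp]: "(\<lambda>g. cls (pos g)) \<in> S \<rightarrow> carrier PG"
  by auto

lemma cls_conv_word_value: "w \<in> words S \<Longrightarrow> cls w = word_value PG (\<lambda>g. cls (pos g)) w"
proof (induction w rule: word_induct)
  case (neg g w)
  then show ?case
    by (simp add: PG.word_value_append[where S = S] inv_cls flip: mult_cls)
qed (simp_all add: PG.word_value_append[where S = S] one_PG flip: mult_cls)

lemma PG_induct [consumes 1, case_names one pos neg]:
  assumes "x \<in> carrier PG" and "P \<one>\<^bsub>PG\<^esub>"
    and "\<And>g x. g \<in> S \<Longrightarrow> x \<in> carrier PG \<Longrightarrow> P x \<Longrightarrow> P (cls (pos g) \<otimes>\<^bsub>PG\<^esub> x)"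
    and "\<And>g x. g \<in> S \<Longrightarrow> x \<in> carrier PG \<Longrightarrow> P x \<Longrightarrow> P (inv\<^bsub>PG\<^esub> (cls (pos g)) \<otimes>\<^bsub>PG\<^esub> x)"
  shows "P x"
proof -
  have "P (cls w)" if "w \<in> words S" for w
    using that
  proof (induction w rule: word_induct)
    case (pos g w)
    then show ?case using assms(3)[of g "cls w"] by (simp add: mult_cls)
  next
    case (neg g w)
    then show ?case using assms(4)[of g "cls w"] by (simp add: mult_cls inv_cls)
  qed (use assms(2) in \<open>simp add: one_PG\<close>)
  then show ?thesis using assms(1) by (auto elim: cls_cases)
qed

lemma hom_eqI:
  assumes "group H" "h \<in> hom PG H" "k \<in> hom PG H" "x \<in> carrier PG"
    and "\<And>g. g \<in> S \<Longrightarrow> h (cls (pos g)) = k (cls (pos g))"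
  shows "h x = k x"
proof -
  interpret h: group_hom PG H h
    using assms group_PG by (simp add: group_hom_def group_hom_axioms_def)
  interpret k: group_hom PG H k
    using assms group_PG by (simp add: group_hom_def group_hom_axioms_def)
  show ?thesis
    using assms(4) by (induction rule: PG_induct) (simp_all add: assms(5))
qed

text \<open>The map of von Dyck's theorem. Evaluating one chosen representative is sound because
  \<open>word_value\<close> is constant on classes once it respects the relations.\<close>

definition pres_lift :: "('a, 'b) monoid_scheme \<Rightarrow> ('g \<Rightarrow> 'a) \<Rightarrow> 'g word set \<Rightarrow> 'a" where
  "pres_lift H f C = word_value H f (SOME w. w \<in> words S \<and> cls w = C)"

context
  fixes H :: "('a, 'b) monoid_scheme" (structure) and f :: "'g \<Rightarrow> 'a"
  assumes H: "group H" and f: "f \<in> S \<rightarrow> carrier H"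
    and rels: "\<And>u v. (u, v) \<in> R \<Longrightarrow> word_value H f u = word_value H f v"
begin

interpretation H: group H by (rule H)

lemma word_value_pres_eq: "pres_eq S R u v \<Longrightarrow> word_value H f u = word_value H f v"
proof (induction rule: pres_eq.induct)
  case (append u u' v v')
  then show ?case using pres_eq_words[OF append(1)] pres_eq_words[OF append(2)]
    by (simp add: H.word_value_append[OF f])
next
  case (cancel g b)
  then have "f g \<in> carrier H" using f by auto
  then show ?case by (cases b) (simp_all add: H.word_value_Cons letter_def)
qed (use rels in auto)

lemma pres_lift_cls: "w \<in> words S \<Longrightarrow> pres_lift H f (cls w) = word_value H f w"
  unfolding pres_lift_def
  by (rule someI2[where a = w]) (auto simp: cls_eq_iff intro: word_value_pres_eq)

lemma pres_lift_hom: "pres_lift H f \<in> hom PG H"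
proof (rule homI)
  show "pres_lift H f x \<in> carrier H" if "x \<in> carrier PG" for x
    using that f by (auto elim!: cls_cases simp: pres_lift_cls)
  show "pres_lift H f (x \<otimes>\<^bsub>PG\<^esub> y) = pres_lift H f x \<otimes> pres_lift H f y"
    if xy: "x \<in> carrier PG" "y \<in> carrier PG" for x y
  proof -
    obtain u where "u \<in> words S" "x = cls u" using xy(1) by (rule cls_cases)
    moreover obtain v where "v \<in> words S" "y = cls v" using xy(2) by (rule cls_cases)
    ultimately show ?thesis by (simp add: mult_cls pres_lift_cls H.word_value_append[OF f])
  qed
qed

lemma pres_lift_pos: "g \<in> S \<Longrightarrow> pres_lift H f (cls (pos g)) = f g"
  using f by (simp add: pres_lift_cls Pi_iff)

end

end

section \<open>Integer matrices of determinant one\<close>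

abbreviation mat2 :: "int \<Rightarrow> int \<Rightarrow> int \<Rightarrow> int \<Rightarrow> int^2^2" where
  "mat2 a b c d \<equiv> vector [vector [a, b], vector [c, d]]"

lemma mat2_nth [simp]:
  "mat2 a b c d $ 1 $ 1 = a" "mat2 a b c d $ 1 $ 2 = b"
  "mat2 a b c d $ 2 $ 1 = c" "mat2 a b c d $ 2 $ 2 = d"
  by simp_all

lemma mat2_eq_iff: "A = mat2 a b c d \<longleftrightarrow> A $ 1 $ 1 = a \<and> A $ 1 $ 2 = b \<and> A $ 2 $ 1 = c \<and> A $ 2 $ 2 = d"
  by (simp add: vec_eq_iff forall_2)

lemma mat2_eta: "A = mat2 (A $ 1 $ 1) (A $ 1 $ 2) (A $ 2 $ 1) (A $ 2 $ 2)"
  by (simp add: mat2_eq_iff)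

lemma mat2_mult [simp]:
  "mat2 a b c d ** mat2 a' b' c' d' =
     mat2 (a * a' + b * c') (a * b' + b * d') (c * a' + d * c') (c * b' + d * d')"
  by (simp add: mat2_eq_iff matrix_matrix_mult_def sum_2)

lemma mat_1_conv_mat2: "mat 1 = mat2 1 0 0 1"
  by (simp add: mat2_eq_iff mat_def)

lemma det_mat2 [simp]: "det (mat2 a b c d) = a * d - b * c"
  by (simp add: det_2)

lemma SL2Z_mult [simp]: "A \<otimes>\<^bsub>SL2Z\<^esub> B = A ** B"
  by (simp add: SL2Z_def)

lemma SL2Z_one [simp]: "\<one>\<^bsub>SL2Z\<^esub> = mat 1"
  by (simp add: SL2Z_def)

lemma SL2Z_carrier: "A \<in> carrier SL2Z \<longleftrightarrow> det A = 1"
  by (simp add: SL2Z_def)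

lemma group_SL2Z: "group SL2Z"
proof (rule groupI)
  fix A assume A: "A \<in> carrier SL2Z"
  obtain a b c d where "A = mat2 a b c d" using mat2_eta by blast
  with A show "\<exists>B\<in>carrier SL2Z. B \<otimes>\<^bsub>SL2Z\<^esub> A = \<one>\<^bsub>SL2Z\<^esub>"
    by (intro bexI[of _ "mat2 d (- b) (- c) a"])
       (auto simp: SL2Z_carrier mat_1_conv_mat2 mult.commute)
qed (auto simp: SL2Z_carrier det_mul matrix_mul_assoc)

interpretation SL2Z: group SL2Z
  by (rule group_SL2Z)

lemma inv_SL2Z_mat2:
  "a * d - b * c = 1 \<Longrightarrow> inv\<^bsub>SL2Z\<^esub> (mat2 a b c d) = mat2 d (- b) (- c) a"
  by (rule SL2Z.inv_equality) (auto simp: SL2Z_carrier mat_1_conv_mat2 mat2_eq_iff algebra_simps)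

lemma int_pow_unitriangular: "mat2 1 (-1) 0 1 [^]\<^bsub>SL2Z\<^esub> (k::int) = mat2 1 (- k) 0 1"
proof -
  have nat: "mat2 1 (-1) 0 1 [^]\<^bsub>SL2Z\<^esub> (n::nat) = mat2 1 (- int n) 0 1" for n
    by (induction n) (simp_all add: mat_1_conv_mat2)
  show ?thesis
    by (cases k rule: int_cases2)
       (simp_all add: int_pow_int nat SL2Z.int_pow_neg_int SL2Z_carrier inv_SL2Z_mat2)
qed

lemma hom_inv:
  assumes "group G" "group H" "h \<in> hom G H" "x \<in> carrier G"
  shows "h (inv\<^bsub>G\<^esub> x) = inv\<^bsub>H\<^esub> (h x)"
proof -
  interpret group_hom G H h using assms by (simp add: group_hom_def group_hom_axioms_def)
  show ?thesis using assms by simp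
qed

section \<open>The kernel of the projection to matrices\<close>

context group
begin

lemma int_pow_commute:
  assumes "x \<otimes> y = y \<otimes> x" "x \<in> carrier G" "y \<in> carrier G"
  shows "x [^] (k::int) \<otimes> y = y \<otimes> x [^] k"
proof -
  have nat: "x [^] (n::nat) \<otimes> y = y \<otimes> x [^] n" for n
    using group_commutes_pow assms by simp
  have "inv (x [^] n) \<otimes> y = y \<otimes> inv (x [^] n)" for n :: nat
  proof -
    let ?a = "x [^] n"
    have "inv ?a \<otimes> y = inv ?a \<otimes> (y \<otimes> ?a) \<otimes> inv ?a"
      using assms by (simp add: m_assoc)
    also have "\<dots> = (inv ?a \<otimes> ?a) \<otimes> y \<otimes> inv ?a"
      using assms by (simp only: nat[symmetric] m_assoc inv_closed nat_pow_closed m_closed)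
    finally show ?thesis using assms by simp
  qed
  then show ?thesis
    using nat assms by (cases k rule: int_cases2) (simp_all add: int_pow_int int_pow_neg_int)
qed

text \<open>Modulo the central element W^N the group generated by x and W is a quotient of the free
  product of Z and Z/N; these are its reduced words. An inner word begins with a power of W, an
  outer one with a nontrivial power of x in front of an inner word. The trailing power of x in
  \<open>inner_power\<close> may be trivial. The names refer to the interval used for ping-pong
  below.\<close>

inductive inner :: "'a \<Rightarrow> 'a \<Rightarrow> nat \<Rightarrow> 'a \<Rightarrow> bool" and outer :: "'a \<Rightarrow> 'a \<Rightarrow> nat \<Rightarrow> 'a \<Rightarrow> bool"
  for x W N where
  inner_power: "1 \<le> e \<Longrightarrow> e < N \<Longrightarrow> inner x W N (W [^] (e::nat) \<otimes> x [^] (k::int))"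
| inner_step: "1 \<le> e \<Longrightarrow> e < N \<Longrightarrow> outer x W N g \<Longrightarrow> inner x W N (W [^] (e::nat) \<otimes> g)"
| outer_step: "k \<noteq> 0 \<Longrightarrow> inner x W N g \<Longrightarrow> outer x W N (x [^] (k::int) \<otimes> g)"

definition reduced_form :: "'a \<Rightarrow> 'a \<Rightarrow> nat \<Rightarrow> 'a \<Rightarrow> bool" where
  "reduced_form x W N g \<longleftrightarrow> (\<exists>k::int. g = x [^] k) \<or> inner x W N g \<or> outer x W N g"

end

text \<open>In the application W = x v, and \<open>central\<close> follows from the Artin relation
  (x v)^N = (v x)^N.\<close>

locale ping_pong = group G for G :: "('a, 'b) monoid_scheme" (structure) +
  fixes x W :: 'a and N :: nat
  assumes x [simp]: "x \<in> carrier G" and W [simp]: "W \<in> carrier G" and N: "N \<ge> 2"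
    and central: "W [^] N \<otimes> x = x \<otimes> W [^] N"
begin

abbreviation "z \<equiv> W [^] N"

lemma inner_outer_closed:
  shows "inner x W N g \<Longrightarrow> g \<in> carrier G" and "outer x W N g \<Longrightarrow> g \<in> carrier G"
  by (induction rule: inner_outer.inducts) auto

lemma reduced_form_closed: "reduced_form x W N g \<Longrightarrow> g \<in> carrier G"
  using inner_outer_closed by (auto simp: reduced_form_def)

lemma z_commute: "W \<otimes> z = z \<otimes> W" "x [^] (k::int) \<otimes> z = z \<otimes> x [^] k"
  using int_pow_commute[of x z k] by (simp_all add: central group_commutes_pow)

lemma W_pow_Suc: "g \<in> carrier G \<Longrightarrow> W \<otimes> (W [^] (e::nat) \<otimes> g) = W [^] Suc e \<otimes> g"
  by (simp only: nat_pow_Suc2[OF W] m_assoc nat_pow_closed W)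

text \<open>The new power of x merges with a leading one; if they cancel, the inner word that
  remains is itself reduced.\<close>

lemma reduced_form_x:
  assumes "reduced_form x W N g"
  shows "reduced_form x W N (x [^] (k::int) \<otimes> g)"
proof -
  consider l :: int where "g = x [^] l" | "inner x W N g" | "outer x W N g"
    using assms by (auto simp: reduced_form_def)
  then show ?thesis
  proof cases
    case 1
    then show ?thesis by (auto simp: reduced_form_def simp flip: int_pow_mult)
  next
    case 2
    then show ?thesis
      by (cases "k = 0") (auto simp: reduced_form_def inner_outer_closed intro: inner_outer.intros)
  next
    case 3
    then obtain l h where h: "l \<noteq> 0" "inner x W N h" "g = x [^] (l::int) \<otimes> h"
      by (auto elim: outer.cases)
    then have "x [^] k \<otimes> g = x [^] (k + l) \<otimes> h"
      by (simp add: int_pow_mult m_assoc inner_outer_closed)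
    then show ?thesis
      using h by (cases "k + l = 0") (auto simp: reduced_form_def inner_outer_closed intro: inner_outer.intros)
  qed
qed

text \<open>Only the exponent of a leading power of W grows; when it reaches N, that power becomes
  the central element and leaves the word.\<close>

lemma reduced_form_W:
  assumes "reduced_form x W N g"
  shows "\<exists>(j::int) h. reduced_form x W N h \<and> W \<otimes> g = z [^] j \<otimes> h"
proof -
  have *: ?thesis if "reduced_form x W N (W \<otimes> g)"
    using that by (intro exI[of _ 0] exI[of _ "W \<otimes> g"]) (auto simp: reduced_form_closed)
  consider l :: int where "g = x [^] l" | "outer x W N g"
    | e l where "1 \<le> e" "e < N" "g = W [^] (e::nat) \<otimes> x [^] (l::int)"
    | e h where "1 \<le> e" "e < N" "outer x W N h" "g = W [^] (e::nat) \<otimes> h"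
    using assms by (auto simp: reduced_form_def elim: inner.cases)
  \<comment> \<open>All shapes are brought to W^e h with e from 1 to N, where h does not begin with
    W.\<close>
  then have "\<exists>h e. 1 \<le> e \<and> e \<le> N \<and> W \<otimes> g = W [^] (e::nat) \<otimes> h \<and>
      ((\<exists>l::int. h = x [^] l) \<or> outer x W N h)"
  proof cases
    case 1
    then show ?thesis using N by (intro exI[of _ g] exI[of _ 1]) auto
  next
    case 2
    then show ?thesis using N by (intro exI[of _ g] exI[of _ 1]) auto
  next
    case 3
    then show ?thesis
      using W_pow_Suc by (intro exI[of _ "x [^] l"] exI[of _ "Suc e"]) auto
  next
    case 4
    then show ?thesis
      using W_pow_Suc inner_outer_closed by (intro exI[of _ h] exI[of _ "Suc e"]) auto
  qed
  then obtain h e where he: "1 \<le> e" "e \<le> N" "W \<otimes> g = W [^] (e::nat) \<otimes> h"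
      "(\<exists>l::int. h = x [^] l) \<or> outer x W N h" by blast
  then have "reduced_form x W N h" by (auto simp: reduced_form_def)
  show ?thesis
  proof (cases "e = N")
    case True
    then show ?thesis
      using he \<open>reduced_form x W N h\<close> by (intro exI[of _ 1] exI[of _ h]) auto
  next
    case False
    then show ?thesis
      using he by (intro *) (auto simp: reduced_form_def intro: inner_outer.intros)
  qed
qed

text \<open>The elements z^j h with h reduced contain 1 and are stable under left multiplication by
  x, W and their inverses.\<close>

lemma generate_reduced_form:
  assumes "g \<in> generate G {x, W}"
  shows "\<exists>(j::int) h. reduced_form x W N h \<and> g = z [^] j \<otimes> h"
proof -
  define A where "A = {g. \<exists>(j::int) h. reduced_form x W N h \<and> g = z [^] j \<otimes> h}"
  have A_closed: "A \<subseteq> carrier G"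
    by (auto simp: A_def reduced_form_closed)
  have one: "\<one> \<in> A"
    unfolding A_def reduced_form_def by (auto intro!: exI[of _ "0::int"] exI[of _ "\<one>"])
  have z: "z [^] (j::int) \<otimes> g \<in> A" if "g \<in> A" for j g
  proof -
    obtain i :: int and h where h: "reduced_form x W N h" "g = z [^] i \<otimes> h"
      using \<open>g \<in> A\<close> by (auto simp: A_def)
    then have "z [^] j \<otimes> g = z [^] (j + i) \<otimes> h"
      by (simp add: int_pow_mult m_assoc reduced_form_closed)
    then show ?thesis using h by (auto simp: A_def)
  qed
  have x: "x [^] (k::int) \<otimes> g \<in> A" if "g \<in> A" for k g
  proof -
    obtain i :: int and h where h: "reduced_form x W N h" "g = z [^] i \<otimes> h"
      using \<open>g \<in> A\<close> by (auto simp: A_def)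
    have "z [^] i \<otimes> x [^] k = x [^] k \<otimes> z [^] i"
      by (rule int_pow_commute) (simp_all add: z_commute)
    then have "x [^] k \<otimes> g = z [^] i \<otimes> (x [^] k \<otimes> h)"
      using h by (simp add: reduced_form_closed flip: m_assoc)
    then show ?thesis using reduced_form_x[OF h(1)] by (auto simp: A_def)
  qed
  have W1: "W \<otimes> g \<in> A" if "g \<in> A" for g
  proof -
    obtain i :: int and h where h: "reduced_form x W N h" "g = z [^] i \<otimes> h"
      using \<open>g \<in> A\<close> by (auto simp: A_def)
    have "z [^] i \<otimes> W = W \<otimes> z [^] i"
      by (rule int_pow_commute) (simp_all add: z_commute)
    then have "W \<otimes> g = z [^] i \<otimes> (W \<otimes> h)"
      using h by (simp add: reduced_form_closed flip: m_assoc)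
    moreover have "W \<otimes> h \<in> A"
      using reduced_form_W[OF h(1)] by (auto simp: A_def)
    ultimately show ?thesis using z by simp
  qed
  have Wn: "W [^] (n::nat) \<otimes> g \<in> A" if "g \<in> A" for g n
  proof (induction n)
    case (Suc n)
    have "W [^] Suc n \<otimes> g = W \<otimes> (W [^] n \<otimes> g)"
      using W_pow_Suc[of g n] that A_closed by auto
    then show ?case using W1[OF Suc] by (simp only:)
  qed (use that A_closed in auto)
  \<comment> \<open>The identity W^-1 = z^-1 W^(N-1) reduces the inverse to positive powers of
    W.\<close>
  have W2: "inv W \<otimes> g \<in> A" if "g \<in> A" for g
  proof -
    have gc: "g \<in> carrier G" using that A_closed by auto
    have W_inv: "W \<otimes> (inv W \<otimes> g) = g" using gc by (simp flip: m_assoc)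
    have "z = W \<otimes> W [^] (N - 1)" using N nat_pow_Suc2[OF W, of "N - 1"] by simp
    then have "z \<otimes> (inv W \<otimes> g) = (W \<otimes> W [^] (N - 1)) \<otimes> (inv W \<otimes> g)" by simp
    also have "W \<otimes> W [^] (N - 1) = W [^] (N - 1) \<otimes> W" by (simp add: group_commutes_pow)
    finally have "z \<otimes> (inv W \<otimes> g) = W [^] (N - 1) \<otimes> g"
      using gc W_inv by (simp add: m_assoc)
    then have "inv W \<otimes> g = z [^] (-1 :: int) \<otimes> (W [^] (N - 1) \<otimes> g)"
      using gc by (simp add: int_pow_neg inv_solve_left)
    then show ?thesis using Wn[OF that] z by simp
  qed
  have "h \<otimes> g \<in> A" if "h \<in> generate G {x, W}" "g \<in> A" for h g
    using that
  proof (induction arbitrary: g rule: generate.induct)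
    case (incl h)
    then show ?case using x[of g 1] W1 by auto
  next
    case (inv h)
    then show ?case using x[of g "-1"] W2 by (auto simp: int_pow_neg)
  next
    case (eng h1 h2)
    moreover have "h1 \<in> carrier G" "h2 \<in> carrier G"
      using eng generate_in_carrier[of "{x, W}"] by auto
    ultimately show ?case using A_closed by (simp add: m_assoc subset_iff)
  qed (use A_closed in auto)
  from this[OF assms one] show ?thesis
    using assms generate_in_carrier[of "{x, W}" g] by (auto simp: A_def)
qed

end

text \<open>The matrix of W is the product of those of x and v. Its trace 2 - N is 0 or -1 for N =
  2, 3, so its N-th power is -1 or 1.\<close>

locale triangular_ping_pong = ping_pong +
  fixes h
  assumes hom: "h \<in> hom G SL2Z" and N3: "N \<le> 3"
    and h_x: "h x = mat2 1 (-1) 0 1" and h_W: "h W = mat2 (1 - int N) (-1) (int N) 1"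
begin

sublocale h: group_hom G SL2Z h
  using hom group_SL2Z by (simp add: group_hom_def group_hom_axioms_def)

lemma h_x_pow: "h (x [^] (k::int)) = mat2 1 (- k) 0 1"
  using h.hom_int_pow[OF x] by (simp add: h_x int_pow_unitriangular)

lemma N_cases: "N = 2 \<or> N = 3"
  using N N3 by linarith

lemma h_W_pow:
  assumes "1 \<le> e" "e < N"
  shows "(N = 2 \<and> h (W [^] (e::nat)) = mat2 (-1) (-1) 2 1) \<or>
    (N = 3 \<and> h (W [^] e) = mat2 (-2) (-1) 3 1) \<or> (N = 3 \<and> h (W [^] e) = mat2 1 1 (-3) (-2))"
proof -
  have "e = 1 \<or> e = 2 \<and> N = 3" using assms N_cases by auto
  then show ?thesis using N_cases by (auto simp: h_W numeral_2_eq_2)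
qed

lemma h_z: "h z = mat2 1 0 0 1 \<or> h z = mat2 (-1) 0 0 (-1)"
  using N_cases by (auto simp: h_W numeral_2_eq_2 numeral_3_eq_3)

text \<open>Only scalarity is recorded, since a scalar matrix leaves every ratio p / q
  fixed.\<close>

lemma h_z_pow: "\<exists>\<epsilon>. \<epsilon> \<noteq> 0 \<and> h (z [^] (j::int)) = mat2 \<epsilon> 0 0 \<epsilon>"
proof -
  have nat: "h (z [^] (n::nat)) = mat2 1 0 0 1 \<or> h (z [^] n) = mat2 (-1) 0 0 (-1)" for n
  proof (induction n)
    case (Suc n)
    then show ?case using h_z by auto
  qed (simp add: mat_1_conv_mat2)
  have "inv\<^bsub>SL2Z\<^esub> (mat2 1 0 0 1) = mat2 1 0 0 1" "inv\<^bsub>SL2Z\<^esub> (mat2 (-1) 0 0 (-1)) = mat2 (-1) 0 0 (-1)"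
    by (simp_all add: inv_SL2Z_mat2)
  moreover have "h (z [^] (- int n)) = inv\<^bsub>SL2Z\<^esub> (h (z [^] n))" for n
    by (simp add: int_pow_neg_int)
  ultimately have "h (z [^] j) = mat2 1 0 0 1 \<or> h (z [^] j) = mat2 (-1) 0 0 (-1)"
    using nat by (cases j rule: int_cases2) (metis int_pow_int)+
  then show ?thesis by (metis one_neq_zero zero_neq_neg_one)
qed

text \<open>The matrix acts on the first column \<open>p / q\<close>: powers of \<open>x\<close> translate the interval
  \<open>(-1, 0)\<close> off itself and powers of \<open>W\<close> map the exterior of the interval into it.\<close>

lemma inner_step_ineqs:
  fixes p q :: int
  assumes "p * q > 0 \<or> p * q + q * q < 0"
  shows "(- p - q) * (2 * p + q) < 0 \<and> 0 < (- p - q) * (2 * p + q) + (2 * p + q) * (2 * p + q)"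
    and "(- (2 * p) - q) * (3 * p + q) < 0 \<and>
      0 < (- (2 * p) - q) * (3 * p + q) + (3 * p + q) * (3 * p + q)"
    and "(p + q) * (- (3 * p) - 2 * q) < 0 \<and>
      0 < (p + q) * (- (3 * p) - 2 * q) + (- (3 * p) - 2 * q) * (- (3 * p) - 2 * q)"
proof -
  \<comment> \<open>In these monomials all claims are linear; the quadratic input is that the
    squares of p, q and p + q are nonnegative.\<close>
  define P Q R where PQR: "P = p * p" "Q = q * q" "R = p * q"
  have "(p + q) * (p + q) = P + 2 * R + Q" by (simp add: PQR algebra_simps)
  then have *: "P + 2 * R + Q \<ge> 0" "P \<ge> 0" "Q \<ge> 0" by (metis zero_le_square, simp_all add: PQR)
  have R: "R > 0 \<or> R + Q < 0" using assms by (simp add: PQR)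
  have "(- p - q) * (2 * p + q) = - (2 * P + 3 * R + Q)"
    "(- p - q) * (2 * p + q) + (2 * p + q) * (2 * p + q) = 2 * P + R"
    "(- (2 * p) - q) * (3 * p + q) = - (6 * P + 5 * R + Q)"
    "(- (2 * p) - q) * (3 * p + q) + (3 * p + q) * (3 * p + q) = 3 * P + R"
    "(p + q) * (- (3 * p) - 2 * q) = - (3 * P + 5 * R + 2 * Q)"
    "(p + q) * (- (3 * p) - 2 * q) + (- (3 * p) - 2 * q) * (- (3 * p) - 2 * q) =
       6 * P + 7 * R + 2 * Q"
    by (simp_all add: PQR algebra_simps)
  moreover have "2 * P + 3 * R + Q > 0" "2 * P + R > 0" "6 * P + 5 * R + Q > 0" "3 * P + R > 0"
    "3 * P + 5 * R + 2 * Q > 0" "6 * P + 7 * R + 2 * Q > 0"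
    using R * by linarith+
  ultimately show "(- p - q) * (2 * p + q) < 0 \<and> 0 < (- p - q) * (2 * p + q) + (2 * p + q) * (2 * p + q)"
    and "(- (2 * p) - q) * (3 * p + q) < 0 \<and>
      0 < (- (2 * p) - q) * (3 * p + q) + (3 * p + q) * (3 * p + q)"
    and "(p + q) * (- (3 * p) - 2 * q) < 0 \<and>
      0 < (p + q) * (- (3 * p) - 2 * q) + (- (3 * p) - 2 * q) * (- (3 * p) - 2 * q)"
    by (simp_all only: neg_less_0_iff_less)
qed

text \<open>For inner elements the condition says that p / q lies in (-1, 0), for outer ones that it
  lies outside [-1, 0].\<close>

lemma inner_outer_column:
  shows "inner x W N g \<Longrightarrow> \<forall>p q. h g $ 1 $ 1 = p \<longrightarrow> h g $ 2 $ 1 = q \<longrightarrow> p * q < 0 \<and> p * q + q * q > 0"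
    and "outer x W N g \<Longrightarrow> \<forall>p q. h g $ 1 $ 1 = p \<longrightarrow> h g $ 2 $ 1 = q \<longrightarrow> p * q > 0 \<or> p * q + q * q < 0"
proof (induction rule: inner_outer.inducts)
  case (inner_power e k)
  then show ?case using h_W_pow[of e] by (auto simp: h_x_pow)
next
  case (inner_step e g)
  obtain p b q d where g: "h g = mat2 p b q d" using mat2_eta by blast
  then have "p * q > 0 \<or> p * q + q * q < 0" using inner_step by auto
  note inner_step_ineqs[OF this]
  moreover have "g \<in> carrier G" using inner_step inner_outer_closed by auto
  ultimately show ?case using h_W_pow[OF inner_step(1,2)] g by auto
next
  case (outer_step k g)
  obtain p b q d where g: "h g = mat2 p b q d" using mat2_eta by blast
  then have pq: "p * q < 0" "p * q + q * q > 0" using outer_step by auto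
  then have qq: "q * q > 0" by linarith
  \<comment> \<open>A nonzero integer k translates p / q by at least 1, the length of the
    interval.\<close>
  have "k * (q * q) \<ge> q * q \<or> k * (q * q) \<le> - (q * q)"
  proof (cases "k > 0")
    case True
    then have "1 * (q * q) \<le> k * (q * q)" using qq by (intro mult_right_mono) auto
    then show ?thesis by simp
  next
    case False
    then have "k * (q * q) \<le> (-1) * (q * q)" using qq outer_step by (intro mult_right_mono) auto
    then show ?thesis by simp
  qed
  moreover have "g \<in> carrier G" using outer_step inner_outer_closed by auto
  ultimately show ?case using g pq qq
    by (auto simp: h_x_pow algebra_simps)
qed

text \<open>The first column of a scalar matrix has q = 0, which neither region allows, so the
  reduced word is a power of x; the upper right entry shows that this power is trivial.\<close>

lemma kernel_power_z:
  assumes "g \<in> generate G {x, W}" "h g = mat 1"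
  shows "\<exists>j::int. g = z [^] j"
proof -
  obtain j :: int and n where n: "reduced_form x W N n" "g = z [^] j \<otimes> n"
    using generate_reduced_form[OF assms(1)] by blast
  obtain \<epsilon> where \<epsilon>: "\<epsilon> \<noteq> 0" "h (z [^] j) = mat2 \<epsilon> 0 0 \<epsilon>" using h_z_pow by blast
  obtain p b q d where hn: "h n = mat2 p b q d" using mat2_eta by blast
  then have "mat2 \<epsilon> 0 0 \<epsilon> ** mat2 p b q d = mat2 1 0 0 1"
    using assms(2) n \<epsilon> by (simp add: reduced_form_closed mat_1_conv_mat2)
  then have "q = 0" "b = 0" using \<epsilon>(1) by (auto simp: mat2_eq_iff)
  then have "\<not> inner x W N n" "\<not> outer x W N n"
    using inner_outer_column[of n] hn by auto
  then obtain k :: int where k: "n = x [^] k" using n(1) by (auto simp: reduced_form_def)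
  with hn \<open>b = 0\<close> have "k = 0" by (auto simp: h_x_pow mat2_eq_iff)
  then show ?thesis using n k by auto
qed

end

section \<open>From matrix and degree to triviality\<close>

context group
begin

lemma generate_absorb_left:
  assumes "x \<in> carrier G" "y \<in> carrier G" "A \<subseteq> carrier G"
    and "\<And>g. g \<in> A \<Longrightarrow> x \<otimes> g \<in> A" "\<And>g. g \<in> A \<Longrightarrow> inv x \<otimes> g \<in> A"
    and "\<And>g. g \<in> A \<Longrightarrow> y \<otimes> g \<in> A" "\<And>g. g \<in> A \<Longrightarrow> inv y \<otimes> g \<in> A"
  shows "h \<in> generate G {x, y} \<Longrightarrow> g \<in> A \<Longrightarrow> h \<otimes> g \<in> A"
proof (induction arbitrary: g rule: generate.induct)
  case (eng h1 h2)
  moreover have "h1 \<in> carrier G" "h2 \<in> carrier G"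
    using eng assms generate_in_carrier[of "{x, y}"] by auto
  ultimately show ?case using assms(3) by (simp add: m_assoc subset_iff)
qed (use assms in auto)

lemma generate_le_generate:
  assumes "x \<in> carrier G" "v \<in> carrier G"
  shows "generate G {x, v} \<subseteq> generate G {x, x \<otimes> v}"
proof (rule generate_subgroup_incl)
  have "inv x \<otimes> (x \<otimes> v) \<in> generate G {x, x \<otimes> v}"
    by (intro generate.eng generate.incl generate.inv) auto
  moreover have "inv x \<otimes> (x \<otimes> v) = v" using assms by (simp flip: m_assoc)
  ultimately show "{x, v} \<subseteq> generate G {x, x \<otimes> v}" by (auto intro: generate.incl)
  show "subgroup (generate G {x, x \<otimes> v}) G" using assms by (intro generate_is_subgroup) auto
qed

text \<open>The kernel consists of powers of z = (x v)^N, whose degree N (d x + d v) is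
  positive.\<close>

lemma matrix_kernel_even:
  assumes N: "N = 2 \<or> N = 3" and xv: "x \<in> carrier G" "v \<in> carrier G"
    and rel: "(x \<otimes> v) [^] N = (v \<otimes> x) [^] N"
    and h: "h \<in> hom G SL2Z" "h x = mat2 1 (-1) 0 1" "h v = mat2 1 0 (int N) 1"
    and d: "d \<in> hom G integer_group" "d x + d v > 0"
    and g: "g \<in> generate G {x, v}" "h g = mat 1" "d g = 0"
  shows "g = \<one>"
proof -
  interpret h: group_hom G SL2Z h
    using h(1) group_SL2Z by (simp add: group_hom_def group_hom_axioms_def)
  interpret d: group_hom G integer_group d
    using d(1) by (simp add: group_hom_def group_hom_axioms_def)
  have "(x \<otimes> v) [^] N \<otimes> x = x \<otimes> (v \<otimes> x) [^] N"
    using N xv by (auto simp: numeral_2_eq_2 numeral_3_eq_3 m_assoc)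
  then interpret triangular_ping_pong G x "x \<otimes> v" N h
    using N xv h rel by unfold_locales auto
  obtain j :: int where j: "g = ((x \<otimes> v) [^] N) [^] j"
    using kernel_power_z g generate_le_generate[OF xv] by blast
  have "d ((x \<otimes> v) [^] N) = int N * (d x + d v)"
    using xv assms(1) by (auto simp: numeral_2_eq_2 numeral_3_eq_3)
  then have "d g = j * (int N * (d x + d v))"
    using xv by (simp add: j d.hom_int_pow)
  then have "j = 0" using g(3) d(2) assms(1) by auto
  then show ?thesis using j by simp
qed

text \<open>Modelled on the matrices with even lower left entry, a subgroup of index 3 in SL(2, Z):
  the union of the three cosets is stable under left multiplication by x, y and their
  inverses.\<close>

lemma coset_decomposition:
  assumes x: "x \<in> carrier G" and y: "y \<in> carrier G" and braid: "x \<otimes> y \<otimes> x = y \<otimes> x \<otimes> y"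
    and g: "g \<in> generate G {x, y}"
  shows "\<exists>a c. a \<in> generate G {x, y \<otimes> y} \<and> c \<in> {\<one>, inv y, inv x \<otimes> inv y} \<and> g = c \<otimes> a"
proof -
  let ?K = "generate G {x, y \<otimes> y}"
  define A where "A = {c \<otimes> a | a c. a \<in> ?K \<and> c \<in> {\<one>, inv y, inv x \<otimes> inv y}}"
  have K_sub: "?K \<subseteq> carrier G" using x y generate_incl[of "{x, y \<otimes> y}"] by auto
  note [simp] = x y
  have K: "x \<in> ?K" "y \<otimes> y \<in> ?K" "inv x \<in> ?K" "inv (y \<otimes> y) \<in> ?K"
    by (auto intro: generate.incl generate.inv)
  note Kmult = generate.eng[of _ G "{x, y \<otimes> y}"]
  have cancel: "a \<otimes> (inv a \<otimes> b) = b" "inv a \<otimes> (a \<otimes> b) = b"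
    if "a \<in> carrier G" "b \<in> carrier G" for a b
    using that by (simp_all flip: m_assoc)
  have memA: "a \<in> A" "inv y \<otimes> a \<in> A" "inv x \<otimes> (inv y \<otimes> a) \<in> A" if "a \<in> ?K" for a
  proof -
    have "a \<in> carrier G" using that K_sub by auto
    then have "\<one> \<otimes> a = a" "inv x \<otimes> inv y \<otimes> a = inv x \<otimes> (inv y \<otimes> a)" by (simp_all add: m_assoc)
    then show "a \<in> A" "inv y \<otimes> a \<in> A" "inv x \<otimes> (inv y \<otimes> a) \<in> A"
      using that unfolding A_def by (metis (mono_tags, lifting) insertCI mem_Collect_eq)+
  qed
  have A_cases: "P (g)" if "g \<in> A" "\<And>a. a \<in> ?K \<Longrightarrow> P a" "\<And>a. a \<in> ?K \<Longrightarrow> P (inv y \<otimes> a)"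
      "\<And>a. a \<in> ?K \<Longrightarrow> P (inv x \<otimes> (inv y \<otimes> a))" for g P
    using that K_sub unfolding A_def by (auto simp: m_assoc subset_iff)
  have br: "x \<otimes> (y \<otimes> (x \<otimes> a)) = y \<otimes> (x \<otimes> (y \<otimes> a))" if "a \<in> carrier G" for a
    using that braid by (simp flip: m_assoc)
  \<comment> \<open>The identities \<open>conj1\<close> to \<open>conj6\<close> move a letter past a
    representative and collect the rest as an element of \<open>?K\<close>.\<close>
  have conj1: "inv y \<otimes> (inv x \<otimes> (inv y \<otimes> a)) = inv x \<otimes> (inv y \<otimes> (inv x \<otimes> a))"
    if "a \<in> carrier G" for a
  proof -
    have "inv (x \<otimes> y \<otimes> x) = inv (y \<otimes> x \<otimes> y)" using braid by simp
    then have "inv x \<otimes> inv y \<otimes> inv x = inv y \<otimes> inv x \<otimes> inv y"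
      by (simp add: inv_mult_group m_assoc)
    then show ?thesis using that by (simp flip: m_assoc)
  qed
  have conj2: "y \<otimes> (inv x \<otimes> (inv y \<otimes> a)) = inv x \<otimes> (inv y \<otimes> (x \<otimes> a))"
    if "a \<in> carrier G" for a
  proof -
    have "inv y \<otimes> (inv x \<otimes> (inv y \<otimes> (x \<otimes> a))) = inv x \<otimes> (inv y \<otimes> a)"
      using that conj1[of "x \<otimes> a"] by (simp add: cancel)
    then have "y \<otimes> (inv y \<otimes> (inv x \<otimes> (inv y \<otimes> (x \<otimes> a)))) = y \<otimes> (inv x \<otimes> (inv y \<otimes> a))"
      by (simp only:)
    then show ?thesis using that by (simp add: cancel)
  qed
  \<comment> \<open>x y^-1 lies in the coset of x^-1 y^-1, because y x^2 y^-1 = x^-1 y^2 x.\<close>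
  have conj3: "x \<otimes> (inv y \<otimes> a) = inv x \<otimes> (inv y \<otimes> (y \<otimes> (x \<otimes> (x \<otimes> (inv y \<otimes> a)))))"
    if "a \<in> carrier G" for a
    using that by (simp add: cancel)
  have conj4: "y \<otimes> (x \<otimes> (x \<otimes> (inv y \<otimes> a))) = inv x \<otimes> (y \<otimes> (y \<otimes> (x \<otimes> a)))"
    if "a \<in> carrier G" for a
  proof -
    have "x \<otimes> (y \<otimes> (x \<otimes> (x \<otimes> (inv y \<otimes> a)))) = y \<otimes> (y \<otimes> (x \<otimes> a))"
      using that by (simp add: br cancel)
    then have "inv x \<otimes> (x \<otimes> (y \<otimes> (x \<otimes> (x \<otimes> (inv y \<otimes> a))))) = inv x \<otimes> (y \<otimes> (y \<otimes> (x \<otimes> a)))"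
      by (simp only:)
    then show ?thesis using that by (simp add: cancel)
  qed
  \<comment> \<open>Likewise x^-2 y^-1 lies in the coset of y^-1, the quotient being x^-1 y^-2
    x.\<close>
  have conj5: "inv x \<otimes> (inv x \<otimes> (inv y \<otimes> a)) =
      inv y \<otimes> (y \<otimes> (inv x \<otimes> (inv x \<otimes> (inv y \<otimes> a))))" if "a \<in> carrier G" for a
    using that by (simp add: cancel)
  have conj6: "y \<otimes> (inv x \<otimes> (inv x \<otimes> (inv y \<otimes> a))) = inv x \<otimes> (inv (y \<otimes> y) \<otimes> (x \<otimes> a))"
    if "a \<in> carrier G" for a
  proof -
    have "y \<otimes> (inv x \<otimes> (inv x \<otimes> (inv y \<otimes> a))) =
        y \<otimes> (inv x \<otimes> (inv y \<otimes> (y \<otimes> (inv x \<otimes> (inv y \<otimes> a)))))"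
      using that by (simp add: cancel)
    also have "\<dots> = inv x \<otimes> (inv y \<otimes> (x \<otimes> (inv x \<otimes> (inv y \<otimes> (x \<otimes> a)))))"
      using that by (simp add: conj2)
    finally show ?thesis using that by (simp add: cancel inv_mult_group m_assoc)
  qed
  have "g \<otimes> \<one> \<in> A"
  proof (rule generate_absorb_left[OF x y _ _ _ _ _ g])
    show "A \<subseteq> carrier G" using K_sub by (auto simp: A_def)
    show "\<one> \<in> A" using memA(1)[OF generate.one] .
    show "x \<otimes> g \<in> A" if "g \<in> A" for g
      using that
    proof (rule A_cases)
      fix a assume a: "a \<in> ?K"
      then have "inv x \<otimes> (y \<otimes> y \<otimes> (x \<otimes> a)) \<in> ?K" using K Kmult by blast
      then show "x \<otimes> (inv y \<otimes> a) \<in> A"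
        using a K_sub memA(3) by (subst conj3, blast, subst conj4, blast) (auto simp: m_assoc subset_iff)
    qed (use K Kmult memA K_sub in \<open>auto simp: cancel subset_iff\<close>)
    show "inv x \<otimes> g \<in> A" if "g \<in> A" for g
      using that
    proof (rule A_cases)
      fix a assume a: "a \<in> ?K"
      then have "inv x \<otimes> (inv (y \<otimes> y) \<otimes> (x \<otimes> a)) \<in> ?K" using K Kmult by blast
      then show "inv x \<otimes> (inv x \<otimes> (inv y \<otimes> a)) \<in> A"
        using a K_sub memA(2) by (subst conj5, blast, subst conj6, blast) (auto simp: m_assoc subset_iff)
    qed (use K Kmult memA K_sub in \<open>auto simp: cancel subset_iff\<close>)
    show "y \<otimes> g \<in> A" if "g \<in> A" for g
      using that
    proof (rule A_cases)
      fix a assume a: "a \<in> ?K"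
      then have "a \<in> carrier G" "inv y \<otimes> (y \<otimes> y \<otimes> a) \<in> A" using K Kmult memA K_sub by blast+
      then show "y \<otimes> a \<in> A" by (simp add: m_assoc cancel)
    qed (use K Kmult memA K_sub in \<open>auto simp: cancel conj2 subset_iff\<close>)
    show "inv y \<otimes> g \<in> A" if "g \<in> A" for g
      using that
    proof (rule A_cases)
      fix a assume a: "a \<in> ?K"
      then have "a \<in> carrier G" "inv (y \<otimes> y) \<otimes> a \<in> A" using K Kmult memA K_sub by blast+
      then show "inv y \<otimes> (inv y \<otimes> a) \<in> A" by (simp add: m_assoc inv_mult_group)
    qed (use K Kmult memA K_sub in \<open>auto simp: cancel conj1 subset_iff\<close>)
  qed
  then show ?thesis
    using g x y generate_in_carrier[of "{x, y}" g] by (auto simp: A_def)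
qed

text \<open>The parity of the lower left entry pushes the kernel into the subgroup generated by x
  and y^2, where the case N = 2 applies.\<close>

lemma matrix_kernel_braid:
  assumes xy: "x \<in> carrier G" "y \<in> carrier G" and braid: "x \<otimes> y \<otimes> x = y \<otimes> x \<otimes> y"
    and h: "h \<in> hom G SL2Z" "h x = mat2 1 (-1) 0 1" "h y = mat2 1 0 1 1"
    and d: "d \<in> hom G integer_group" "d x = 1" "d y = 1"
    and g: "g \<in> generate G {x, y}" "h g = mat 1" "d g = 0"
  shows "g = \<one>"
proof -
  interpret h: group_hom G SL2Z h
    using h(1) group_SL2Z by (simp add: group_hom_def group_hom_axioms_def)
  interpret d: group_hom G integer_group d
    using d(1) by (simp add: group_hom_def group_hom_axioms_def)
  have carr: "a \<in> carrier G" if "a \<in> generate G {x, y \<otimes> y}" for a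
    using generate_in_carrier[OF _ that] xy by simp
  have even: "even (h a $ 2 $ 1)" if "a \<in> generate G {x, y \<otimes> y}" for a
    using that
  proof (induction rule: generate.induct)
    case (inv a)
    then show ?case using xy h by (auto simp: inv_SL2Z_mat2 h.hom_inv)
  next
    case (eng a b)
    then show ?case by (simp add: carr matrix_matrix_mult_def sum_2)
  qed (use xy h in \<open>auto simp: mat_def\<close>)
  obtain a c where ac: "a \<in> generate G {x, y \<otimes> y}" "c \<in> {\<one>, inv y, inv x \<otimes> inv y}" "g = c \<otimes> a"
    using coset_decomposition[OF xy braid g(1)] by blast
  have a: "a \<in> carrier G" using carr ac by simp
  have "c = \<one>"
  proof (rule ccontr)
    assume "c \<noteq> \<one>"
    \<comment> \<open>Both nontrivial representatives have second row (-1, 1), so the lower left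
      entry of the product is r - p; as r is even, p would be even too, against determinant
      1.\<close>
    then have "h c = mat2 1 0 (-1) 1 \<or> h c = mat2 0 1 (-1) 1"
      using ac(2) xy h by (auto simp: inv_SL2Z_mat2)
    moreover obtain p q r s where M: "h a = mat2 p q r s" using mat2_eta by blast
    ultimately have "(h c ** h a) $ 2 $ 1 = r - p" by auto
    moreover have "h c ** h a = mat 1"
      using g(2) ac a xy by auto
    ultimately have "r = p" "even r" using even[OF ac(1)] M by (simp_all add: mat_def)
    moreover have "p * s - q * r = 1"
      using h.hom_closed[OF a] M by (simp add: SL2Z_carrier)
    ultimately show False
      by (metis dvd_diff dvd_mult dvd_mult2 odd_one)
  qed
  then have "g \<in> generate G {x, y \<otimes> y}" using ac a by simp
  \<comment> \<open>Both sides are the full twist (x y)^3.\<close>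
  moreover have "(x \<otimes> (y \<otimes> y)) [^] (2::nat) = (y \<otimes> y \<otimes> x) [^] (2::nat)"
  proof -
    have br: "x \<otimes> (y \<otimes> (x \<otimes> a)) = y \<otimes> (x \<otimes> (y \<otimes> a))" if "a \<in> carrier G" for a
      using that braid xy by (simp flip: m_assoc)
    have "x \<otimes> (y \<otimes> (y \<otimes> (x \<otimes> (y \<otimes> y)))) = y \<otimes> (y \<otimes> (x \<otimes> (y \<otimes> (y \<otimes> x))))"
    proof -
      have braid': "y \<otimes> (x \<otimes> y) = x \<otimes> (y \<otimes> x)" using braid xy by (simp add: m_assoc)
      have "x \<otimes> (y \<otimes> (y \<otimes> (x \<otimes> (y \<otimes> y)))) = x \<otimes> (y \<otimes> (x \<otimes> (y \<otimes> (x \<otimes> y))))"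
        by (simp only: br[OF xy(2), symmetric])
      also have "\<dots> = y \<otimes> (x \<otimes> (y \<otimes> (x \<otimes> (y \<otimes> x))))"
        using xy by (simp only: braid' br m_closed)
      also have "\<dots> = y \<otimes> (y \<otimes> (x \<otimes> (y \<otimes> (y \<otimes> x))))"
        using br[of "y \<otimes> x"] xy by simp
      finally show ?thesis .
    qed
    then show ?thesis using xy by (simp add: numeral_2_eq_2 m_assoc)
  qed
  ultimately show ?thesis
    using matrix_kernel_even[of 2 x "y \<otimes> y" h d g] xy h d g by simp
qed

end

section \<open>Reflections\<close>

lemma ip_sym: "ip X x y = ip X y x"
  by (simp add: ip_def mult.commute)

lemma ip_add_left: "ip X (\<lambda>j. x j + y j) z = ip X x z + ip X y z"
  by (simp add: ip_def sum.distrib algebra_simps)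

lemma ip_diff_left: "ip X (\<lambda>j. x j - y j) z = ip X x z - ip X y z"
  by (simp add: ip_def sum_subtractf algebra_simps)

lemma ip_scale_left: "ip X (\<lambda>j. c * x j) z = c * ip X x z"
  by (simp add: ip_def sum_distrib_left algebra_simps)

lemma ip_add_right: "ip X z (\<lambda>j. x j + y j) = ip X z x + ip X z y"
  and ip_diff_right: "ip X z (\<lambda>j. x j - y j) = ip X z x - ip X z y"
  and ip_scale_right: "ip X z (\<lambda>j. c * x j) = c * ip X z x"
  using ip_add_left ip_diff_left ip_scale_left by (simp_all add: ip_sym)

lemmas ip_linear = ip_add_left ip_diff_left ip_scale_left ip_add_right ip_diff_right ip_scale_right

lemma ip_sum_left: "ip X (\<lambda>j. \<Sum>i\<in>A. c i * x i j) y = (\<Sum>i\<in>A. c i * ip X (x i) y)"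
proof -
  have "ip X (\<lambda>j. \<Sum>i\<in>A. c i * x i j) y = (\<Sum>j = 1..ambient_dim X. \<Sum>i\<in>A. c i * (x i j * y j))"
    by (simp add: ip_def sum_distrib_right mult.assoc)
  also have "\<dots> = (\<Sum>i\<in>A. \<Sum>j = 1..ambient_dim X. c i * (x i j * y j))"
    by (rule sum.swap)
  finally show ?thesis by (simp add: ip_def sum_distrib_left)
qed

lemma ip_nonneg: "ip X x x \<ge> 0"
  by (simp add: ip_def sum_nonneg)

text \<open>\<open>ip\<close> sees only the coordinates 1 to \<open>ambient_dim X\<close>, so
  definiteness is confined to vectors supported there.\<close>

lemma ip_definite:
  assumes "ip X x x \<le> 0" "\<And>j. j \<notin> {1..ambient_dim X} \<Longrightarrow> x j = 0"
  shows "x = (\<lambda>j. 0)"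
proof -
  have "ip X x x = 0" using assms ip_nonneg[of X x] by simp
  then have "\<forall>j\<in>{1..ambient_dim X}. x j * x j = 0"
    unfolding ip_def by (subst (asm) sum_nonneg_eq_0_iff) auto
  then have "x j = 0" for j using assms(2)[of j] by (cases "j \<in> {1..ambient_dim X}") auto
  then show ?thesis by blast
qed

definition linear_vec :: "(vec \<Rightarrow> vec) \<Rightarrow> bool" where
  "linear_vec f \<longleftrightarrow> (\<forall>x y. f (\<lambda>j. x j + y j) = (\<lambda>j. f x j + f y j)) \<and>
    (\<forall>c x. f (\<lambda>j. c * x j) = (\<lambda>j. c * f x j))"

lemma linear_vec_add: "linear_vec f \<Longrightarrow> f (\<lambda>j. x j + y j) = (\<lambda>j. f x j + f y j)"
  and linear_vec_scale: "linear_vec f \<Longrightarrow> f (\<lambda>j. c * x j) = (\<lambda>j. c * f x j)"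
  by (auto simp: linear_vec_def)

lemma linear_vec_diff:
  assumes "linear_vec f"
  shows "f (\<lambda>j. x j - c * y j) = (\<lambda>j. f x j - c * f y j)"
  using linear_vec_add[OF assms, of x "\<lambda>j. (- c) * y j"] linear_vec_scale[OF assms, of "- c" y] by simp

lemma linear_vec_reflection: "linear_vec (reflection X \<gamma>)"
  by (auto simp: linear_vec_def reflection_def pairing_def ip_linear algebra_simps add_divide_distrib)

lemma pairing_scale: "pairing X (\<lambda>j. c * x j) \<gamma> = c * pairing X x \<gamma>"
  by (simp add: pairing_def ip_linear)

lemma pairing_diff: "pairing X (\<lambda>j. x j - y j) \<gamma> = pairing X x \<gamma> - pairing X y \<gamma>"
  by (simp add: pairing_def ip_linear diff_divide_distrib right_diff_distrib)

lemma pairing_self: "ip X \<gamma> \<gamma> \<noteq> 0 \<Longrightarrow> pairing X \<gamma> \<gamma> = 2"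
  by (simp add: pairing_def)

lemma pairing_scale_root: "pairing X x (\<lambda>j. c * \<gamma> j) = pairing X x \<gamma> / c"
  by (simp add: pairing_def ip_linear)

lemma reflection_scale: "c \<noteq> 0 \<Longrightarrow> reflection X (\<lambda>j. c * \<gamma> j) = reflection X \<gamma>"
  by (simp add: reflection_def fun_eq_iff pairing_scale_root)

lemma reflection_involution [simp]:
  "ip X \<gamma> \<gamma> \<noteq> 0 \<Longrightarrow> reflection X \<gamma> (reflection X \<gamma> x) = x"
  by (simp add: reflection_def pairing_diff pairing_scale pairing_self fun_eq_iff)

lemma reflection_self: "ip X \<gamma> \<gamma> \<noteq> 0 \<Longrightarrow> reflection X \<gamma> \<gamma> = (\<lambda>j. - \<gamma> j)"
  by (simp add: reflection_def pairing_self)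

lemma ip_reflection:
  assumes "ip X \<gamma> \<gamma> \<noteq> 0"
  shows "ip X (reflection X \<gamma> x) (reflection X \<gamma> y) = ip X x y"
proof -
  let ?p = "pairing X x \<gamma>" and ?q = "pairing X y \<gamma>"
  have "?p * ip X \<gamma> \<gamma> = 2 * ip X x \<gamma>" "?q * ip X \<gamma> \<gamma> = 2 * ip X y \<gamma>"
    using assms by (simp_all add: pairing_def)
  moreover have "ip X (reflection X \<gamma> x) (reflection X \<gamma> y) =
      ip X x y - ?q * ip X x \<gamma> - ?p * ip X y \<gamma> + ?p * (?q * ip X \<gamma> \<gamma>)"
    by (simp add: reflection_def ip_linear ip_sym[of X \<gamma> y] right_diff_distrib)
  ultimately show ?thesis by (simp add: pairing_def)
qed

lemma bij_reflection: "ip X \<gamma> \<gamma> \<noteq> 0 \<Longrightarrow> bij (reflection X \<gamma>)"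
  by (rule o_bij[of "reflection X \<gamma>"]) auto

text \<open>Applied to Weyl group elements and to the dualities F; the latter rescale lengths but
  preserve pairings.\<close>

lemma reflection_conj:
  assumes "linear_vec f" "\<And>y. pairing X' (f y) (f \<gamma>) = pairing X y \<gamma>"
  shows "f (reflection X \<gamma> x) = reflection X' (f \<gamma>) (f x)"
  by (simp add: reflection_def linear_vec_diff[OF assms(1)] assms(2))

lemma weyl_prod_Nil [simp]: "weyl_prod X [] = id"
  by (simp add: weyl_prod_def)

lemma weyl_prod_Cons: "weyl_prod X (i # is) = reflection X (simple_root X i) \<circ> weyl_prod X is"
  by (simp add: weyl_prod_def)

lemma weyl_prod_append: "weyl_prod X (is @ js) = weyl_prod X is \<circ> weyl_prod X js"
  by (induction "is") (simp_all add: weyl_prod_Cons comp_assoc)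

lemma linear_vec_weyl_prod: "linear_vec (weyl_prod X is)"
proof (induction "is")
  case (Cons i "is")
  then show ?case using linear_vec_reflection[of X "simple_root X i"]
    by (simp add: linear_vec_def weyl_prod_Cons)
qed (simp add: linear_vec_def)

section \<open>Obtuse bases of integral lattices\<close>

text \<open>An obtuse basis of a lattice whose norms are multiples of t. The factors \<kappa> do not
  change the reflections, so one Weyl group acts both on the root lattice and on the rescaled coroot
  lattice. Pairing with \<rho> is an integral height.\<close>

locale simple_system =
  fixes X :: cartan_type and a :: "nat \<Rightarrow> vec" and \<kappa> :: "nat \<Rightarrow> real" and t :: real and \<rho> :: vec
  assumes t_pos: "t > 0"
    and scaled: "i \<in> {1..rank X} \<Longrightarrow> \<kappa> i > 0 \<and> a i = (\<lambda>j. \<kappa> i * simple_root X i j)"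
    and support: "i \<in> {1..rank X} \<Longrightarrow> j \<notin> {1..ambient_dim X} \<Longrightarrow> simple_root X i j = 0"
    and norm: "i \<in> {1..rank X} \<Longrightarrow> \<exists>k::nat. ip X (a i) (a i) = real k * t"
    and cartan: "i \<in> {1..rank X} \<Longrightarrow> j \<in> {1..rank X} \<Longrightarrow> i \<noteq> j \<Longrightarrow>
      pairing X (a i) (a j) \<in> \<int> \<and> pairing X (a i) (a j) \<le> 0"
    and height: "i \<in> {1..rank X} \<Longrightarrow> ip X (a i) \<rho> \<in> \<int> \<and> ip X (a i) \<rho> > 0"
    and connected: "Z \<subseteq> {1..rank X} \<Longrightarrow> Z \<noteq> {} \<Longrightarrow> Z \<noteq> {1..rank X} \<Longrightarrow>
      \<exists>i\<in>Z. \<exists>j\<in>{1..rank X} - Z. ip X (simple_root X i) (simple_root X j) \<noteq> 0"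
begin

abbreviation "I \<equiv> {1..rank X}"

declare atLeastAtMost_iff [simp del] One_nat_def [simp del]

definition comb :: "(nat \<Rightarrow> real) \<Rightarrow> vec" where
  "comb b = (\<lambda>j. \<Sum>i\<in>I. b i * a i j)"

definition integral :: "(nat \<Rightarrow> real) \<Rightarrow> bool" where
  "integral b \<longleftrightarrow> (\<forall>i\<in>I. b i \<in> \<int>)"

definition dominant :: "vec \<Rightarrow> bool" where
  "dominant v \<longleftrightarrow> (\<forall>i\<in>I. ip X v (a i) \<ge> 0)"

lemma a_support: "i \<in> I \<Longrightarrow> j \<notin> {1..ambient_dim X} \<Longrightarrow> a i j = 0"
  using scaled support by simp

lemma comb_support: "j \<notin> {1..ambient_dim X} \<Longrightarrow> comb b j = 0"
  unfolding comb_def by (rule sum.neutral) (use a_support in auto)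

lemma comb_definite: "ip X (comb b) (comb b) \<le> 0 \<Longrightarrow> comb b = (\<lambda>j. 0)"
  using ip_definite comb_support by blast

lemma ip_comb_left: "ip X (comb b) y = (\<Sum>i\<in>I. b i * ip X (a i) y)"
  unfolding comb_def by (rule ip_sum_left)

lemma ip_comb_right: "ip X y (comb b) = (\<Sum>i\<in>I. b i * ip X y (a i))"
  using ip_comb_left[of b y] by (simp add: ip_sym)

lemma comb_add: "comb (\<lambda>i. b i + c i) = (\<lambda>j. comb b j + comb c j)"
  by (simp add: comb_def algebra_simps sum.distrib)

lemma comb_diff: "comb (\<lambda>i. b i - c i) = (\<lambda>j. comb b j - comb c j)"
  by (simp add: comb_def algebra_simps sum_subtractf)

lemma comb_scale: "comb (\<lambda>i. r * b i) = (\<lambda>j. r * comb b j)"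
  by (simp add: comb_def sum_distrib_left mult.assoc)

lemma comb_cong: "(\<And>i. i \<in> I \<Longrightarrow> b i = c i) \<Longrightarrow> comb b = comb c"
  by (simp add: comb_def)

lemma comb_unit: "i \<in> I \<Longrightarrow> comb (\<lambda>k. if k = i then r else 0) = (\<lambda>j. r * a i j)"
  by (simp add: comb_def if_distrib[of "\<lambda>x. x * _"] sum.delta cong: if_cong)

lemma norm_pos: "i \<in> I \<Longrightarrow> ip X (a i) (a i) > 0"
proof (rule ccontr)
  assume i: "i \<in> I" and "\<not> ip X (a i) (a i) > 0"
  then have "a i = (\<lambda>j. 0)" using a_support[OF i] by (intro ip_definite[of X]) auto
  then show False using height[OF i] by (simp add: ip_def)
qed

lemma obtuse: "i \<in> I \<Longrightarrow> j \<in> I \<Longrightarrow> i \<noteq> j \<Longrightarrow> ip X (a i) (a j) \<le> 0"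
  using cartan[of i j] norm_pos[of j] by (simp add: pairing_def divide_le_0_iff)

text \<open>Disjoint supports leave only inner products of different basis vectors.\<close>

lemma obtuse_comb:
  assumes "\<And>i. i \<in> I \<Longrightarrow> b i \<ge> 0" "\<And>i. i \<in> I \<Longrightarrow> c i \<ge> 0" "\<And>i. i \<in> I \<Longrightarrow> b i = 0 \<or> c i = 0"
  shows "ip X (comb b) (comb c) \<le> 0"
  unfolding ip_comb_left
  unfolding ip_comb_right sum_distrib_left
proof (intro sum_nonpos)
  fix i j assume ij: "i \<in> I" "j \<in> I"
  show "b i * (c j * ip X (a i) (a j)) \<le> 0"
  proof (cases "i = j")
    case True
    then show ?thesis using assms(3)[OF ij(1)] by auto
  next
    case False
    have "c j * ip X (a i) (a j) \<le> 0"
      using obtuse[OF ij False] assms(2)[OF ij(2)] by (rule mult_nonneg_nonpos[rotated])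
    then show ?thesis using assms(1)[OF ij(1)] by (rule mult_nonneg_nonpos[rotated])
  qed
qed

text \<open>Pairing with \<rho> turns the relation into a vanishing sum of nonnegative
  terms.\<close>

lemma nonneg_comb_zero:
  assumes "\<And>i. i \<in> I \<Longrightarrow> b i \<ge> 0" "comb b = (\<lambda>j. 0)" "i \<in> I"
  shows "b i = 0"
proof -
  have "(\<Sum>i\<in>I. b i * ip X (a i) \<rho>) = 0"
    using assms(2) ip_comb_left[of b \<rho>] by (simp add: ip_def)
  then have "\<forall>i\<in>I. b i * ip X (a i) \<rho> = 0"
    using assms(1) height by (subst (asm) sum_nonneg_eq_0_iff) (auto simp: less_imp_le)
  then show ?thesis using height[OF assms(3)] assms(3) by auto
qed

definition pos_part :: "(nat \<Rightarrow> real) \<Rightarrow> nat \<Rightarrow> real" where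
  "pos_part b = (\<lambda>i. max (b i) 0)"

definition neg_part :: "(nat \<Rightarrow> real) \<Rightarrow> nat \<Rightarrow> real" where
  "neg_part b = (\<lambda>i. max (- b i) 0)"

lemma parts_nonneg: "pos_part b i \<ge> 0" "neg_part b i \<ge> 0"
  by (simp_all add: pos_part_def neg_part_def)

lemma comb_parts: "comb b = (\<lambda>j. comb (pos_part b) j - comb (neg_part b) j)"
  unfolding comb_diff[symmetric] by (rule comb_cong) (simp add: pos_part_def neg_part_def)

lemma parts_obtuse: "ip X (comb (pos_part b)) (comb (neg_part b)) \<le> 0"
  by (rule obtuse_comb) (auto simp: pos_part_def neg_part_def)

lemma parts_integral: "integral b \<Longrightarrow> integral (pos_part b)" "integral b \<Longrightarrow> integral (neg_part b)"
  by (auto simp: integral_def pos_part_def neg_part_def max_def)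

lemma pos_part_zeroD: "comb (pos_part b) = (\<lambda>j. 0) \<Longrightarrow> i \<in> I \<Longrightarrow> b i \<le> 0"
  using nonneg_comb_zero[of "pos_part b" i] parts_nonneg by (simp add: pos_part_def max_def split: if_splits)

lemma neg_part_zeroD: "comb (neg_part b) = (\<lambda>j. 0) \<Longrightarrow> i \<in> I \<Longrightarrow> b i \<ge> 0"
  using nonneg_comb_zero[of "neg_part b" i] parts_nonneg by (simp add: neg_part_def max_def split: if_splits)

text \<open>A relation equates the positive and the negative part of b - c; their common value v has
  (v, v) \<le> 0 by obtuseness.\<close>

lemma independent:
  assumes "comb b = comb c" "i \<in> I"
  shows "b i = c i"
proof -
  let ?d = "\<lambda>i. b i - c i"
  have "comb ?d = (\<lambda>j. 0)" using assms by (simp add: comb_diff)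
  then have eq: "comb (pos_part ?d) = comb (neg_part ?d)"
    using comb_parts[of ?d] by (simp add: fun_eq_iff)
  then have "ip X (comb (pos_part ?d)) (comb (pos_part ?d)) \<le> 0"
    using parts_obtuse[of ?d] by simp
  then have "comb (pos_part ?d) = (\<lambda>j. 0)" by (rule comb_definite)
  then show ?thesis using pos_part_zeroD neg_part_zeroD assms(2) eq by fastforce
qed

lemma pairing_int: "i \<in> I \<Longrightarrow> j \<in> I \<Longrightarrow> pairing X (a i) (a j) \<in> \<int>"
  using cartan[of i j] norm_pos[of j] by (cases "i = j") (auto simp: pairing_self)

text \<open>Adding r a_k to v contributes the cross term r n (a_k, a_k) with n =
  \<open>pairing X v (a k)\<close> an integer, again a multiple of t.\<close>

lemma lattice_norm:
  assumes "integral b"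
  shows "\<exists>m::int. ip X (comb b) (comb b) = m * t"
proof -
  have "\<exists>m::int. ip X (\<lambda>j. \<Sum>i\<in>F. b i * a i j) (\<lambda>j. \<Sum>i\<in>F. b i * a i j) = m * t" if "F \<subseteq> I" for F
  proof -
    have "finite F" using that finite_subset by blast
    then show ?thesis using that
    proof (induction F)
      case empty
      then show ?case by (auto simp: ip_def intro: exI[of _ 0])
    next
      case (insert k F)
      define v where "v = (\<lambda>j. \<Sum>i\<in>F. b i * a i j)"
      obtain m :: int where m: "ip X v v = m * t" using insert v_def by auto
      obtain l :: nat where l: "ip X (a k) (a k) = l * t" using norm[of k] insert by auto
      have "b k \<in> \<int>" using assms insert by (auto simp: integral_def)
      then obtain r where r: "b k = of_int r" by (rule Ints_cases)
      have "pairing X v (a k) = (\<Sum>i\<in>F. b i * pairing X (a i) (a k))"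
        unfolding v_def pairing_def ip_sum_left by (simp add: sum_distrib_left sum_divide_distrib mult.left_commute)
      also have "\<dots> \<in> \<int>"
        using insert assms by (intro Ints_sum Ints_mult pairing_int) (auto simp: integral_def)
      finally obtain n where "pairing X v (a k) = of_int n" by (rule Ints_cases)
      moreover have "2 * ip X v (a k) = pairing X v (a k) * ip X (a k) (a k)"
        using norm_pos[of k] insert by (simp add: pairing_def)
      ultimately have "2 * ip X v (a k) = n * (l * t)" by (simp add: l)
      moreover have "(\<lambda>j. \<Sum>i\<in>insert k F. b i * a i j) = (\<lambda>j. v j + b k * a k j)"
        using insert by (simp add: v_def add.commute)
      ultimately have "ip X (\<lambda>j. \<Sum>i\<in>insert k F. b i * a i j) (\<lambda>j. \<Sum>i\<in>insert k F. b i * a i j) =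
          of_int (m + r * n * int l + r * r * int l) * t"
        using m l by (simp add: ip_linear r ip_sym[of X "a k" v] algebra_simps)
      then show ?case by blast
    qed
  qed
  from this[of I] show ?thesis by (simp add: comb_def)
qed

lemma lattice_norm_ge:
  assumes "integral b" "comb b \<noteq> (\<lambda>j. 0)"
  shows "ip X (comb b) (comb b) \<ge> t"
proof -
  obtain m :: int where m: "ip X (comb b) (comb b) = m * t" using lattice_norm assms by blast
  have "ip X (comb b) (comb b) > 0" using comb_definite[of b] assms by force
  then have "m \<ge> 1" using m t_pos by (simp add: zero_less_mult_iff)
  then have "1 * t \<le> m * t" using t_pos by (intro mult_right_mono) auto
  then show ?thesis using m by simp
qed

text \<open>If both parts were nonzero, each would have norm at least t, and the obtuse angle
  between them would push the norm of their difference to 2 t.\<close>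

lemma dichotomy:
  assumes "integral b" "ip X (comb b) (comb b) = t"
  shows "(\<forall>i\<in>I. b i \<ge> 0) \<or> (\<forall>i\<in>I. b i \<le> 0)"
proof (rule ccontr)
  assume "\<not> ?thesis"
  then have "comb (pos_part b) \<noteq> (\<lambda>j. 0)" "comb (neg_part b) \<noteq> (\<lambda>j. 0)"
    using pos_part_zeroD neg_part_zeroD by blast+
  then have "ip X (comb (pos_part b)) (comb (pos_part b)) \<ge> t"
      "ip X (comb (neg_part b)) (comb (neg_part b)) \<ge> t"
    using parts_integral[OF assms(1)] lattice_norm_ge by blast+
  moreover have "t = ip X (comb (pos_part b)) (comb (pos_part b)) + ip X (comb (neg_part b)) (comb (neg_part b))
      - 2 * ip X (comb (pos_part b)) (comb (neg_part b))"
    unfolding assms(2)[symmetric]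
    by (subst (1 2) comb_parts[of b]) (simp add: ip_linear ip_sym[of X "comb (neg_part b)" "comb (pos_part b)"])
  ultimately show False using parts_obtuse[of b] t_pos by linarith
qed

lemma dominant_comb_nonneg: "dominant v \<Longrightarrow> (\<And>i. i \<in> I \<Longrightarrow> c i \<ge> 0) \<Longrightarrow> ip X v (comb c) \<ge> 0"
  unfolding ip_comb_right dominant_def by (intro sum_nonneg mult_nonneg_nonneg) auto

text \<open>For the positive and negative parts p and n, dominance gives 0 \<le> (p, n) - (n, n),
  while (p, n) \<le> 0.\<close>

lemma dominant_nonneg:
  assumes "dominant (comb b)" "i \<in> I"
  shows "b i \<ge> 0"
proof (rule neg_part_zeroD[OF _ assms(2)], rule comb_definite)
  have "0 \<le> ip X (comb b) (comb (neg_part b))"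
    using assms parts_nonneg by (intro dominant_comb_nonneg) auto
  also have "\<dots> = ip X (comb (pos_part b)) (comb (neg_part b)) -
      ip X (comb (neg_part b)) (comb (neg_part b))"
    by (subst comb_parts[of b]) (simp add: ip_linear)
  finally show "ip X (comb (neg_part b)) (comb (neg_part b)) \<le> 0"
    using parts_obtuse[of b] by linarith
qed

text \<open>Otherwise connectedness yields a vanishing coefficient at k adjacent to a positive one
  at l, and the inner product with a_k becomes negative.\<close>

lemma dominant_full:
  assumes dom: "dominant (comb b)" and nz: "comb b \<noteq> (\<lambda>j. 0)" and "i \<in> I"
  shows "b i > 0"
proof (rule ccontr)
  assume "\<not> b i > 0"
  define Z where "Z = {i \<in> I. b i = 0}"
  have "i \<in> Z" using \<open>\<not> b i > 0\<close> dominant_nonneg[OF dom \<open>i \<in> I\<close>] \<open>i \<in> I\<close> by (simp add: Z_def)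
  moreover have "Z \<noteq> I"
  proof
    assume "Z = I"
    then have "comb b = comb (\<lambda>i. 0)" by (intro comb_cong) (auto simp: Z_def)
    then show False using nz by (simp add: comb_def)
  qed
  ultimately obtain k l where kl: "k \<in> Z" "l \<in> I - Z" "ip X (simple_root X k) (simple_root X l) \<noteq> 0"
    using connected[of Z] by (auto simp: Z_def)
  have g: "ip X (a l) (a k) < 0"
  proof -
    have "k \<in> I" "l \<in> I" "l \<noteq> k" using kl by (auto simp: Z_def)
    moreover have "ip X (a l) (a k) = \<kappa> l * \<kappa> k * ip X (simple_root X k) (simple_root X l)"
      using scaled[of k] scaled[of l] \<open>k \<in> I\<close> \<open>l \<in> I\<close>
      by (simp add: ip_linear ip_sym[of X "simple_root X l" "simple_root X k"])
    ultimately have "ip X (a l) (a k) \<noteq> 0" using kl(3) scaled[of k] scaled[of l] by auto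
    then show ?thesis using obtuse[OF \<open>l \<in> I\<close> \<open>k \<in> I\<close> \<open>l \<noteq> k\<close>] by simp
  qed
  have le: "b m * ip X (a m) (a k) \<le> 0" if "m \<in> I" for m
    using that kl obtuse[of m k] dominant_nonneg[OF dom that]
    by (cases "m = k") (auto simp: Z_def mult_nonneg_nonpos)
  have "ip X (comb b) (a k) = (\<Sum>m\<in>I - {l}. b m * ip X (a m) (a k)) + b l * ip X (a l) (a k)"
    unfolding ip_comb_left using kl by (subst sum.remove[of I l]) auto
  moreover have "(\<Sum>m\<in>I - {l}. b m * ip X (a m) (a k)) \<le> 0"
    using le by (intro sum_nonpos) auto
  moreover have "b l > 0" using kl dominant_nonneg[OF dom, of l] by (auto simp: Z_def)
  ultimately have "ip X (comb b) (a k) < 0" using g mult_pos_neg[of "b l" "ip X (a l) (a k)"] by linarith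
  then show False using dom kl by (auto simp: dominant_def Z_def)
qed

text \<open>Writing \<open>\<beta> = \<theta> - p + n\<close> with \<open>p\<close> and \<open>n\<close> nonnegative of disjoint supports, the norm of
  \<open>\<beta>\<close> is at least \<open>|\<theta> - p|\<^sup>2 + |n|\<^sup>2\<close>, so minimality of the norm of \<open>\<beta>\<close> forces \<open>n = 0\<close>.\<close>

lemma minimal_le_dominant:
  assumes m: "dominant (comb m)" "comb m \<noteq> (\<lambda>j. 0)" "integral m"
    and b: "integral b" "ip X (comb b) (comb b) = t" and "i \<in> I"
  shows "b i \<le> m i"
proof -
  let ?c = "\<lambda>i. m i - b i"
  let ?p = "comb (pos_part ?c)" and ?n = "comb (neg_part ?c)"
  have "integral ?c" using m b by (auto simp: integral_def)
  have "?n = (\<lambda>j. 0)"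
  proof (rule ccontr)
    assume "?n \<noteq> (\<lambda>j. 0)"
    then have n: "ip X ?n ?n \<ge> t" using lattice_norm_ge parts_integral[OF \<open>integral ?c\<close>] by blast
    have "comb b = (\<lambda>j. (comb m j - ?p j) + ?n j)"
      using comb_parts[of ?c] by (simp add: comb_diff fun_eq_iff algebra_simps)
    then have "t = ip X (\<lambda>j. comb m j - ?p j) (\<lambda>j. comb m j - ?p j) + ip X ?n ?n
        + 2 * ip X (comb m) ?n - 2 * ip X ?p ?n"
      using b(2) by (simp add: ip_linear ip_sym[of X ?n "comb m"] ip_sym[of X ?n ?p] ip_sym[of X ?p "comb m"])
    moreover have "ip X (comb m) ?n \<ge> 0"
      using m parts_nonneg by (intro dominant_comb_nonneg) auto
    ultimately have "ip X (\<lambda>j. comb m j - ?p j) (\<lambda>j. comb m j - ?p j) \<le> 0"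
      using n parts_obtuse[of ?c] by linarith
    then have "comb (\<lambda>i. m i - pos_part ?c i) = (\<lambda>j. 0)"
      by (intro comb_definite) (simp add: comb_diff)
    \<comment> \<open>In the extreme case \<theta> = p, the full support of \<theta> makes every m i
      - b i positive, so n vanishes all the same.\<close>
    then have eq: "comb m = ?p" by (simp add: comb_diff fun_eq_iff)
    have "?c i \<ge> 0" if "i \<in> I" for i
      using independent[OF eq that] dominant_full[OF m(1,2) that] by (simp add: pos_part_def max_def split: if_splits)
    then have "?n = comb (\<lambda>i. 0)" by (intro comb_cong) (auto simp: neg_part_def)
    then show False using \<open>?n \<noteq> (\<lambda>j. 0)\<close> by (simp add: comb_def)
  qed
  then show ?thesis using neg_part_zeroD[of ?c i] \<open>i \<in> I\<close> by simp
qed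

lemma dominant_minimal_unique:
  assumes "dominant (comb m)" "integral m" "ip X (comb m) (comb m) = t"
    and "dominant (comb b)" "integral b" "ip X (comb b) (comb b) = t"
  shows "comb m = comb b"
proof -
  have "comb m \<noteq> (\<lambda>j. 0)" "comb b \<noteq> (\<lambda>j. 0)"
    using assms t_pos by (auto simp: ip_def)
  then have "b i \<le> m i" "m i \<le> b i" if "i \<in> I" for i
    using minimal_le_dominant assms that by blast+
  then show ?thesis by (intro comb_cong) (simp add: order_antisym)
qed

lemma reflection_a: "i \<in> I \<Longrightarrow> reflection X (simple_root X i) = reflection X (a i)"
  using scaled[of i] reflection_scale[of "\<kappa> i" X "simple_root X i"] by simp

lemma root_norm_pos: "i \<in> I \<Longrightarrow> ip X (simple_root X i) (simple_root X i) > 0"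
  using scaled[of i] norm_pos[of i] by (simp add: ip_linear zero_less_mult_iff)

lemma ip_weyl: "set is \<subseteq> I \<Longrightarrow> ip X (weyl_prod X is x) (weyl_prod X is y) = ip X x y"
proof (induction "is")
  case (Cons i "is")
  then show ?case using root_norm_pos[of i] by (simp add: weyl_prod_Cons ip_reflection)
qed simp

lemma reflection_lattice:
  assumes "i \<in> I" "integral b"
  shows "\<exists>c. integral c \<and> reflection X (simple_root X i) (comb b) = comb c"
proof -
  let ?r = "pairing X (comb b) (a i)"
  have "?r = (\<Sum>k\<in>I. b k * pairing X (a k) (a i))"
    by (simp add: pairing_def ip_comb_left sum_distrib_left sum_divide_distrib mult.left_commute)
  also have "\<dots> \<in> \<int>"
    using assms by (intro Ints_sum Ints_mult pairing_int) (auto simp: integral_def)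
  finally have "integral (\<lambda>k. b k - (if k = i then ?r else 0))"
    using assms by (auto simp: integral_def)
  moreover have "reflection X (simple_root X i) (comb b) = comb (\<lambda>k. b k - (if k = i then ?r else 0))"
    using assms by (simp add: reflection_a comb_diff comb_unit) (simp add: reflection_def)
  ultimately show ?thesis by blast
qed

lemma weyl_lattice:
  "set is \<subseteq> I \<Longrightarrow> integral b \<Longrightarrow> \<exists>c. integral c \<and> weyl_prod X is (comb b) = comb c"
proof (induction "is")
  case (Cons i "is")
  then obtain c where "integral c" "weyl_prod X is (comb b) = comb c" by auto
  then show ?case using reflection_lattice[of i c] Cons by (auto simp: weyl_prod_Cons)
qed auto

text \<open>A translate of maximal height is dominant.\<close>

lemma exists_dominant:
  assumes "integral b"
  shows "\<exists>is. set is \<subseteq> I \<and> dominant (weyl_prod X is (comb b))"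
proof -
  define ht where "ht is = ip X (weyl_prod X is (comb b)) \<rho>" for "is"
  \<comment> \<open>Expanding |v - \<rho>|^2 \<ge> 0 bounds 2 (v, \<rho>) by |v|^2 + |\<rho>|^2, and
    |v| is constant along the orbit.\<close>
  define B where "B = \<lceil>(ip X (comb b) (comb b) + ip X \<rho> \<rho>) / 2\<rceil>"
  have ht_int: "ht is \<in> \<int>" if "set is \<subseteq> I" for "is"
  proof -
    obtain c where "integral c" "weyl_prod X is (comb b) = comb c"
      using weyl_lattice assms \<open>set is \<subseteq> I\<close> by blast
    then show ?thesis unfolding ht_def
      by (simp add: ip_comb_left, intro Ints_sum Ints_mult) (use height in \<open>auto simp: integral_def\<close>)
  qed
  have ht_le: "ht is \<le> of_int B" if "set is \<subseteq> I" for "is"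
  proof -
    let ?v = "weyl_prod X is (comb b)"
    have "0 \<le> ip X (\<lambda>j. ?v j - \<rho> j) (\<lambda>j. ?v j - \<rho> j)" by (rule ip_nonneg)
    also have "\<dots> = ip X ?v ?v + ip X \<rho> \<rho> - 2 * ip X ?v \<rho>"
      by (simp add: ip_linear ip_sym[of X \<rho> ?v])
    also have "ip X ?v ?v = ip X (comb b) (comb b)" using that by (rule ip_weyl)
    finally have "ht is \<le> (ip X (comb b) (comb b) + ip X \<rho> \<rho>) / 2" by (simp add: ht_def field_simps)
    then show ?thesis unfolding B_def by linarith
  qed
  \<comment> \<open>Heights are integers bounded by B, so the defect from B is a natural number and
    attains its minimum.\<close>
  define f where "f is = nat \<lceil>of_int B - ht is\<rceil>" for "is"
  have f: "real (f is) = of_int B - ht is" if "is": "set is \<subseteq> I" for "is"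
  proof -
    obtain k where "ht is = of_int k" using ht_int[OF "is"] by (auto elim: Ints_cases)
    then show ?thesis using ht_le[OF "is"] by (simp add: f_def flip: of_int_diff)
  qed
  obtain "is" where "is": "set is \<subseteq> I" "\<And>js. set js \<subseteq> I \<Longrightarrow> f is \<le> f js"
    using ex_has_least_nat[of "\<lambda>is. set is \<subseteq> I" "[]" f] by auto
  let ?v = "weyl_prod X is (comb b)"
  have "ip X ?v (a i) \<ge> 0" if i: "i \<in> I" for i
  proof -
    have "real (f is) \<le> real (f (i # is))" using "is"(2)[of "i # is"] "is"(1) i by simp
    then have "ht (i # is) \<le> ht is" using f[of "is"] f[of "i # is"] "is"(1) i by simp
    \<comment> \<open>The reflection in a_i lowers the height by exactly this product.\<close>
    then have "pairing X ?v (a i) * ip X (a i) \<rho> \<ge> 0"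
      using i by (simp add: ht_def weyl_prod_Cons reflection_a reflection_def ip_linear)
    then show ?thesis using height[OF i] norm_pos[OF i]
      by (simp add: pairing_def zero_le_mult_iff zero_le_divide_iff)
  qed
  then show ?thesis using "is"(1) by (auto simp: dominant_def)
qed

end

section \<open>Highest roots and dominant short roots\<close>

text \<open>s and q s are the squared lengths of short and long roots; for q = 1 every root is both.
  \<rho> may be any vector with positive integral heights, which leaves room for convenient
  coordinates.\<close>

locale root_datum =
  fixes X :: cartan_type and s :: real and q :: nat and \<rho> :: vec
  assumes s_pos: "s > 0" and q: "q = 1 \<or> q = 2 \<or> q = 3"
    and norms: "i \<in> {1..rank X} \<Longrightarrow> ip X (simple_root X i) (simple_root X i) = s \<or>
      ip X (simple_root X i) (simple_root X i) = q * s"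
    and short_ex: "\<exists>i\<in>{1..rank X}. ip X (simple_root X i) (simple_root X i) = s"
    and long_ex: "\<exists>i\<in>{1..rank X}. ip X (simple_root X i) (simple_root X i) = q * s"
    and simple_pairing: "i \<in> {1..rank X} \<Longrightarrow> j \<in> {1..rank X} \<Longrightarrow> i \<noteq> j \<Longrightarrow>
      pairing X (simple_root X i) (simple_root X j) \<in> \<int> \<and>
      pairing X (simple_root X i) (simple_root X j) \<le> 0"
    and simple_bond: "i \<in> {1..rank X} \<Longrightarrow> j \<in> {1..rank X} \<Longrightarrow> i \<noteq> j \<Longrightarrow>
      pairing X (simple_root X i) (simple_root X j) * pairing X (simple_root X j) (simple_root X i) < 4"
    and simple_height: "i \<in> {1..rank X} \<Longrightarrow>
      ip X (simple_root X i) \<rho> \<in> \<int> \<and> ip X (simple_root X i) \<rho> > 0"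
    and simple_support: "i \<in> {1..rank X} \<Longrightarrow> j \<notin> {1..ambient_dim X} \<Longrightarrow> simple_root X i j = 0"
    and diagram_connected: "Z \<subseteq> {1..rank X} \<Longrightarrow> Z \<noteq> {} \<Longrightarrow> Z \<noteq> {1..rank X} \<Longrightarrow>
      \<exists>i\<in>Z. \<exists>j\<in>{1..rank X} - Z. ip X (simple_root X i) (simple_root X j) \<noteq> 0"
begin

text \<open>The lattice spanned by the \<open>colength i\<close>-fold multiples of the simple roots is the coroot
  lattice up to scaling; its vectors of minimal norm include the long roots.\<close>

definition colength :: "nat \<Rightarrow> real" where
  "colength i = (if ip X (simple_root X i) (simple_root X i) = q * s then 1 else q)"

lemma q_pos: "q > 0" "real q * s > 0"
  using q s_pos by auto

lemma colength_norm:
  "i \<in> {1..rank X} \<Longrightarrow> colength i * ip X (simple_root X i) (simple_root X i) = q * s"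
  using norms[of i] by (auto simp: colength_def)

lemma colength_pos: "colength i > 0" "colength i \<in> \<int>"
  using q_pos by (auto simp: colength_def)

sublocale short: simple_system X "simple_root X" "\<lambda>_. 1" s \<rho>
proof
  show "\<exists>k::nat. ip X (simple_root X i) (simple_root X i) = real k * s" if "i \<in> {1..rank X}" for i
    using norms[OF that] by (auto intro: exI[of _ 1])
qed (use s_pos simple_support simple_pairing simple_height diagram_connected in auto)

sublocale long: simple_system X "\<lambda>i j. colength i * simple_root X i j" colength "q * s" \<rho>
proof
  fix i assume i: "i \<in> {1..rank X}"
  show "\<exists>k::nat. ip X (\<lambda>j. colength i * simple_root X i j) (\<lambda>j. colength i * simple_root X i j) = k * (q * s)"
    using colength_norm[OF i]
    by (intro exI[of _ "if ip X (simple_root X i) (simple_root X i) = q * s then 1 else q"])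
       (auto simp: ip_linear colength_def)
  fix j assume j: "j \<in> {1..rank X}" and "i \<noteq> j"
  \<comment> \<open>Rescaling transposes the Cartan matrix, because \<open>colength i\<close> times
    the norm of the i-th simple root is always q s.\<close>
  have "pairing X (\<lambda>k. colength i * simple_root X i k) (\<lambda>k. colength j * simple_root X j k) =
      colength i * (2 * ip X (simple_root X i) (simple_root X j)) /
      (colength j * ip X (simple_root X j) (simple_root X j))"
    using colength_pos[of j] by (simp add: pairing_def ip_linear)
  also have "\<dots> = colength i * (2 * ip X (simple_root X j) (simple_root X i)) /
      (colength i * ip X (simple_root X i) (simple_root X i))"
    using colength_norm[OF i] colength_norm[OF j] by (simp add: ip_sym[of X "simple_root X j" "simple_root X i"])
  also have "\<dots> = pairing X (simple_root X j) (simple_root X i)"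
    using colength_pos[of i] by (simp add: pairing_def)
  finally show "pairing X (\<lambda>k. colength i * simple_root X i k) (\<lambda>k. colength j * simple_root X j k) \<in> \<int> \<and>
      pairing X (\<lambda>k. colength i * simple_root X i k) (\<lambda>k. colength j * simple_root X j k) \<le> 0"
    using simple_pairing[OF j i] \<open>i \<noteq> j\<close> by simp
next
  fix i assume "i \<in> {1..rank X}"
  then show "ip X (\<lambda>j. colength i * simple_root X i j) \<rho> \<in> \<int> \<and> ip X (\<lambda>j. colength i * simple_root X i j) \<rho> > 0"
    using simple_height colength_pos[of i] by (simp add: ip_linear)
qed (use q_pos colength_pos simple_support diagram_connected in auto)

abbreviation "I \<equiv> {1..rank X}"

declare atLeastAtMost_iff [simp del] One_nat_def [simp del]

lemma long_dominant: "long.dominant v \<longleftrightarrow> short.dominant v"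
  unfolding long.dominant_def short.dominant_def
  using mult_le_cancel_left_pos[OF colength_pos(1), of _ 0] by (simp add: ip_linear)

lemma rootE:
  assumes "\<beta> \<in> roots X"
  obtains "is" i where "set is \<subseteq> I" "i \<in> I" "\<beta> = weyl_prod X is (simple_root X i)"
  using assms by (auto simp: roots_def)

lemma rootI: "set is \<subseteq> I \<Longrightarrow> i \<in> I \<Longrightarrow> weyl_prod X is (simple_root X i) \<in> roots X"
  by (auto simp: roots_def)

lemma simple_root_in_roots: "i \<in> I \<Longrightarrow> simple_root X i \<in> roots X"
  using rootI[of "[]" i] by simp

lemma weyl_root:
  assumes "\<beta> \<in> roots X" "set is \<subseteq> I"
  shows "weyl_prod X is \<beta> \<in> roots X"
proof -
  obtain js i where "set js \<subseteq> I" "i \<in> I" "\<beta> = weyl_prod X js (simple_root X i)"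
    using assms(1) by (rule rootE)
  then show ?thesis using rootI[of "is @ js" i] assms(2) by (simp add: weyl_prod_append)
qed

lemma root_norm:
  assumes "\<beta> \<in> roots X"
  shows "ip X \<beta> \<beta> = s \<or> ip X \<beta> \<beta> = q * s"
proof -
  obtain js i where "set js \<subseteq> I" "i \<in> I" "\<beta> = weyl_prod X js (simple_root X i)"
    using assms by (rule rootE)
  then show ?thesis using norms[of i] by (simp add: short.ip_weyl)
qed

lemma root_norm_pos: "\<beta> \<in> roots X \<Longrightarrow> ip X \<beta> \<beta> > 0"
  using root_norm[of \<beta>] s_pos q_pos by auto

lemma simple_comb: "i \<in> I \<Longrightarrow> \<exists>b. short.integral b \<and> simple_root X i = short.comb b"
  using short.comb_unit[of i 1]
  by (intro exI[of _ "\<lambda>k. if k = i then 1 else 0"]) (auto simp: short.integral_def)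

lemma root_comb:
  assumes "\<beta> \<in> roots X"
  shows "\<exists>b. short.integral b \<and> \<beta> = short.comb b"
proof -
  obtain js i where "set js \<subseteq> I" "i \<in> I" "\<beta> = weyl_prod X js (simple_root X i)"
    using assms by (rule rootE)
  then show ?thesis using simple_comb[of i] short.weyl_lattice[of js] by auto
qed

lemma long_simple_comb:
  assumes "i \<in> I" "ip X (simple_root X i) (simple_root X i) = q * s"
  shows "\<exists>b. long.integral b \<and> simple_root X i = long.comb b"
  using long.comb_unit[of i 1] assms
  by (intro exI[of _ "\<lambda>k. if k = i then 1 else 0"]) (auto simp: long.integral_def colength_def)

lemma long_root_comb:
  assumes "\<beta> \<in> roots X" "ip X \<beta> \<beta> = q * s"
  shows "\<exists>b. long.integral b \<and> \<beta> = long.comb b"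
proof -
  obtain js i where *: "set js \<subseteq> I" "i \<in> I" "\<beta> = weyl_prod X js (simple_root X i)"
    using assms(1) by (rule rootE)
  then have "ip X (simple_root X i) (simple_root X i) = q * s"
    using assms(2) by (simp add: short.ip_weyl)
  then show ?thesis using long_simple_comb[of i] long.weyl_lattice[of js] * by auto
qed

lemma root_nonzero: "\<beta> \<in> roots X \<Longrightarrow> \<beta> \<noteq> (\<lambda>j. 0)"
  using root_norm_pos[of \<beta>] by (auto simp: ip_def)

lemma root_support: "\<beta> \<in> roots X \<Longrightarrow> j \<notin> {1..ambient_dim X} \<Longrightarrow> \<beta> j = 0"
  using root_comb[of \<beta>] short.comb_support by auto

text \<open>A Weyl group element moves \<gamma> to a simple root, where integrality follows from the
  expansion of the other root in simple roots.\<close>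

lemma root_pairing_int:
  assumes "\<beta> \<in> roots X" "\<gamma> \<in> roots X"
  shows "pairing X \<beta> \<gamma> \<in> \<int>"
proof -
  have simple: "pairing X \<beta> (simple_root X i) \<in> \<int>" if \<beta>: "\<beta> \<in> roots X" and i: "i \<in> I" for \<beta> i
  proof -
    obtain b where b: "short.integral b" "\<beta> = short.comb b" using root_comb \<beta> by blast
    have "pairing X \<beta> (simple_root X i) = (\<Sum>k\<in>I. b k * pairing X (simple_root X k) (simple_root X i))"
      by (simp add: b pairing_def short.ip_comb_left sum_distrib_left sum_divide_distrib mult.left_commute)
    then show ?thesis
      using b i by (auto simp: short.integral_def intro!: Ints_sum Ints_mult short.pairing_int)
  qed
  obtain js i where *: "set js \<subseteq> I" "i \<in> I" "\<gamma> = weyl_prod X js (simple_root X i)"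
    using assms(2) by (rule rootE)
  have inverse: "weyl_prod X js (weyl_prod X (rev js) x) = x" if "set js \<subseteq> I" for js x
    using that
  proof (induction js arbitrary: x)
    case (Cons i js)
    then show ?case using short.root_norm_pos[of i] by (simp add: weyl_prod_Cons weyl_prod_append)
  qed simp
  have "pairing X \<beta> \<gamma> = pairing X (weyl_prod X js (weyl_prod X (rev js) \<beta>)) (weyl_prod X js (simple_root X i))"
    using * by (simp add: inverse)
  also have "\<dots> = pairing X (weyl_prod X (rev js) \<beta>) (simple_root X i)"
    using * by (simp add: pairing_def short.ip_weyl)
  finally show ?thesis using simple[of "weyl_prod X (rev js) \<beta>" i] weyl_root assms(1) * by simp
qed

definition is_highest :: "vec \<Rightarrow> bool" where
  "is_highest \<phi> \<longleftrightarrow> \<phi> \<in> roots X \<and> (\<forall>\<beta>\<in>roots X. \<exists>c :: nat \<Rightarrow> nat.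
       \<forall>j. \<phi> j - \<beta> j = (\<Sum>i = 1..rank X. real (c i) * simple_root X i j))"

lemma is_highest_iff_comb: "is_highest \<phi> \<longleftrightarrow> \<phi> \<in> roots X \<and>
    (\<forall>\<beta>\<in>roots X. \<exists>c :: nat \<Rightarrow> nat. (\<lambda>j. \<phi> j - \<beta> j) = short.comb (\<lambda>i. real (c i)))"
  by (simp add: is_highest_def short.comb_def fun_eq_iff)

lemma comb_nat:
  assumes "\<And>i. i \<in> I \<Longrightarrow> b i \<in> \<int> \<and> b i \<ge> 0"
  shows "\<exists>c :: nat \<Rightarrow> nat. short.comb b = short.comb (\<lambda>i. real (c i))"
proof (intro exI short.comb_cong)
  fix i assume "i \<in> I"
  with assms obtain k where "b i = of_int k" "b i \<ge> 0" by (meson Ints_cases)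
  then show "b i = real (nat \<lfloor>b i\<rfloor>)" by simp
qed

text \<open>A short \<beta> is compared with \<phi> in the root lattice, a long one in the rescaled
  coroot lattice: in each case \<beta> has the minimal norm that the comparison of coefficients
  requires.\<close>

lemma dominant_long_is_highest:
  assumes "\<phi> \<in> roots X" "short.dominant \<phi>" "ip X \<phi> \<phi> = q * s"
  shows "is_highest \<phi>"
  unfolding is_highest_iff_comb
proof (intro conjI ballI assms(1))
  fix \<beta> assume \<beta>: "\<beta> \<in> roots X"
  obtain m where m: "short.integral m" "\<phi> = short.comb m" using root_comb assms(1) by blast
  obtain l where l: "long.integral l" "\<phi> = long.comb l" using long_root_comb assms by blast
  from root_norm[OF \<beta>] show "\<exists>c :: nat \<Rightarrow> nat. (\<lambda>j. \<phi> j - \<beta> j) = short.comb (\<lambda>i. real (c i))"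
  proof
    assume norm: "ip X \<beta> \<beta> = s"
    obtain b where b: "short.integral b" "\<beta> = short.comb b" using root_comb \<beta> by blast
    have "b i \<le> m i" if "i \<in> I" for i
      using short.minimal_le_dominant[of m b i] assms root_nonzero[OF assms(1)] m b norm that by simp
    then have "\<exists>c :: nat \<Rightarrow> nat. short.comb (\<lambda>i. m i - b i) = short.comb (\<lambda>i. real (c i))"
      using m b by (intro comb_nat) (auto simp: short.integral_def)
    then show ?thesis using m b by (simp add: short.comb_diff)
  next
    assume norm: "ip X \<beta> \<beta> = q * s"
    obtain b where b: "long.integral b" "\<beta> = long.comb b" using long_root_comb[OF \<beta> norm] by blast
    have "b i \<le> l i" if "i \<in> I" for i
      using long.minimal_le_dominant[of l b i] assms root_nonzero[OF assms(1)] l b norm that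
      by (simp add: long_dominant)
    then have "\<exists>c :: nat \<Rightarrow> nat. short.comb (\<lambda>i. (l i - b i) * colength i) = short.comb (\<lambda>i. real (c i))"
      using l b colength_pos
      by (intro comb_nat) (auto simp: long.integral_def less_imp_le intro!: mult_nonneg_nonneg)
    moreover have "short.comb (\<lambda>i. (l i - b i) * colength i) = long.comb (\<lambda>i. l i - b i)"
      by (simp add: short.comb_def long.comb_def mult.assoc)
    ultimately show ?thesis using l b by (simp add: long.comb_diff)
  qed
qed

lemma is_highest_unique:
  assumes "is_highest \<phi>" "is_highest \<psi>"
  shows "\<phi> = \<psi>"
proof -
  obtain c d :: "nat \<Rightarrow> nat" where c: "(\<lambda>j. \<phi> j - \<psi> j) = short.comb (\<lambda>i. real (c i))"
    and d: "(\<lambda>j. \<psi> j - \<phi> j) = short.comb (\<lambda>i. real (d i))"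
    using assms unfolding is_highest_iff_comb by meson
  have "short.comb (\<lambda>i. real (c i) + real (d i)) = (\<lambda>j. 0)"
    unfolding short.comb_add c[symmetric] d[symmetric] by simp
  then have "c i = 0" if "i \<in> I" for i
    using short.nonneg_comb_zero[of "\<lambda>i. real (c i) + real (d i)" i] that by simp
  then have "short.comb (\<lambda>i. real (c i)) = (\<lambda>j. 0)" by (simp add: short.comb_def)
  then show ?thesis using c by (simp add: fun_eq_iff)
qed

lemma exists_dominant_root:
  assumes "i \<in> I"
  shows "\<exists>\<phi>\<in>roots X. short.dominant \<phi> \<and> ip X \<phi> \<phi> = ip X (simple_root X i) (simple_root X i)"
proof -
  obtain b where "short.integral b" "simple_root X i = short.comb b" using simple_comb assms by blast
  then obtain "is" where "set is \<subseteq> I" "short.dominant (weyl_prod X is (simple_root X i))"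
    using short.exists_dominant by auto
  then show ?thesis using assms rootI[of "is" i] by (auto simp: short.ip_weyl)
qed

text \<open>Trades the definite description for conditions that can be checked on a given root and
  transported along dualities.\<close>

lemma highest_root_eq:
  assumes "\<phi> \<in> roots X" "short.dominant \<phi>" "ip X \<phi> \<phi> = q * s"
  shows "highest_root X = \<phi>"
proof -
  have "is_highest \<phi>" using dominant_long_is_highest assms by blast
  then have "(THE \<phi>. is_highest \<phi>) = \<phi>"
    using is_highest_unique by (intro the_equality) auto
  then show ?thesis by (simp add: highest_root_def is_highest_def)
qed

lemma highest_root:
  shows "highest_root X \<in> roots X" "short.dominant (highest_root X)"
    "ip X (highest_root X) (highest_root X) = q * s"
proof -
  obtain \<phi> where "\<phi> \<in> roots X" "short.dominant \<phi>" "ip X \<phi> \<phi> = q * s"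
    using exists_dominant_root long_ex by metis
  then show "highest_root X \<in> roots X" "short.dominant (highest_root X)"
      "ip X (highest_root X) (highest_root X) = q * s"
    using highest_root_eq by auto
qed

lemma dominant_iff_pairing: "short.dominant v \<longleftrightarrow> (\<forall>i\<in>I. pairing X v (simple_root X i) \<ge> 0)"
  unfolding short.dominant_def
  using short.norm_pos by (simp add: pairing_def pos_le_divide_eq)

lemma short_le: "\<beta> \<in> roots X \<Longrightarrow> s \<le> ip X \<beta> \<beta>"
  using root_norm[of \<beta>] q s_pos by auto

lemma dominant_short_root_eq:
  assumes "\<phi> \<in> roots X" "short.dominant \<phi>" "ip X \<phi> \<phi> = s"
  shows "dominant_short_root X = \<phi>"
  unfolding dominant_short_root_def dominant_iff_pairing[symmetric]
proof (rule the_equality)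
  show "\<phi> \<in> roots X \<and> (\<forall>\<beta>\<in>roots X. ip X \<phi> \<phi> \<le> ip X \<beta> \<beta>) \<and> short.dominant \<phi>"
    using assms short_le by simp
  fix \<theta> assume \<theta>: "\<theta> \<in> roots X \<and> (\<forall>\<beta>\<in>roots X. ip X \<theta> \<theta> \<le> ip X \<beta> \<beta>) \<and> short.dominant \<theta>"
  then have norm: "ip X \<theta> \<theta> = s" using assms short_le by (metis order_antisym)
  obtain m b where "short.integral m" "\<theta> = short.comb m" "short.integral b" "\<phi> = short.comb b"
    using root_comb \<theta> assms(1) by meson
  then show "\<theta> = \<phi>" using short.dominant_minimal_unique \<theta> norm assms by blast
qed

lemma dominant_short_root:
  shows "dominant_short_root X \<in> roots X" "short.dominant (dominant_short_root X)"
    "ip X (dominant_short_root X) (dominant_short_root X) = s"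
proof -
  obtain \<phi> where "\<phi> \<in> roots X" "short.dominant \<phi>" "ip X \<phi> \<phi> = s"
    using exists_dominant_root short_ex by metis
  then show "dominant_short_root X \<in> roots X" "short.dominant (dominant_short_root X)"
      "ip X (dominant_short_root X) (dominant_short_root X) = s"
    using dominant_short_root_eq by auto
qed

text \<open>The pairing k of \<theta> with the coroot of \<phi> is a positive integer with k^2 q
  \<le> 4, which leaves k = 1 for q \<ge> 2.\<close>

lemma short_long_pairing:
  assumes "q \<noteq> 1"
  shows "pairing X (dominant_short_root X) (highest_root X) = 1"
    and "pairing X (highest_root X) (dominant_short_root X) = q"
proof -
  let ?\<theta> = "dominant_short_root X" and ?\<phi> = "highest_root X"
  note \<theta> = dominant_short_root and \<phi> = highest_root
  obtain m where m: "?\<theta> = short.comb m" using root_comb \<theta> by blast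
  obtain i where i: "i \<in> I" "ip X ?\<phi> (simple_root X i) > 0"
  proof (rule ccontr)
    assume "\<not> thesis"
    then have zero: "ip X ?\<phi> (simple_root X i) = 0" if "i \<in> I" for i
      using that \<phi>(2) \<open>(\<And>i. i \<in> I \<Longrightarrow> 0 < ip X ?\<phi> (simple_root X i) \<Longrightarrow> thesis)\<close>
      unfolding short.dominant_def by (metis order_le_less)
    obtain b where b: "?\<phi> = short.comb b" using root_comb \<phi> by blast
    have "ip X ?\<phi> (short.comb b) = 0" unfolding short.ip_comb_right using zero by simp
    then show False using root_norm_pos[OF \<phi>(1)] b by simp
  qed
  \<comment> \<open>Full support of \<theta>, together with one simple root not orthogonal to
    \<phi>, makes the inner product of \<phi> and \<theta> positive.\<close>
  have m_pos: "m k > 0" if "k \<in> I" for k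
    using short.dominant_full[of m k] \<theta> root_nonzero[OF \<theta>(1)] that by (simp add: m)
  have "ip X ?\<phi> ?\<theta> = (\<Sum>k\<in>I. m k * ip X ?\<phi> (simple_root X k))"
    by (simp add: m short.ip_comb_right)
  also have "\<dots> > 0"
    using i m_pos \<phi>(2) unfolding short.dominant_def
    by (intro sum_pos2[of I i]) (auto intro!: mult_nonneg_nonneg simp: less_imp_le)
  finally have pos: "ip X ?\<phi> ?\<theta> > 0" .
  obtain k where k: "pairing X ?\<theta> ?\<phi> = of_int k"
    using root_pairing_int[OF \<theta>(1) \<phi>(1)] by (rule Ints_cases)
  have ip_k: "2 * ip X ?\<phi> ?\<theta> = k * (q * s)"
    using k q_pos s_pos by (simp add: pairing_def \<phi>(3) ip_sym[of X ?\<theta> ?\<phi>] field_simps)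
  with pos have "k > 0" using q_pos(2) by (metis mult_2 add_pos_pos zero_less_mult_pos2 of_int_0_less_iff)
  \<comment> \<open>By \<open>ip_k\<close> this norm equals (4 - k^2 q) s.\<close>
  have "0 \<le> ip X (\<lambda>j. 2 * ?\<theta> j - k * ?\<phi> j) (\<lambda>j. 2 * ?\<theta> j - k * ?\<phi> j)" by (rule ip_nonneg)
  also have "\<dots> = 4 * s - 2 * k * (2 * ip X ?\<phi> ?\<theta>) + k * k * (q * s)"
    by (simp add: ip_linear \<theta>(3) \<phi>(3) ip_sym[of X ?\<theta> ?\<phi>]) (simp add: algebra_simps)
  also have "\<dots> = (4 - real_of_int (k * k * int q)) * s"
    unfolding ip_k by (simp add: algebra_simps)
  finally have "real_of_int (k * k * int q) \<le> 4"
    using s_pos by (simp add: zero_le_mult_iff)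
  then have "k * k * int q \<le> 4" by linarith
  moreover have "k = 1" if "k * k * int q \<le> 4"
  proof (rule ccontr)
    assume "k \<noteq> 1"
    then have "k * k \<ge> 2 * 2" using \<open>k > 0\<close> by (intro mult_mono) auto
    then have "k * k * int q \<ge> 4 * 2" using q assms by (intro mult_mono) auto
    then show False using that by simp
  qed
  ultimately have "k = 1" by blast
  then show "pairing X ?\<theta> ?\<phi> = 1" using k by simp
  show "pairing X ?\<phi> ?\<theta> = q"
    using ip_k \<open>k = 1\<close> s_pos by (simp add: pairing_def \<theta>(3))
qed

end

section \<open>The classical and exceptional root systems\<close>

text \<open>p makes the diagram a tree with root i0. Among the nodes separated from i0 by Z, one of
  least rank is joined to its parent, which is on the side of i0.\<close>

lemma connected_by_rank:
  fixes r p :: "nat \<Rightarrow> nat" and A :: "nat set"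
  assumes parent: "\<And>i. i \<in> A \<Longrightarrow> i \<noteq> i0 \<Longrightarrow> p i \<in> A \<and> r (p i) < r i \<and> ip X (f i) (f (p i)) \<noteq> 0" and "i0 \<in> A"
    and Z: "Z \<subseteq> A" "Z \<noteq> {}" "Z \<noteq> A"
  shows "\<exists>i\<in>Z. \<exists>j\<in>A - Z. ip X (f i) (f j) \<noteq> 0"
proof -
  have "\<exists>k. k \<in> A \<and> (k \<in> Z) \<noteq> (i0 \<in> Z)" using Z by auto
  then obtain k where k: "k \<in> A" "(k \<in> Z) \<noteq> (i0 \<in> Z)"
    "\<And>l. l \<in> A \<Longrightarrow> (l \<in> Z) \<noteq> (i0 \<in> Z) \<Longrightarrow> r k \<le> r l"
    using ex_has_least_nat[of "\<lambda>k. k \<in> A \<and> (k \<in> Z) \<noteq> (i0 \<in> Z)" _ r] by blast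
  then have p: "p k \<in> A" "r (p k) < r k" "ip X (f k) (f (p k)) \<noteq> 0"
    using parent[of k] by blast+
  then have "(p k \<in> Z) = (i0 \<in> Z)" using k(3)[of "p k"] by auto
  then show ?thesis using k p ip_sym[of X "f k" "f (p k)"] by (cases "k \<in> Z") force+
qed

lemma ip_unit_left:
  "ip X (unit_vec k) y = (if k \<in> {1..ambient_dim X} then y k else 0)"
proof -
  have "ip X (unit_vec k) y = (\<Sum>j = 1..ambient_dim X. if j = k then y j else 0)"
    by (simp add: ip_def unit_vec_def if_distrib[of "\<lambda>x. x * _"] cong: if_cong)
  then show ?thesis by (simp add: sum.delta)
qed

lemma unit_vec_apply: "unit_vec k j = (if j = k then 1 else 0)"
  by (simp add: unit_vec_def)

lemma root_datum_A: "n \<ge> 1 \<Longrightarrow> root_datum (TypeA n) 2 1 (\<lambda>j. - real j)"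
proof (unfold_locales, goal_cases)
  case (10 Z)
  then show ?case
    by (intro connected_by_rank[where ?i0.0 = 1 and r = id and p = "\<lambda>i. i - 1"])
       (auto simp: ip_linear ip_unit_left split: if_splits, auto simp: unit_vec_apply split: if_splits)
next
  case 4
  then show ?case
    by (intro bexI[of _ 1]) (auto simp: ip_linear ip_unit_left, auto simp: unit_vec_apply)
next
  case 5
  then show ?case
    by (intro bexI[of _ 1]) (auto simp: ip_linear ip_unit_left, auto simp: unit_vec_apply)
next
  case (6 i j)
  then show ?case
    by (auto simp: pairing_def ip_linear ip_unit_left split: if_splits)
      (auto simp: unit_vec_apply split: if_splits)
next
  case (7 i j)
  then show ?case
    by (auto simp: pairing_def ip_linear ip_unit_left split: if_splits)
      (auto simp: unit_vec_apply split: if_splits)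
next
  case (8 i)
  then show ?case
    by (auto simp: ip_linear ip_unit_left split: if_splits)
next
  case (3 i)
  then show ?case
    by (auto simp: ip_linear ip_unit_left split: if_splits) (auto simp: unit_vec_apply)
qed (auto simp: unit_vec_apply)

text \<open>The half sum of positive roots is not integral on e_n. The coordinates n, ..., 1 give
  e_n height 1 and also serve type C, where 2 e_n has height 2.\<close>

lemma root_datum_B: "n \<ge> 2 \<Longrightarrow> root_datum (TypeB n) 1 2 (\<lambda>j. real (n + 1) - real j)"
proof (unfold_locales, goal_cases)
  case (10 Z)
  then show ?case
    by (intro connected_by_rank[where ?i0.0 = 1 and r = id and p = "\<lambda>i. i - 1"])
       (auto simp: ip_linear ip_unit_left split: if_splits, auto simp: unit_vec_apply split: if_splits)
next
  case 4
  then show ?case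
    by (intro bexI[of _ n]) (auto simp: ip_linear ip_unit_left, auto simp: unit_vec_apply)
next
  case 5
  then show ?case
    by (intro bexI[of _ 1]) (auto simp: ip_linear ip_unit_left, auto simp: unit_vec_apply)
next
  case (6 i j)
  then show ?case
    by (auto simp: pairing_def ip_linear ip_unit_left split: if_splits)
      (auto simp: unit_vec_apply split: if_splits)
next
  case (7 i j)
  then show ?case
    by (auto simp: pairing_def ip_linear ip_unit_left split: if_splits)
      (auto simp: unit_vec_apply split: if_splits)
next
  case (8 i)
  then show ?case
    by (auto simp: ip_linear ip_unit_left split: if_splits)
next
  case (3 i)
  then show ?case
    by (auto simp: ip_linear ip_unit_left split: if_splits) (auto simp: unit_vec_apply)
qed (auto simp: unit_vec_apply)

lemma root_datum_C: "n \<ge> 2 \<Longrightarrow> root_datum (TypeC n) 2 2 (\<lambda>j. real (n + 1) - real j)"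
proof (unfold_locales, goal_cases)
  case (10 Z)
  then show ?case
    by (intro connected_by_rank[where ?i0.0 = 1 and r = id and p = "\<lambda>i. i - 1"])
       (auto simp: ip_linear ip_unit_left split: if_splits, auto simp: unit_vec_apply split: if_splits)
next
  case 4
  then show ?case
    by (intro bexI[of _ 1]) (auto simp: ip_linear ip_unit_left, auto simp: unit_vec_apply)
next
  case 5
  then show ?case
    by (intro bexI[of _ n]) (auto simp: ip_linear ip_unit_left, auto simp: unit_vec_apply)
next
  case (6 i j)
  then show ?case
    by (auto simp: pairing_def ip_linear ip_unit_left split: if_splits)
      (auto simp: unit_vec_apply split: if_splits)
next
  case (7 i j)
  then show ?case
    by (auto simp: pairing_def ip_linear ip_unit_left split: if_splits)
      (auto simp: unit_vec_apply split: if_splits)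
next
  case (8 i)
  then show ?case
    by (auto simp: ip_linear ip_unit_left split: if_splits)
next
  case (3 i)
  then show ?case
    by (auto simp: ip_linear ip_unit_left split: if_splits) (auto simp: unit_vec_apply)
qed (auto simp: unit_vec_apply)

lemma root_datum_D: "n \<ge> 4 \<Longrightarrow> root_datum (TypeD n) 2 1 (\<lambda>j. real n - real j)"
proof (unfold_locales, goal_cases)
  case (10 Z)
  \<comment> \<open>The last node hangs on n - 2: the fork of type D.\<close>
  let ?p = "\<lambda>i. if i = n then n - 2 else i - 1"
  have "?p i \<in> {1..n} \<and> ?p i < i \<and> ip (TypeD n) (simple_root (TypeD n) i) (simple_root (TypeD n) (?p i)) \<noteq> 0"
    if i: "i \<in> {1..n}" "i \<noteq> 1" for i
  proof (cases "i = n")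
    case True
    then show ?thesis using 10(1)
      by (simp add: ip_linear ip_unit_left) (simp add: unit_vec_apply, arith)
  next
    case False
    then have "i - 1 \<noteq> n" "Suc (i - 1) = i" using i by auto
    then show ?thesis using i False
      by (simp add: ip_linear ip_unit_left) (simp add: unit_vec_apply)
  qed
  then show ?case using 10
    by (intro connected_by_rank[where ?i0.0 = 1 and r = id and p = ?p]) auto
next
  case 4
  then show ?case
    by (intro bexI[of _ 1]) (auto simp: ip_linear ip_unit_left, auto simp: unit_vec_apply)
next
  case 5
  then show ?case
    by (intro bexI[of _ 1]) (auto simp: ip_linear ip_unit_left, auto simp: unit_vec_apply)
next
  case (6 i j)
  then show ?case
    by (auto simp: pairing_def ip_linear ip_unit_left split: if_splits)
      (auto simp: unit_vec_apply split: if_splits)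
next
  case (7 i j)
  then show ?case
    by (auto simp: pairing_def ip_linear ip_unit_left split: if_splits)
      (auto simp: unit_vec_apply split: if_splits)
next
  case (8 i)
  then show ?case
    by (auto simp: ip_linear ip_unit_left split: if_splits)
next
  case (3 i)
  then show ?case
    by (auto simp: ip_linear ip_unit_left split: if_splits) (auto simp: unit_vec_apply)
qed (auto simp: unit_vec_apply)

lemma ip_e8:
  assumes "ambient_dim X = 8"
  shows "ip X x y = x 1 * y 1 + x 2 * y 2 + x 3 * y 3 + x 4 * y 4 + x 5 * y 5 + x 6 * y 6 + x 7 * y 7 + x 8 * y 8"
proof -
  have "{1..8} = {1, 2, 3, 4, 5, 6, 7, 8 :: nat}" by auto
  then show ?thesis by (simp add: ip_def assms add.assoc)
qed

definition e8_adjacent :: "nat \<Rightarrow> nat \<Rightarrow> bool" where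
  "e8_adjacent i j \<longleftrightarrow> (i, j) \<in> {(1, 3), (3, 1), (3, 4), (4, 3), (2, 4), (4, 2), (4, 5), (5, 4), (5, 6), (6, 5),
    (6, 7), (7, 6), (7, 8), (8, 7)}"

lemma atLeastAtMost_8_cases:
  "i \<in> {1..8} \<Longrightarrow> i = 1 \<or> i = 2 \<or> i = 3 \<or> i = 4 \<or> i = 5 \<or> i = 6 \<or> i = 7 \<or> i = (8::nat)"
  by auto

lemma ip_e8_simple_roots:
  assumes X: "ambient_dim X = 8" and "i \<in> {1..8}" "j \<in> {1..8}"
  shows "ip X (e8_simple_root i) (e8_simple_root j) = (if i = j then 2 else if e8_adjacent i j then -1 else 0)"
  using atLeastAtMost_8_cases[OF assms(2)] atLeastAtMost_8_cases[OF assms(3)]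
  by (elim disjE) (simp_all add: ip_e8[OF X] e8_simple_root_def unit_vec_def e8_adjacent_def)

text \<open>The vector (0, 1, ..., 6, 23) is half the sum of the positive roots of E8.\<close>

lemma e8_height:
  assumes X: "ambient_dim X = 8" and "i \<in> {1..8}"
  shows "ip X (e8_simple_root i) (\<lambda>j. if j = 8 then 23 else real j - 1) = 1"
  using atLeastAtMost_8_cases[OF assms(2)]
  by (elim disjE) (simp_all add: ip_e8[OF X] e8_simple_root_def unit_vec_def)

lemma e8_support:
  assumes "i \<in> {1..8}" "j \<notin> {1..8}"
  shows "e8_simple_root i j = 0"
  using atLeastAtMost_8_cases[OF assms(1)] assms(2)
  by (elim disjE) (auto simp: e8_simple_root_def unit_vec_def)

text \<open>E6 and E7 are spanned by the first 6 or 7 simple roots of E8 in the same 8-dimensional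
  space and inherit its data.\<close>

lemma root_datum_E:
  assumes X: "ambient_dim X = 8" "rank X \<in> {6, 7, 8}" "simple_root X = e8_simple_root"
  shows "root_datum X 2 1 (\<lambda>j. if j = 8 then 23 else real j - 1)"
proof -
  have I: "i \<in> {1..8}" if "i \<in> {1..rank X}" for i using that X(2) by auto
  note ip = ip_e8_simple_roots[OF X(1)]
  show ?thesis
  proof (unfold_locales, goal_cases)
    case (10 Z)
    \<comment> \<open>The tree is rooted at the branch node 4.\<close>
    let ?p = "\<lambda>i::nat. if i = 1 then 3 else if i = 2 \<or> i = 3 then 4 else i - 1"
    have "?p i \<in> {1..rank X} \<and> (nat \<bar>2 * int (?p i) - 8\<bar> < nat \<bar>2 * int i - 8\<bar>) \<and>
        ip X (e8_simple_root i) (e8_simple_root (?p i)) \<noteq> 0" if "i \<in> {1..rank X}" "i \<noteq> 4" for i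
      using atLeastAtMost_8_cases[OF I[OF that(1)]] that X(2)
      by (elim disjE) (auto simp: ip e8_adjacent_def)
    then show ?case unfolding X(3)
      using 10 X(2)
      by (intro connected_by_rank[where ?i0.0 = 4 and r = "\<lambda>i. nat \<bar>2 * int i - 8\<bar>" and p = ?p]) auto
  next
    case 4
    show ?case using X by (intro bexI[of _ 1]) (auto simp: ip)
  next
    case 5
    show ?case using X by (intro bexI[of _ 1]) (auto simp: ip)
  next
    case (9 i j)
    then show ?case using X e8_support[OF I[OF 9(1)]] by simp
  qed (use X I in \<open>auto simp: pairing_def ip e8_height simp del: atLeastAtMost_iff One_nat_def\<close>)
qed

text \<open>The height vector is the sum of all positive roots; half of it would not be integral on
  the short simple roots.\<close>

lemma root_datum_F4: "root_datum TypeF4 1 2 (\<lambda>j. if j = 1 then 11 else if j = 2 then 5 else if j = 3 then 3 else 1)"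
proof -
  have set4: "{1..4} = {1, 2, 3, 4 :: nat}" by auto
  have ip: "ip TypeF4 x y = x 1 * y 1 + x 2 * y 2 + x 3 * y 3 + x 4 * y 4" for x y
    by (simp only: ip_def ambient_dim.simps set4) simp
  have cases: "i = 1 \<or> i = 2 \<or> i = 3 \<or> i = 4" if "i \<in> {1..rank TypeF4}" for i using that by auto
  show ?thesis
  proof (unfold_locales, goal_cases)
    case (10 Z)
    then show ?case
      by (intro connected_by_rank[where ?i0.0 = 1 and r = id and p = "\<lambda>i. i - 1"])
        (use cases in \<open>fastforce simp: ip unit_vec_def\<close>)+
  next
    case (3 i)
    from cases[OF this] show ?case by (elim disjE) (simp_all add: ip unit_vec_def)
  next
    case 4
    show ?case by (intro bexI[of _ 3]) (simp_all add: ip unit_vec_def)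
  next
    case 5
    show ?case by (intro bexI[of _ 1]) (simp_all add: ip unit_vec_def)
  next
    case (6 i j)
    from cases[OF this(1)] cases[OF this(2)] this(3) show ?case
      by (elim disjE) (simp_all add: ip pairing_def unit_vec_def)
  next
    case (7 i j)
    from cases[OF this(1)] cases[OF this(2)] this(3) show ?case
      by (elim disjE) (simp_all add: ip pairing_def unit_vec_def)
  next
    case (8 i)
    from cases[OF this] show ?case by (elim disjE) (simp_all add: ip unit_vec_def)
  next
    case (9 i j)
    from cases[OF this(1)] this(2) show ?case by (elim disjE) (auto simp: unit_vec_def)
  qed simp_all
qed

text \<open>The height vector is half the sum of the positive roots.\<close>

lemma root_datum_G2: "root_datum TypeG2 2 3 (\<lambda>j. if j = 1 then -1 else if j = 2 then -2 else 3)"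
proof -
  have set3: "{1..3} = {1, 2, 3 :: nat}" by auto
  have ip: "ip TypeG2 x y = x 1 * y 1 + x 2 * y 2 + x 3 * y 3" for x y
    by (simp only: ip_def ambient_dim.simps set3) simp
  have cases: "i = 1 \<or> i = 2" if "i \<in> {1..rank TypeG2}" for i using that by auto
  show ?thesis
  proof (unfold_locales, goal_cases)
    case (10 Z)
    then show ?case
      by (intro connected_by_rank[where ?i0.0 = 1 and r = id and p = "\<lambda>i. i - 1"])
        (use cases in \<open>fastforce simp: ip unit_vec_def\<close>)+
  next
    case (3 i)
    from cases[OF this] show ?case by (elim disjE) (simp_all add: ip unit_vec_def)
  next
    case 4
    show ?case by (intro bexI[of _ 1]) (simp_all add: ip unit_vec_def)
  next
    case 5
    show ?case by (intro bexI[of _ 2]) (simp_all add: ip unit_vec_def)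
  next
    case (6 i j)
    from cases[OF this(1)] cases[OF this(2)] this(3) show ?case
      by (elim disjE) (simp_all add: ip pairing_def unit_vec_def)
  next
    case (7 i j)
    from cases[OF this(1)] cases[OF this(2)] this(3) show ?case
      by (elim disjE) (simp_all add: ip pairing_def unit_vec_def)
  next
    case (8 i)
    from cases[OF this] show ?case by (elim disjE) (simp_all add: ip unit_vec_def)
  next
    case (9 i j)
    from cases[OF this(1)] this(2) show ?case by (elim disjE) (auto simp: unit_vec_def)
  qed simp_all
qed

section \<open>Braid relations between reflections\<close>

primrec alt :: "nat \<Rightarrow> 'a \<Rightarrow> 'a \<Rightarrow> 'a list" where
  "alt 0 g h = []"
| "alt (Suc k) g h = g # alt k h g"

lemma alternating_conv_alt: "alternating k g h = concat (map pos (alt k g h))"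
  by (induction k arbitrary: g h) simp_all

lemma map_alt: "map f (alt k g h) = alt k (f g) (f h)"
  by (induction k arbitrary: g h) simp_all

lemma set_alt: "set (alt k g h) \<subseteq> {g, h}"
  by (induction k arbitrary: g h) fastforce+

lemma length_alt [simp]: "length (alt k g h) = k"
  by (induction k arbitrary: g h) simp_all

lemma alt_Suc_snoc: "alt (Suc k) g h = alt k g h @ [if even k then g else h]"
  by (induction k arbitrary: g h) simp_all

definition reflection_prod :: "cartan_type \<Rightarrow> vec list \<Rightarrow> vec \<Rightarrow> vec" where
  "reflection_prod X \<gamma>s = foldr (\<lambda>\<gamma> f. reflection X \<gamma> \<circ> f) \<gamma>s id"

lemma reflection_prod_simps [simp]:
  "reflection_prod X [] = id"
  "reflection_prod X (\<gamma> # \<gamma>s) = reflection X \<gamma> \<circ> reflection_prod X \<gamma>s"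
  by (simp_all add: reflection_prod_def)

lemma weyl_prod_conv_reflection_prod: "weyl_prod X is = reflection_prod X (map (simple_root X) is)"
  by (induction "is") (simp_all add: weyl_prod_Cons)

text \<open>Both products move x within the plane through x spanned by \<beta> and \<gamma>, where
  the reflections are affine maps of the coefficients u and w. Only pairings enter, so the argument
  also covers roots with an imaginary part.\<close>

lemma reflection_prod_alt_braid:
  assumes nz: "ip X \<beta> \<beta> \<noteq> 0" "ip X \<gamma> \<gamma> \<noteq> 0"
    and p: "pairing X \<beta> \<gamma> * pairing X \<gamma> \<beta> = real p" "p < 4"
  shows "reflection_prod X (alt (braid_length p) \<beta> \<gamma>) = reflection_prod X (alt (braid_length p) \<gamma> \<beta>)"
proof
  fix x
  define A B Y Z where defs: "A = pairing X \<beta> \<gamma>" "B = pairing X \<gamma> \<beta>" "Y = pairing X x \<beta>" "Z = pairing X x \<gamma>"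
  define L where "L u w = (\<lambda>j. x j - u * \<beta> j - w * \<gamma> j)" for u w
  have \<beta>: "reflection X \<beta> (L u w) = L (Y - u - B * w) w" for u w
    by (simp add: L_def reflection_def pairing_diff pairing_scale pairing_self nz defs fun_eq_iff) (simp add: algebra_simps)
  have \<gamma>: "reflection X \<gamma> (L u w) = L u (Z - w - A * u)" for u w
    by (simp add: L_def reflection_def pairing_diff pairing_scale pairing_self nz defs fun_eq_iff) (simp add: algebra_simps)
  have x: "x = L 0 0" by (simp add: L_def)
  have AB: "A * B = real p" using p(1) by (simp add: defs)
  \<comment> \<open>For p = 0 the product of A and B does not determine them, but symmetry of the
    form makes both vanish.\<close>
  have zero: "A = 0 \<and> B = 0" if "p = 0"
    using AB that nz ip_sym[of X \<beta> \<gamma>] by (auto simp: defs pairing_def)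
  have AB': "B * A = real p" "A * (B * c) = real p * c" "B * (A * c) = real p * c" for c
    using AB by (simp_all add: mult.commute mult.left_commute flip: mult.assoc)
  have "p = 0 \<or> p = 1 \<or> p = 2 \<or> p = 3" using p(2) by auto
  then show "reflection_prod X (alt (braid_length p) \<beta> \<gamma>) x = reflection_prod X (alt (braid_length p) \<gamma> \<beta>) x"
    using zero
    by (elim disjE; subst (1 2) x)
       (simp_all add: braid_length_def numeral_eq_Suc \<beta> \<gamma> AB AB' right_diff_distrib)
qed

lemma bond_sym: "bond X \<beta> \<gamma> = bond X \<gamma> \<beta>"
  by (simp add: bond_def mult.commute)

section \<open>Matsumoto's theorem\<close>

context root_datum
begin

lemma root_bond:
  assumes "\<beta> \<in> roots X" "\<gamma> \<in> roots X"
  shows "pairing X \<beta> \<gamma> * pairing X \<gamma> \<beta> = real (bond X \<beta> \<gamma>)"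
proof -
  have "pairing X \<beta> \<gamma> * pairing X \<gamma> \<beta> \<in> \<int>"
    using root_pairing_int assms by auto
  moreover have "pairing X \<beta> \<gamma> * pairing X \<gamma> \<beta> = (2 * ip X \<beta> \<gamma>)\<^sup>2 / (ip X \<beta> \<beta> * ip X \<gamma> \<gamma>)"
    by (simp add: pairing_def ip_sym[of X \<gamma> \<beta>] power2_eq_square)
  then have "pairing X \<beta> \<gamma> * pairing X \<gamma> \<beta> \<ge> 0"
    using ip_nonneg[of X] by simp
  ultimately show ?thesis unfolding bond_def by (metis Ints_cases floor_of_int of_int_0_le_iff of_int_of_nat_eq of_nat_nat)
qed

lemma simple_bond_less: "i \<in> I \<Longrightarrow> j \<in> I \<Longrightarrow> i \<noteq> j \<Longrightarrow> bond X (simple_root X i) (simple_root X j) < 4"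
  using simple_bond[of i j] root_bond[of "simple_root X i" "simple_root X j"] simple_root_in_roots by simp

definition coxeter :: "nat \<Rightarrow> nat \<Rightarrow> nat" where
  "coxeter i j = braid_length (bond X (simple_root X i) (simple_root X j))"

lemma coxeter_sym: "coxeter i j = coxeter j i"
  by (simp add: coxeter_def bond_sym)

lemma coxeter_pos: "i \<in> I \<Longrightarrow> j \<in> I \<Longrightarrow> i \<noteq> j \<Longrightarrow> coxeter i j > 0"
  using simple_bond_less[of i j] by (auto simp: coxeter_def braid_length_def)

lemma weyl_prod_alt:
  assumes "i \<in> I" "j \<in> I" "i \<noteq> j"
  shows "weyl_prod X (alt (coxeter i j) i j) = weyl_prod X (alt (coxeter i j) j i)"
  unfolding weyl_prod_conv_reflection_prod map_alt coxeter_def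
  using assms root_bond simple_bond_less simple_root_in_roots root_norm_pos
  by (intro reflection_prod_alt_braid) (auto simp: less_imp_neq[THEN not_sym])

lemma weyl_prod_rev [simp]:
  "set is \<subseteq> I \<Longrightarrow> weyl_prod X (rev is) (weyl_prod X is x) = x"
proof (induction "is" arbitrary: x)
  case (Cons i "is")
  then show ?case using short.root_norm_pos[of i] by (simp add: weyl_prod_Cons weyl_prod_append)
qed simp

lemma weyl_prod_rev' [simp]: "set is \<subseteq> I \<Longrightarrow> weyl_prod X is (weyl_prod X (rev is) x) = x"
  using weyl_prod_rev[of "rev is" x] by simp

lemma weyl_prod_rev_cong:
  assumes "set is \<subseteq> I" "set js \<subseteq> I" "weyl_prod X is = weyl_prod X js"
  shows "weyl_prod X (rev is) = weyl_prod X (rev js)"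
  using assms by (metis ext weyl_prod_rev weyl_prod_rev')

lemma weyl_reflection:
  assumes "set is \<subseteq> I"
  shows "weyl_prod X is (reflection X \<gamma> x) = reflection X (weyl_prod X is \<gamma>) (weyl_prod X is x)"
  using assms by (intro reflection_conj linear_vec_weyl_prod) (simp add: pairing_def short.ip_weyl)

section \<open>Positive roots and descents\<close>

definition positive :: "vec \<Rightarrow> bool" where
  "positive v \<longleftrightarrow> (\<exists>c. (\<forall>i\<in>I. c i \<ge> 0) \<and> v = short.comb c)"

lemma positive_add_scaled:
  assumes "positive v" "positive w" "x \<ge> 0" "y \<ge> 0"
  shows "positive (\<lambda>j. x * v j + y * w j)"
proof -
  obtain c d where "\<forall>i\<in>I. c i \<ge> 0" "v = short.comb c" "\<forall>i\<in>I. d i \<ge> 0" "w = short.comb d"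
    using assms by (auto simp: positive_def)
  then show ?thesis
    unfolding positive_def using assms(3,4)
    by (intro exI[of _ "\<lambda>i. x * c i + y * d i"]) (simp add: short.comb_add short.comb_scale)
qed

lemma comb_uminus: "short.comb (\<lambda>i. - c i) = (\<lambda>j. - short.comb c j)"
  using short.comb_scale[of "-1" c] by simp

text \<open>A short root is minimal in the root lattice, a long one in the rescaled coroot lattice,
  and minimal vectors have coefficients of one sign.\<close>

lemma root_positive_or_negative:
  assumes "\<beta> \<in> roots X"
  shows "positive \<beta> \<or> positive (\<lambda>j. - \<beta> j)"
proof -
  have *: ?thesis if "\<beta> = short.comb c" "(\<forall>i\<in>I. c i \<ge> 0) \<or> (\<forall>i\<in>I. c i \<le> 0)" for c
    using that(2)
  proof
    assume "\<forall>i\<in>I. c i \<le> 0"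
    then have "positive (\<lambda>j. - \<beta> j)"
      unfolding positive_def that(1) by (intro exI[of _ "\<lambda>i. - c i"]) (simp add: comb_uminus)
    then show ?thesis ..
  qed (use that in \<open>auto simp: positive_def\<close>)
  from root_norm[OF assms] show ?thesis
  proof
    assume "ip X \<beta> \<beta> = s"
    moreover obtain b where "short.integral b" "\<beta> = short.comb b" using root_comb assms by blast
    ultimately show ?thesis using * short.dichotomy by blast
  next
    assume norm: "ip X \<beta> \<beta> = q * s"
    obtain b where b: "long.integral b" "\<beta> = long.comb b" using long_root_comb[OF assms norm] by blast
    then have "(\<forall>i\<in>I. b i \<ge> 0) \<or> (\<forall>i\<in>I. b i \<le> 0)" using long.dichotomy norm by blast
    then have "(\<forall>i\<in>I. b i * colength i \<ge> 0) \<or> (\<forall>i\<in>I. b i * colength i \<le> 0)"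
      using colength_pos(1) by (auto simp: mult_nonneg_nonneg mult_nonpos_nonneg less_imp_le)
    moreover have "\<beta> = short.comb (\<lambda>i. b i * colength i)"
      by (simp add: b short.comb_def long.comb_def mult.assoc)
    ultimately show ?thesis using * by blast
  qed
qed

lemma not_positive_and_negative:
  assumes "positive v" "positive (\<lambda>j. - v j)"
  shows "v = (\<lambda>j. 0)"
proof -
  obtain c d where c: "\<forall>i\<in>I. c i \<ge> 0" "v = short.comb c"
    and d: "\<forall>i\<in>I. d i \<ge> 0" "(\<lambda>j. - v j) = short.comb d"
    using assms by (auto simp: positive_def)
  then have "short.comb (\<lambda>i. c i + d i) = (\<lambda>j. 0)"
    unfolding short.comb_add c(2)[symmetric] d(2)[symmetric] by simp
  then have "c i + d i = 0" if "i \<in> I" for i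
    using short.nonneg_comb_zero[of "\<lambda>i. c i + d i" i] c d that by simp
  then have "c i = 0" if "i \<in> I" for i
    using c(1) d(1) that by (simp add: add_nonneg_eq_0_iff)
  then show ?thesis using c by (simp add: short.comb_def)
qed

text \<open>A simple reflection changes only the j-th coefficient, so a positive root that it makes
  negative is a multiple of the j-th simple root.\<close>

lemma simple_reflection_sign_change:
  assumes \<beta>: "\<beta> \<in> roots X" "positive \<beta>" and j: "j \<in> I"
    and neg: "positive (\<lambda>k. - reflection X (simple_root X j) \<beta> k)"
  shows "reflection X \<beta> = reflection X (simple_root X j)"
proof -
  obtain c where c: "\<forall>i\<in>I. c i \<ge> 0" "\<beta> = short.comb c" using \<beta> by (auto simp: positive_def)
  obtain d where d: "\<forall>i\<in>I. d i \<ge> 0" "(\<lambda>k. - reflection X (simple_root X j) \<beta> k) = short.comb d"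
    using neg by (auto simp: positive_def)
  define p where "p = pairing X \<beta> (simple_root X j)"
  have "short.comb (\<lambda>i. c i + d i) = short.comb (\<lambda>k. if k = j then p else 0)"
    unfolding short.comb_add c(2)[symmetric] d(2)[symmetric] short.comb_unit[OF j]
    by (simp add: reflection_def p_def)
  then have "c i + d i = (if i = j then p else 0)" if "i \<in> I" for i
    using short.independent that by blast
  then have "c i + d i = 0" if "i \<in> I" "i \<noteq> j" for i
    using that by simp
  then have "c i = 0" if "i \<in> I" "i \<noteq> j" for i
    using c(1) d(1) that by (simp add: add_nonneg_eq_0_iff)
  then have "\<beta> = short.comb (\<lambda>k. if k = j then c j else 0)"
    unfolding c(2) by (intro short.comb_cong) auto
  then have eq: "\<beta> = (\<lambda>k. c j * simple_root X j k)" using short.comb_unit[OF j] by simp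
  then have "c j \<noteq> 0" using root_nonzero[OF \<beta>(1)] by auto
  then show ?thesis unfolding eq by (rule reflection_scale)
qed

text \<open>The left descents of the element w given by the word, in terms of the sign of w^-1
  \<alpha>_i; \<open>rev\<close> yields the inverse.\<close>

definition descent :: "nat list \<Rightarrow> nat \<Rightarrow> bool" where
  "descent is i \<longleftrightarrow> positive (\<lambda>j. - weyl_prod X (rev is) (simple_root X i) j)"

definition reduced :: "nat list \<Rightarrow> bool" where
  "reduced is \<longleftrightarrow> reduced_expression X (weyl_prod X is) is"

lemma reduced_set: "reduced is \<Longrightarrow> set is \<subseteq> I"
  by (simp add: reduced_def reduced_expression_def)

lemma reduced_length_le:
  "reduced is \<Longrightarrow> set js \<subseteq> I \<Longrightarrow> weyl_prod X js = weyl_prod X is \<Longrightarrow> length is \<le> length js"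
  by (simp add: reduced_def reduced_expression_def)

lemma reduced_cong:
  "reduced is \<Longrightarrow> set js \<subseteq> I \<Longrightarrow> weyl_prod X js = weyl_prod X is \<Longrightarrow> length js \<le> length is \<Longrightarrow> reduced js"
  by (auto simp: reduced_def reduced_expression_def intro: order_trans)

lemma reduced_appendD:
  assumes "reduced (is @ js)"
  shows "reduced js"
proof -
  have "length js \<le> length ks" if "set ks \<subseteq> I" "weyl_prod X ks = weyl_prod X js" for ks
    using reduced_length_le[OF assms, of "is @ ks"] reduced_set[OF assms] that
    by (simp add: weyl_prod_append)
  then show ?thesis
    using reduced_set[OF assms] by (simp add: reduced_def reduced_expression_def)
qed

lemma reduced_ConsD: "reduced (i # is) \<Longrightarrow> reduced is"
  using reduced_appendD[of "[i]"] by simp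

lemma not_descent: "set is \<subseteq> I \<Longrightarrow> i \<in> I \<Longrightarrow> \<not> descent is i \<Longrightarrow> positive (weyl_prod X (rev is) (simple_root X i))"
  unfolding descent_def using root_positive_or_negative rootI[of "rev is" i] by auto

lemma descent_not_positive:
  "set is \<subseteq> I \<Longrightarrow> i \<in> I \<Longrightarrow> descent is i \<Longrightarrow> \<not> positive (weyl_prod X (rev is) (simple_root X i))"
  unfolding descent_def
  using not_positive_and_negative root_nonzero[OF rootI[of "rev is" i]] by auto

lemma simple_positive: "i \<in> I \<Longrightarrow> positive (simple_root X i)"
  unfolding positive_def using short.comb_unit[of i 1]
  by (intro exI[of _ "\<lambda>k. if k = i then 1 else 0"]) auto

text \<open>Along the word the image of \<alpha>_i turns from positive to negative at some letter j.
  There it is a multiple of \<alpha>_j, which lets i pass through ys and come out as j.\<close>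

lemma exchange:
  assumes "set is \<subseteq> I" "i \<in> I" "descent is i"
  shows "\<exists>ys j zs. is = ys @ j # zs \<and> weyl_prod X (i # ys) = weyl_prod X (ys @ [j])"
  using assms
proof (induction "is" rule: rev_induct)
  case Nil
  then show ?case using descent_not_positive[of "[]" i] simple_positive[of i] by simp
next
  case (snoc j "is")
  show ?case
  proof (cases "descent is i")
    case True
    then obtain ys k zs where "is = ys @ k # zs" "weyl_prod X (i # ys) = weyl_prod X (ys @ [k])"
      using snoc by auto
    then show ?thesis by (intro exI[of _ ys] exI[of _ k] exI[of _ "zs @ [j]"]) simp
  next
    case False
    let ?\<beta> = "weyl_prod X (rev is) (simple_root X i)"
    have "set is \<subseteq> I" "j \<in> I" using snoc.prems by auto
    then have "positive ?\<beta>" using False not_descent snoc.prems by blast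
    moreover have "positive (\<lambda>k. - reflection X (simple_root X j) ?\<beta> k)"
      using snoc.prems(3) by (simp add: descent_def weyl_prod_Cons)
    ultimately have "reflection X ?\<beta> = reflection X (simple_root X j)"
      using simple_reflection_sign_change rootI[of "rev is" i] \<open>set is \<subseteq> I\<close> \<open>j \<in> I\<close> snoc.prems(2)
      by auto
    then have "weyl_prod X (i # is) x = weyl_prod X (is @ [j]) x" for x
      using weyl_reflection[of "is" ?\<beta> x] \<open>set is \<subseteq> I\<close>
      by (simp add: weyl_prod_Cons weyl_prod_append)
    then show ?thesis by (intro exI[of _ "is"] exI[of _ j] exI[of _ "[]"]) auto
  qed
qed

text \<open>Exchange deletes a letter j and puts i in front, at equal length.\<close>

lemma descent_imp_reduced_Cons:
  assumes "reduced is" "i \<in> I" "descent is i"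
  shows "\<exists>ks. reduced (i # ks) \<and> weyl_prod X (i # ks) = weyl_prod X is"
proof -
  obtain ys j zs where eq: "is = ys @ j # zs" "weyl_prod X (i # ys) = weyl_prod X (ys @ [j])"
    using exchange reduced_set assms by blast
  have "weyl_prod X (i # ys @ zs) = weyl_prod X (ys @ [j]) \<circ> weyl_prod X zs"
    using eq(2) by (simp only: weyl_prod_append flip: append_Cons)
  then have "weyl_prod X (i # ys @ zs) = weyl_prod X is"
    by (simp add: eq(1) weyl_prod_append weyl_prod_Cons comp_assoc)
  moreover from this have "reduced (i # ys @ zs)"
    using reduced_cong[OF assms(1), of "i # ys @ zs"] reduced_set[OF assms(1)] assms(2) by (simp add: eq(1))
  ultimately show ?thesis by blast
qed

lemma weyl_prod_Cons_Cons [simp]: "i \<in> I \<Longrightarrow> weyl_prod X (i # i # is) = weyl_prod X is"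
  using short.root_norm_pos[of i] by (simp add: weyl_prod_Cons fun_eq_iff)

lemma weyl_prod_Cons_cancel:
  assumes "i \<in> I" "weyl_prod X (i # is) = weyl_prod X (i # js)"
  shows "weyl_prod X is = weyl_prod X js"
proof -
  have "weyl_prod X (i # i # is) = weyl_prod X (i # i # js)"
    using assms(2) by (simp only: weyl_prod_Cons[of X i "i # _"])
  then show ?thesis using assms(1) by simp
qed

text \<open>Were i a descent of ks, a reduced word for ks could start with i and i # ks would
  shorten. As it is not, prefixing i flips the sign of the root.\<close>

lemma reduced_Cons_imp_descent:
  assumes "reduced (i # ks)"
  shows "descent (i # ks) i"
proof -
  have i: "i \<in> I" and ks: "set ks \<subseteq> I" using reduced_set[OF assms] by auto
  have "\<not> descent ks i"
  proof
    assume "descent ks i"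
    then obtain ls where ls: "reduced (i # ls)" "weyl_prod X (i # ls) = weyl_prod X ks"
      using descent_imp_reduced_Cons reduced_ConsD[OF assms] i by blast
    then have "weyl_prod X ls = weyl_prod X (i # ks)"
      using weyl_prod_Cons_Cons[OF i, of ls] by (simp only: weyl_prod_Cons[of X i "i # _"] weyl_prod_Cons[of X i ks])
    then have "length (i # ks) \<le> length ls"
      using reduced_length_le[OF assms, of ls] reduced_set[OF ls(1)] by auto
    moreover have "length (i # ls) \<le> length ks"
      using reduced_length_le[OF ls(1) ks] ls(2) by simp
    ultimately show False by simp
  qed
  then have "positive (weyl_prod X (rev ks) (simple_root X i))" using not_descent i ks by blast
  moreover have "weyl_prod X (rev (i # ks)) (simple_root X i) = (\<lambda>j. - weyl_prod X (rev ks) (simple_root X i) j)"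
    using short.root_norm_pos[OF i] linear_vec_scale[OF linear_vec_weyl_prod[of X "rev ks"], of "-1"]
    by (simp add: weyl_prod_append weyl_prod_Cons reflection_self)
  ultimately show ?thesis by (simp add: descent_def)
qed

lemma descent_cong:
  "set is \<subseteq> I \<Longrightarrow> set js \<subseteq> I \<Longrightarrow> weyl_prod X is = weyl_prod X js \<Longrightarrow> descent is i \<longleftrightarrow> descent js i"
  unfolding descent_def using weyl_prod_rev_cong by metis

text \<open>The systems A1 x A1, A2, B2 and G2 are run through: an alternating product that acts
  first by i and has fewer than m letters keeps \<alpha>_j positive.\<close>

lemma dihedral_positive:
  assumes ij: "i \<in> I" "j \<in> I" "i \<noteq> j" and k: "k < coxeter i j"
  shows "\<exists>x\<ge>0. \<exists>y\<ge>0. weyl_prod X (rev (alt k i j)) (simple_root X j) =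
    (\<lambda>l. x * simple_root X i l + y * simple_root X j l)"
proof -
  define a b where ab: "a = - pairing X (simple_root X j) (simple_root X i)"
    "b = - pairing X (simple_root X i) (simple_root X j)"
  define L where "L x y = (\<lambda>l. x * simple_root X i l + y * simple_root X j l)" for x y
  define p where "p = bond X (simple_root X i) (simple_root X j)"
  have p: "a * b = real p"
    using root_bond[of "simple_root X i" "simple_root X j"] ij simple_root_in_roots
    by (simp add: ab p_def mult.commute)
  have pos: "a \<ge> 0" "b \<ge> 0" using simple_pairing ij by (auto simp: ab)
  have nz: "ip X (simple_root X i) (simple_root X i) \<noteq> 0" "ip X (simple_root X j) (simple_root X j) \<noteq> 0"
    using short.norm_pos ij by force+
  have pairing_add: "pairing X (\<lambda>l. v l + w l) \<gamma> = pairing X v \<gamma> + pairing X w \<gamma>" for v w \<gamma>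
    by (simp add: pairing_def ip_linear add_divide_distrib distrib_left)
  have i: "reflection X (simple_root X i) (L x y) = L (a * y - x) y" for x y
    by (simp add: L_def reflection_def pairing_add pairing_scale pairing_self nz ab fun_eq_iff algebra_simps)
  have j: "reflection X (simple_root X j) (L x y) = L x (b * x - y)" for x y
    by (simp add: L_def reflection_def pairing_add pairing_scale pairing_self nz ab fun_eq_iff algebra_simps)
  have start: "simple_root X j = L 0 1" by (simp add: L_def)
  have zero: "a = 0 \<and> b = 0" if "p = 0"
    using p that nz ip_sym[of X "simple_root X i" "simple_root X j"] by (auto simp: ab pairing_def)
  have ba: "b * a = real p" "b * (a * z) = real p * z" "a * (b * z) = real p * z" for z
    using p by (simp_all add: mult.commute mult.left_commute flip: mult.assoc)
  let ?W = "weyl_prod X (rev (alt k i j)) (simple_root X j)"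
  have "p = 0 \<and> k \<in> {0, Suc 0} \<or> p = 1 \<and> k \<in> {0, Suc 0, 2} \<or> p = 2 \<and> k \<in> {0, Suc 0, 2, 3} \<or>
      p = 3 \<and> k \<in> {0, Suc 0, 2, 3, 4, 5}"
    using k simple_bond_less[OF ij] by (auto simp: coxeter_def braid_length_def p_def[symmetric] split: if_splits)
  then have "?W = L 0 1 \<or> ?W = L a 0 \<or> ?W = L a 1 \<or> ?W = L a 2"
    using zero unfolding start
    by (elim disjE conjE insertE emptyE)
       (simp_all add: numeral_eq_Suc weyl_prod_append weyl_prod_Cons i j p ba right_diff_distrib left_diff_distrib)
  then have "\<exists>x\<ge>0. \<exists>y\<ge>0. ?W = L x y"
    using pos(1) by (metis zero_le_numeral zero_le_one order_refl)
  then show ?thesis by (simp add: L_def)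
qed

text \<open>The alternating prefix grows letter by letter. If the tail had neither letter as a
  descent, w^-1 would send one of the two simple roots to a nonnegative combination of positive
  roots, against the assumed descents.\<close>

lemma dihedral_prefix:
  assumes "is": "reduced is" and ij: "i \<in> I" "j \<in> I" "i \<noteq> j" and d: "descent is i" "descent is j"
  shows "\<exists>us. reduced (alt (coxeter i j) i j @ us) \<and> reduced (alt (coxeter i j) j i @ us) \<and>
    weyl_prod X (alt (coxeter i j) i j @ us) = weyl_prod X is \<and>
    weyl_prod X (alt (coxeter i j) j i @ us) = weyl_prod X is"
proof -
  let ?m = "coxeter i j"
  define P where "P k \<longleftrightarrow> (\<exists>a b us. {a, b} = {i, j} \<and> reduced (alt k a b @ us) \<and>
    weyl_prod X (alt k a b @ us) = weyl_prod X is)" for k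
  have "P k" if "k \<le> ?m" for k
    using that
  proof (induction k)
    case 0
    then show ?case using "is" unfolding P_def by (intro exI[of _ i] exI[of _ j] exI[of _ "is"]) simp
  next
    case (Suc k)
    then obtain a b us where ab: "{a, b} = {i, j}" "reduced (alt k a b @ us)"
        "weyl_prod X (alt k a b @ us) = weyl_prod X is"
      unfolding P_def by auto
    have abI: "a \<in> I" "b \<in> I" "a \<noteq> b" and db: "descent is b" and "coxeter a b = ?m"
      using ab(1) ij d by (auto simp: doubleton_eq_iff coxeter_sym)
    have us: "reduced us" using reduced_appendD ab(2) by blast
    define c where "c = (if even k then a else b)"
    have cI: "c \<in> I" using abI by (simp add: c_def)
    have set: "set (alt k x y @ vs) \<subseteq> I" if "x \<in> I" "y \<in> I" "set vs \<subseteq> I" for k x y and vs :: "nat list"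
      using that set_alt[of k x y] by auto
    show ?case
    proof (cases "descent us c")
      case True
      then obtain vs where vs: "reduced (c # vs)" "weyl_prod X (c # vs) = weyl_prod X us"
        using descent_imp_reduced_Cons[OF us cI] by blast
      have eq: "alt (Suc k) a b @ vs = alt k a b @ (c # vs)" by (simp add: alt_Suc_snoc c_def del: alt.simps)
      then have w: "weyl_prod X (alt (Suc k) a b @ vs) = weyl_prod X (alt k a b @ us)"
        by (simp only: weyl_prod_append vs(2))
      moreover have "length (c # vs) \<le> length us"
        using reduced_length_le[OF vs(1) reduced_set[OF us]] vs(2) by simp
      ultimately have "reduced (alt (Suc k) a b @ vs)"
        using set[of a b vs "Suc k"] abI reduced_set[OF vs(1)] by (intro reduced_cong[OF ab(2)]) auto
      then show ?thesis using w ab(1,3) unfolding P_def by metis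
    next
      case False
      show ?thesis
      proof (cases k)
        case 0
        obtain vs where vs: "reduced (i # vs)" "weyl_prod X (i # vs) = weyl_prod X is"
          using descent_imp_reduced_Cons[OF "is" ij(1) d(1)] by blast
        then show ?thesis unfolding P_def 0 by (intro exI[of _ i] exI[of _ j] exI[of _ vs]) simp
      next
        case (Suc l)
        define e where "e = (if even l then a else b)"
        have e: "alt k a b = alt l a b @ [e]" by (simp add: Suc alt_Suc_snoc e_def del: alt.simps)
        have eI: "e \<in> I" using abI by (simp add: e_def)
        \<comment> \<open>The last letter e of the prefix would cancel against the same letter at
          the front of the tail.\<close>
        have "\<not> descent us e"
        proof
          assume "descent us e"
          then obtain vs where vs: "reduced (e # vs)" "weyl_prod X (e # vs) = weyl_prod X us"
            using descent_imp_reduced_Cons[OF us eI] by blast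
          have "weyl_prod X (alt k a b @ us) = weyl_prod X (alt l a b) \<circ> weyl_prod X (e # e # vs)"
            by (simp only: e weyl_prod_append weyl_prod_Cons[of X e "e # _"] weyl_prod_Cons[of X e "[]"] vs(2)
              weyl_prod_Nil comp_id comp_assoc)
          then have "weyl_prod X (alt l a b @ vs) = weyl_prod X (alt k a b @ us)"
            using eI by (simp add: weyl_prod_append)
          moreover have "set (alt l a b @ vs) \<subseteq> I"
            using reduced_set[OF vs(1)] abI by (intro set) auto
          ultimately have "length (alt k a b @ us) \<le> length (alt l a b @ vs)"
            using reduced_length_le[OF ab(2)] by blast
          moreover have "length (e # vs) \<le> length us"
            using reduced_length_le[OF vs(1) reduced_set[OF us]] vs(2) by simp
          ultimately show False by (simp add: Suc)
        qed
        then have "\<not> descent us a" "\<not> descent us b"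
          using False by (auto simp: c_def e_def Suc split: if_splits)
        then have pos: "positive (weyl_prod X (rev us) (simple_root X a))"
            "positive (weyl_prod X (rev us) (simple_root X b))"
          using not_descent[OF reduced_set[OF us]] abI by auto
        obtain x y where xy: "x \<ge> 0" "y \<ge> 0" "weyl_prod X (rev (alt k a b)) (simple_root X b) =
            (\<lambda>l. x * simple_root X a l + y * simple_root X b l)"
          using dihedral_positive[OF abI, of k] Suc.prems \<open>coxeter a b = ?m\<close> by auto
        have "weyl_prod X (rev (alt k a b @ us)) (simple_root X b) =
            (\<lambda>l. x * weyl_prod X (rev us) (simple_root X a) l + y * weyl_prod X (rev us) (simple_root X b) l)"
          by (simp add: weyl_prod_append xy(3) linear_vec_add[OF linear_vec_weyl_prod]
            linear_vec_scale[OF linear_vec_weyl_prod])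
        then have "positive (weyl_prod X (rev (alt k a b @ us)) (simple_root X b))"
          using positive_add_scaled[OF pos xy(1,2)] by simp
        moreover have "descent (alt k a b @ us) b"
          using db descent_cong[OF reduced_set[OF ab(2)] reduced_set[OF "is"] ab(3)] by simp
        ultimately show ?thesis
          using descent_not_positive[OF reduced_set[OF ab(2)]] abI by blast
      qed
    qed
  qed
  from this[OF order_refl] obtain a b us where ab: "{a, b} = {i, j}" "reduced (alt ?m a b @ us)"
      "weyl_prod X (alt ?m a b @ us) = weyl_prod X is"
    unfolding P_def by blast
  then have cases: "a = i \<and> b = j \<or> a = j \<and> b = i" by (auto simp: doubleton_eq_iff)
  \<comment> \<open>The braid relation between the two simple reflections supplies the word with the
    other first letter.\<close>
  then have swap: "weyl_prod X (alt ?m b a @ us) = weyl_prod X is"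
    using ab(3) weyl_prod_alt[OF ij] by (elim disjE conjE) (simp_all add: weyl_prod_append)
  moreover have "set (alt ?m b a @ us) \<subseteq> I"
    using set_alt[of ?m b a] reduced_set[OF ab(2)] cases ij by auto
  ultimately have "reduced (alt ?m b a @ us)"
    using reduced_cong[OF ab(2)] ab(3) by simp
  then show ?thesis using ab swap cases by (intro exI[of _ us]) (elim disjE conjE; simp)
qed

end

definition list_value :: "('a, 'b) monoid_scheme \<Rightarrow> ('g \<Rightarrow> 'a) \<Rightarrow> 'g list \<Rightarrow> 'a" where
  "list_value G f gs = foldr (\<lambda>g x. f g \<otimes>\<^bsub>G\<^esub> x) gs \<one>\<^bsub>G\<^esub>"

lemma list_value_simps [simp]:
  "list_value G f [] = \<one>\<^bsub>G\<^esub>" "list_value G f (g # gs) = f g \<otimes>\<^bsub>G\<^esub> list_value G f gs"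
  by (simp_all add: list_value_def)

context group
begin

lemma list_value_closed [simp]: "f ` set gs \<subseteq> carrier G \<Longrightarrow> list_value G f gs \<in> carrier G"
  by (induction gs) auto

lemma list_value_append:
  "f ` set gs \<subseteq> carrier G \<Longrightarrow> f ` set hs \<subseteq> carrier G \<Longrightarrow>
    list_value G f (gs @ hs) = list_value G f gs \<otimes> list_value G f hs"
  by (induction gs) (auto simp: m_assoc)

end

text \<open>If the first letters i and j differ, both are descents, so there are reduced words with
  the two alternating prefixes and a common tail. Each shares its first letter with one of the given
  words, where induction applies, and the two differ by a braid relation.\<close>

theorem (in root_datum) matsumoto:
  assumes "group H" and f: "\<And>i. i \<in> I \<Longrightarrow> f i \<in> carrier H"
    and braid: "\<And>i j. i \<in> I \<Longrightarrow> j \<in> I \<Longrightarrow> i \<noteq> j \<Longrightarrow>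
      list_value H f (alt (coxeter i j) i j) = list_value H f (alt (coxeter i j) j i)"
    and "reduced is" "reduced js" "weyl_prod X is = weyl_prod X js"
  shows "list_value H f is = list_value H f js"
  using assms(4-)
proof (induction "length is" arbitrary: "is" js rule: less_induct)
  case less
  interpret H: group H by fact
  have len: "length js = length is"
    using reduced_length_le[OF less.prems(1) reduced_set[OF less.prems(2)]]
      reduced_length_le[OF less.prems(2) reduced_set[OF less.prems(1)]] less.prems(3) by simp
  show ?case
  proof (cases "is")
    case Nil
    then show ?thesis using len by simp
  next
    case (Cons i is')
    then obtain j js' where js: "js = j # js'" using len by (cases js) auto
    have I: "i \<in> I" "j \<in> I"
      using reduced_set[OF less.prems(1)] reduced_set[OF less.prems(2)] Cons js by auto
    note rs = reduced_ConsD[OF less.prems(1)[unfolded Cons]] reduced_ConsD[OF less.prems(2)[unfolded js]]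
    show ?thesis
    proof (cases "i = j")
      case True
      then have "weyl_prod X is' = weyl_prod X js'"
        using weyl_prod_Cons_cancel[OF I(1), of is' js'] less.prems(3) Cons js by simp
      then show ?thesis using less.hyps[of is' js'] rs True Cons js by simp
    next
      case False
      let ?m = "coxeter i j"
      have "descent is i" "descent is j"
        using reduced_Cons_imp_descent[OF less.prems(1)[unfolded Cons]]
          reduced_Cons_imp_descent[OF less.prems(2)[unfolded js]]
          descent_cong[OF reduced_set[OF less.prems(1)] reduced_set[OF less.prems(2)] less.prems(3)]
        by (simp_all add: Cons js)
      then obtain us where us: "reduced (alt ?m i j @ us)" "reduced (alt ?m j i @ us)"
          "weyl_prod X (alt ?m i j @ us) = weyl_prod X is" "weyl_prod X (alt ?m j i @ us) = weyl_prod X is"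
        using dihedral_prefix[OF less.prems(1) I False] by blast
      obtain l where l: "?m = Suc l" using coxeter_pos[OF I False] by (cases ?m) auto
      have "weyl_prod X is' = weyl_prod X (alt l j i @ us)"
        using weyl_prod_Cons_cancel[OF I(1), of is' "alt l j i @ us"] us(3) Cons by (simp add: l)
      then have i: "list_value H f is' = list_value H f (alt l j i @ us)"
        using less.hyps[of is' "alt l j i @ us"] rs(1) us(1) reduced_ConsD[of i] Cons by (simp add: l)
      have "weyl_prod X js' = weyl_prod X (alt l i j @ us)"
        using weyl_prod_Cons_cancel[OF I(2), of js' "alt l i j @ us"] us(4) js less.prems(3) by (simp add: l)
      then have j: "list_value H f js' = list_value H f (alt l i j @ us)"
        using less.hyps[of js' "alt l i j @ us"] rs(2) us(2) reduced_ConsD[of j] js len Cons by (simp add: l)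
      have cl: "f ` set (alt k x y) \<subseteq> carrier H" if "x \<in> I" "y \<in> I" for k x y
        using f set_alt[of k x y] that by auto
      have us_cl: "f ` set us \<subseteq> carrier H"
        using f reduced_set[OF us(1)] by auto
      have "list_value H f is = list_value H f (alt ?m i j @ us)" by (simp add: Cons i l)
      also have "\<dots> = list_value H f (alt ?m j i @ us)"
        using braid[OF I False] by (simp add: H.list_value_append cl I us_cl del: alt.simps)
      also have "\<dots> = list_value H f js" by (simp add: js j l)
      finally show ?thesis .
    qed
  qed
qed

section \<open>The double affine reflection representation\<close>

abbreviation "BijVec \<equiv> BijGroup (UNIV :: vec set)"

interpretation BijVec: group BijVec
  by (rule group_BijGroup)

lemma carrier_BijVec: "f \<in> carrier BijVec \<longleftrightarrow> bij f"
  by (simp add: BijGroup_def Bij_def)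

lemma mult_BijVec [simp]: "bij f \<Longrightarrow> bij g \<Longrightarrow> f \<otimes>\<^bsub>BijVec\<^esub> g = f \<circ> g"
  by (simp add: BijGroup_def Bij_def compose_def fun_eq_iff)

lemma one_BijVec [simp]: "\<one>\<^bsub>BijVec\<^esub> = id"
  by (simp add: BijGroup_def fun_eq_iff)

lemma inv_BijVec: "bij f \<Longrightarrow> f \<circ> g = id \<Longrightarrow> g \<circ> f = id \<Longrightarrow> inv\<^bsub>BijVec\<^esub> f = g"
  by (rule BijVec.inv_equality) (auto simp: carrier_BijVec o_bij)

text \<open>For two affine nodes, \<open>umlaut_q\<close> ties the ratio of root lengths to the
  level of the congruence group.\<close>

locale diagram_datum = root_datum "finite_type D" s q \<rho> for D s q \<rho> +
  assumes admissible: "admissible D" and umlaut_q: "D = Umlaut Y \<Longrightarrow> q = level D"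
begin

abbreviation "X \<equiv> finite_type D"

lemma theta_root: "theta D \<in> roots X"
  by (cases D) (use highest_root dominant_short_root in auto)

lemma node_root_in_roots: "g \<in> nodes D \<Longrightarrow> node_root D g \<in> roots X"
  using theta_root highest_root simple_root_in_roots
  by (cases g; cases D) (auto simp: nodes_def)

lemma T_in_nodes: "T i \<in> nodes D \<longleftrightarrow> i \<in> I"
  by (cases D) (auto simp: nodes_def)

definition T_list :: "nat list \<Rightarrow> gen word" where
  "T_list is = concat (map (\<lambda>i. pos (T i)) is)"

lemma T_list_words: "T_list is \<in> words (nodes D) \<longleftrightarrow> set is \<subseteq> I"
  by (induction "is") (auto simp: T_list_def T_in_nodes)

definition weyl_element :: "(vec \<Rightarrow> vec) \<Rightarrow> bool" where
  "weyl_element w \<longleftrightarrow> (\<exists>is. set is \<subseteq> I \<and> w = weyl_prod X is)"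

lemma T_word_reduced:
  assumes "weyl_element w"
  shows "\<exists>is. reduced is \<and> weyl_prod X is = w \<and> T_word X w = T_list is"
proof -
  obtain "is" where "set is \<subseteq> I \<and> weyl_prod X is = w"
    using assms by (auto simp: weyl_element_def)
  then obtain js where "set js \<subseteq> I" "weyl_prod X js = w"
      "\<And>ks. set ks \<subseteq> I \<and> weyl_prod X ks = w \<Longrightarrow> length js \<le> length ks"
    using ex_has_least_nat[of "\<lambda>is. set is \<subseteq> I \<and> weyl_prod X is = w" "is" length] by blast
  then have "reduced_expression X w js" by (simp add: reduced_expression_def)
  then have "reduced_expression X w (SOME is. reduced_expression X w is)" by (rule someI)
  then show ?thesis
    by (intro exI[of _ "SOME is. reduced_expression X w is"])
       (auto simp: reduced_def T_word_def T_list_def reduced_expression_def)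
qed

lemma T_word_words: "weyl_element w \<Longrightarrow> T_word X w \<in> words (nodes D)"
  using T_word_reduced[of w] reduced_set T_list_words by auto

text \<open>The reflection in w \<alpha>_i is w s_i w^-1.\<close>

lemma weyl_element_reflection:
  assumes "\<beta> \<in> roots X"
  shows "weyl_element (reflection X \<beta>)"
proof -
  obtain "is" i where *: "set is \<subseteq> I" "i \<in> I" "\<beta> = weyl_prod X is (simple_root X i)"
    using assms by (rule rootE)
  have "reflection X \<beta> x = weyl_prod X (is @ i # rev is) x" for x
    using weyl_reflection[OF *(1), of "simple_root X i" "weyl_prod X (rev is) x"] *
    by (simp add: weyl_prod_append weyl_prod_Cons)
  then show ?thesis
    unfolding weyl_element_def using * by (intro exI[of _ "is @ i # rev is"]) auto
qed

lemma weyl_element_comp: "weyl_element v \<Longrightarrow> weyl_element w \<Longrightarrow> weyl_element (v \<circ> w)"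
  unfolding weyl_element_def by (metis Un_subset_iff set_append weyl_prod_append)

lemma theta_words: "Theta_word D \<in> words (nodes D)"
  and phi_words: "Phi_word D \<in> words (nodes D)"
  and psi_words: "Psi_word D \<in> words (nodes D)"
  unfolding Theta_word_def Phi_word_def Psi_word_def inv_word_in_words
  using theta_root highest_root by (auto intro!: T_word_words weyl_element_comp weyl_element_reflection)

lemma alternating_words: "g \<in> S \<Longrightarrow> h \<in> S \<Longrightarrow> alternating k g h \<in> words S"
  by (induction k arbitrary: g h) auto

lemma central_word_words: "central_word D \<in> words (nodes D)"
proof (cases D)
  case (Triple Y)
  then show ?thesis using theta_words by (auto simp: nodes_def)
next
  case (Umlaut Y)
  then show ?thesis using theta_words phi_words psi_words by (auto simp: nodes_def)
qed

lemma relation_words: "(u, v) \<in> relations D \<Longrightarrow> u \<in> words (nodes D) \<and> v \<in> words (nodes D)"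
proof -
  have "u \<in> words (nodes D) \<and> v \<in> words (nodes D)" if uv: "(u, v) \<in> extra_relations D"
  proof -
    obtain n g h where n: "D = Triple (TypeC n)" "{g, h} \<subseteq> {Theta01, Theta02, Theta03}"
      "u = pos g @ neg (T 1) @ pos h @ pos (T 1)" "v = neg (T 1) @ pos h @ pos (T 1) @ pos g"
      using uv by (cases D; cases "finite_type D") auto
    then show ?thesis using admissible by (auto simp: nodes_def atLeastAtMost_iff)
  qed
  then show "u \<in> words (nodes D) \<and> v \<in> words (nodes D)" if "(u, v) \<in> relations D"
    using that central_word_words
    by (auto simp: relations_def braid_relations_def central_relations_def intro!: alternating_words)
qed

sublocale BG: presentation "nodes D" "relations D"
  by unfold_locales (rule relation_words)

lemma braid_group_eq: "braid_group D = BG.PG"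
  by (simp add: braid_group_def)

lemma elt_eq: "elt D = BG.cls"
  by (simp add: elt_def fun_eq_iff)

text \<open>The coordinate 0 holds the imaginary part. Its value a + b at \<open>Theta02\<close>
  makes the image of the central word trivial: the three affine reflections contribute a, -(a + b)
  and b.\<close>

definition rep_vec :: "real \<Rightarrow> real \<Rightarrow> gen \<Rightarrow> vec" where
  "rep_vec a b g = (case g of T i \<Rightarrow> simple_root X i
    | Theta01 \<Rightarrow> (theta D)(0 := a) | Theta02 \<Rightarrow> (theta D)(0 := a + b) | Theta03 \<Rightarrow> (theta D)(0 := b)
    | Theta0 \<Rightarrow> (theta D)(0 := a) | Phi0 \<Rightarrow> (highest_root X)(0 := b))"

text \<open>The bilinear form ignores the coordinate 0, which hence plays the role of an imaginary root.\<close>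

lemma ip_upd [simp]: "ip Y (v(0 := c)) w = ip Y v w" "ip Y v (w(0 := c)) = ip Y v w"
  by (auto simp: ip_def atLeastAtMost_iff intro!: sum.cong)

lemma pairing_upd [simp]: "pairing Y (v(0 := c)) w = pairing Y v w" "pairing Y v (w(0 := c)) = pairing Y v w"
  by (simp_all add: pairing_def)

lemma pairing_rep_vec [simp]:
  "pairing X (rep_vec a b g) w = pairing X (node_root D g) w"
  "pairing X v (rep_vec a b g) = pairing X v (node_root D g)"
  by (cases g; simp add: rep_vec_def)+

lemma ip_rep_vec: "ip X (rep_vec a b g) (rep_vec a b g) = ip X (node_root D g) (node_root D g)"
  by (cases g; simp add: rep_vec_def)

definition rep_gen :: "real \<Rightarrow> real \<Rightarrow> gen \<Rightarrow> vec \<Rightarrow> vec" where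
  "rep_gen a b g = reflection X (rep_vec a b g)"

lemma rep_gen_norm: "g \<in> nodes D \<Longrightarrow> ip X (rep_vec a b g) (rep_vec a b g) \<noteq> 0"
  using root_norm_pos[OF node_root_in_roots[of g]] by (simp add: ip_rep_vec)

lemma rep_gen_bij: "g \<in> nodes D \<Longrightarrow> bij (rep_gen a b g)"
  using rep_gen_norm bij_reflection by (simp add: rep_gen_def)

lemma rep_gen_funcset: "rep_gen a b \<in> nodes D \<rightarrow> carrier BijVec"
  using rep_gen_bij by (auto simp: carrier_BijVec)

abbreviation rep_word :: "real \<Rightarrow> real \<Rightarrow> gen word \<Rightarrow> vec \<Rightarrow> vec" where
  "rep_word a b \<equiv> word_value BijVec (rep_gen a b)"

lemma rep_word_bij: "w \<in> words (nodes D) \<Longrightarrow> bij (rep_word a b w)"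
  using BijVec.word_value_closed[OF rep_gen_funcset] by (simp add: carrier_BijVec)

lemma rep_word_append:
  "u \<in> words (nodes D) \<Longrightarrow> v \<in> words (nodes D) \<Longrightarrow> rep_word a b (u @ v) = rep_word a b u \<circ> rep_word a b v"
  using BijVec.word_value_append[OF rep_gen_funcset] rep_word_bij by simp

lemma rep_word_pos: "g \<in> nodes D \<Longrightarrow> rep_word a b (pos g) = rep_gen a b g"
  using rep_gen_bij by (simp add: carrier_BijVec)

lemma rep_word_neg: "g \<in> nodes D \<Longrightarrow> rep_word a b (neg g) = rep_gen a b g"
proof -
  assume g: "g \<in> nodes D"
  then have "rep_word a b (neg g) = inv\<^bsub>BijVec\<^esub> (rep_gen a b g)"
    using rep_gen_bij by (simp add: carrier_BijVec)
  also have "\<dots> = rep_gen a b g"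
    using rep_gen_bij[OF g] rep_gen_norm[OF g] by (intro inv_BijVec) (auto simp: rep_gen_def)
  finally show ?thesis .
qed

lemma pos_list_words: "concat (map pos gs) \<in> words S \<longleftrightarrow> set gs \<subseteq> S"
  by (induction gs) auto

lemma rep_word_pos_list:
  "set gs \<subseteq> nodes D \<Longrightarrow> rep_word a b (concat (map pos gs)) = reflection_prod X (map (rep_vec a b) gs)"
proof (induction gs)
  case (Cons g gs)
  then have "rep_word a b (concat (map pos (g # gs))) = rep_word a b (pos g) \<circ> rep_word a b (concat (map pos gs))"
    using rep_word_append[of "pos g" "concat (map pos gs)"] by (simp add: pos_list_words)
  moreover have "rep_word a b (pos g) = reflection X (rep_vec a b g)"
    using Cons.prems rep_word_pos[of g a b] by (simp add: rep_gen_def)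
  ultimately show ?case using Cons by simp
qed simp

lemma rep_word_alternating:
  assumes "g \<in> nodes D" "h \<in> nodes D"
  shows "rep_word a b (alternating k g h) = reflection_prod X (alt k (rep_vec a b g) (rep_vec a b h))"
proof -
  have "set (alt k g h) \<subseteq> nodes D" using set_alt[of k g h] assms by auto
  from rep_word_pos_list[OF this] show ?thesis
    by (simp only: alternating_conv_alt map_alt[of "rep_vec a b"])
qed

lemma rep_word_T_list: "set is \<subseteq> I \<Longrightarrow> rep_word a b (T_list is) = weyl_prod X is"
proof -
  assume "set is \<subseteq> I"
  then have "set (map T is) \<subseteq> nodes D" by (auto simp: T_in_nodes)
  from rep_word_pos_list[OF this, of a b] show ?thesis
    by (simp add: T_list_def weyl_prod_conv_reflection_prod rep_vec_def comp_def)
qed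

lemma rep_word_T_word: "weyl_element w \<Longrightarrow> rep_word a b (T_word X w) = w"
  using T_word_reduced[of w] rep_word_T_list reduced_set by auto

lemma rep_word_inv:
  assumes "w \<in> words (nodes D)" "rep_word a b w \<circ> f = id" "f \<circ> rep_word a b w = id"
  shows "rep_word a b (inv_word w) = f"
  using BijVec.word_value_inv_word[OF rep_gen_funcset assms(1)] inv_BijVec[OF rep_word_bij] assms by simp

lemma theta_norm: "ip X (theta D) (theta D) \<noteq> 0" "ip X (highest_root X) (highest_root X) \<noteq> 0"
  using root_norm_pos theta_root highest_root(1) by force+

lemma root_0: "\<beta> \<in> roots X \<Longrightarrow> \<beta> 0 = 0"
  using root_support[of \<beta> 0] by (simp add: atLeastAtMost_iff One_nat_def)

lemma rep_word_Theta: "rep_word a b (Theta_word D) = reflection X (theta D)"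
  and rep_word_Phi: "rep_word a b (Phi_word D) = reflection X (highest_root X)"
  and rep_word_inv_Theta: "rep_word a b (inv_word (Theta_word D)) = reflection X (theta D)"
  and rep_word_inv_Phi: "rep_word a b (inv_word (Phi_word D)) = reflection X (highest_root X)"
  and rep_word_Psi: "rep_word a b (Psi_word D) = reflection X (theta D) \<circ> reflection X (highest_root X)"
proof -
  note we = weyl_element_reflection[OF theta_root] weyl_element_reflection[OF highest_root(1)]
  show *: "rep_word a b (Theta_word D) = reflection X (theta D)"
      "rep_word a b (Phi_word D) = reflection X (highest_root X)"
    using we by (simp_all add: Theta_word_def Phi_word_def rep_word_T_word)
  show "rep_word a b (inv_word (Theta_word D)) = reflection X (theta D)"
      "rep_word a b (inv_word (Phi_word D)) = reflection X (highest_root X)"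
    using theta_norm theta_words phi_words * by (auto intro!: rep_word_inv simp: o_def id_def)
  show "rep_word a b (Psi_word D) = reflection X (theta D) \<circ> reflection X (highest_root X)"
    unfolding Psi_word_def using we theta_norm
    by (intro rep_word_inv T_word_words weyl_element_comp)
       (auto simp: rep_word_T_word weyl_element_comp fun_eq_iff)
qed

text \<open>An affine reflection is the finite one with the coordinate 0 corrected by a multiple of
  a pairing.\<close>

lemma reflection_upd: "reflection X (\<gamma>(0 := c)) x = (reflection X \<gamma> x)(0 := x 0 - pairing X x \<gamma> * c)"
  by (auto simp: reflection_def fun_eq_iff)

lemma pairing_reflection:
  "pairing X (reflection X \<gamma> x) \<beta> = pairing X x \<beta> - pairing X x \<gamma> * pairing X \<gamma> \<beta>"
  by (simp add: reflection_def pairing_diff pairing_scale)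

lemma reflection_0: "\<gamma> 0 = 0 \<Longrightarrow> reflection X \<gamma> x 0 = x 0"
  by (simp add: reflection_def)

lemma reflection_upd_both:
  "reflection X \<gamma> (x(0 := c)) = (reflection X \<gamma> x)(0 := c - pairing X x \<gamma> * \<gamma> 0)"
  by (auto simp: reflection_def fun_eq_iff)

text \<open>The product of an affine reflection and its finite part only shifts the coordinate 0 by
  a multiple of a pairing, so such products commute. With three affine nodes the shifts add up to
  zero; with two, the central word maps to the commutator of the shifts for \<phi> and
  \<theta>.\<close>

lemma rep_central: "rep_word a b (central_word D) = id"
proof
  fix x
  have 0: "theta D 0 = 0" "highest_root X 0 = 0" using root_0 theta_root highest_root(1) by auto
  note simps = rep_gen_def rep_vec_def reflection_upd reflection_upd_both pairing_reflection
    pairing_self theta_norm 0 reflection_0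
  show "rep_word a b (central_word D) x = id x"
  proof (cases D)
    case (Triple Y)
    then have nodes: "Theta01 \<in> nodes D" "Theta02 \<in> nodes D" "Theta03 \<in> nodes D" by (auto simp: nodes_def)
    have "central_word D = pos Theta01 @ pos Theta02 @ pos Theta03 @ Theta_word D" by (simp add: Triple)
    then have "rep_word a b (central_word D) x = rep_gen a b Theta01 (rep_gen a b Theta02 (rep_gen a b Theta03
        (reflection X (theta D) x)))"
      using nodes theta_words rep_word_Theta by (simp add: rep_word_append rep_word_pos)
    also have "\<dots> = x" by (simp add: simps fun_eq_iff algebra_simps)
    finally show ?thesis by simp
  next
    case (Umlaut Y)
    then have nodes: "Theta0 \<in> nodes D" "Phi0 \<in> nodes D" by (auto simp: nodes_def)
    have "central_word D = pos Phi0 @ Phi_word D @ pos Theta0 @ Psi_word D @ pos Phi0 @ Theta_word D @ pos Theta0"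
      by (simp add: Umlaut)
    then have "rep_word a b (central_word D) x = rep_gen a b Phi0 (reflection X (highest_root X) (rep_gen a b Theta0
        (reflection X (theta D) (reflection X (highest_root X) (rep_gen a b Phi0
        (reflection X (theta D) (rep_gen a b Theta0 x)))))))"
      using nodes theta_words phi_words psi_words rep_word_Theta rep_word_Phi rep_word_Psi
      by (simp add: rep_word_append rep_word_pos)
    also have "\<dots> = x" by (simp add: simps fun_eq_iff algebra_simps)
    finally show ?thesis by simp
  qed
qed

text \<open>Imaginary parts are invisible to the form, so edges are pairings of finite roots. The
  two affine nodes of an umlaut diagram have pairings 1 and q; the bound excludes three affine
  nodes, pairwise joined by 4 edges.\<close>

lemma rep_edges:
  assumes "g \<in> nodes D" "h \<in> nodes D" "g \<noteq> h" "edges D g h < 4"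
  shows "pairing X (node_root D g) (node_root D h) * pairing X (node_root D h) (node_root D g) =
    real (edges D g h)"
proof (cases "g \<in> affine_nodes D \<and> h \<in> affine_nodes D")
  case True
  then obtain Y where D: "D = Umlaut Y" using assms(4) by (cases D) (auto simp: edges_def)
  have "q \<noteq> 1" "edges D g h = q" using umlaut_q[OF D] True by (auto simp: D edges_def)
  then show ?thesis using True assms(3) short_long_pairing
    by (auto simp: D)
next
  case False
  then show ?thesis
    using root_bond[OF node_root_in_roots[OF assms(1)] node_root_in_roots[OF assms(2)]]
    by (auto simp: edges_def)
qed

text \<open>Starting from the simple root 2 e_n, simple reflections lead to 2 e_1, which is long and
  dominant.\<close>

lemma highest_root_C:
  assumes "D = Triple (TypeC n)"
  shows "highest_root X = (\<lambda>j. 2 * unit_vec 1 j)"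
proof -
  have n: "n \<ge> 2" using admissible assms by simp
  interpret C: root_datum "TypeC n" 2 2 "\<lambda>j. real (n + 1) - real j"
    using root_datum_C n by simp
  have "(\<lambda>j. 2 * unit_vec (n - k) j) \<in> roots (TypeC n)" if "k < n" for k
    using that
  proof (induction k)
    case 0
    then show ?case using C.simple_root_in_roots[of n] n by (simp add: atLeastAtMost_iff)
  next
    case (Suc k)
    define m where "m = n - Suc k"
    have m: "m \<in> {1..n}" "m + 1 \<in> {1..n}" "Suc m \<in> {1..n}" "m \<noteq> n" "n - k = Suc m" using Suc.prems by (auto simp: m_def atLeastAtMost_iff)
    have "reflection (TypeC n) (simple_root (TypeC n) m) (\<lambda>j. 2 * unit_vec (Suc m) j) = (\<lambda>j. 2 * unit_vec m j)"
      using m by (simp add: reflection_def pairing_def ip_linear ip_unit_left fun_eq_iff) (simp add: unit_vec_apply)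
    then show ?case
      using C.weyl_root[of "\<lambda>j. 2 * unit_vec (Suc m) j" "[m]"] Suc m
      by (simp add: weyl_prod_Cons m_def[symmetric])
  qed
  from this[of "n - 1"] have "(\<lambda>j. 2 * unit_vec 1 j) \<in> roots (TypeC n)" using n by simp
  moreover have "C.short.dominant (\<lambda>j. 2 * unit_vec 1 j)"
    using n by (auto simp: C.short.dominant_def ip_linear ip_unit_left) (auto simp: unit_vec_apply atLeastAtMost_iff)
  moreover have "ip (TypeC n) (\<lambda>j. 2 * unit_vec 1 j) (\<lambda>j. 2 * unit_vec 1 j) = real 2 * 2"
    using n by (simp add: ip_linear ip_unit_left atLeastAtMost_iff) (simp add: unit_vec_apply)
  ultimately show ?thesis using C.highest_root_eq assms by simp
qed

text \<open>Conjugation by \<open>T 1\<close> turns the reflection in 2 e_1 + d into that in 2 e_2 +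
  d, which commutes with the reflection in the orthogonal vector 2 e_1 + c.\<close>

lemma rep_extra:
  assumes "(u, v) \<in> extra_relations D"
  shows "rep_word a b u = rep_word a b v"
proof -
  obtain n g h where D: "D = Triple (TypeC n)"
    and uv: "u = pos g @ neg (T 1) @ pos h @ pos (T 1)" "v = neg (T 1) @ pos h @ pos (T 1) @ pos g"
    and gh: "g \<in> {Theta01, Theta02, Theta03}" "h \<in> {Theta01, Theta02, Theta03}"
    using assms by (cases D; cases "finite_type D") auto
  have n: "n \<ge> 2" using admissible D by simp
  have nodes: "g \<in> nodes D" "h \<in> nodes D" "T 1 \<in> nodes D"
    using gh D n by (auto simp: nodes_def atLeastAtMost_iff)
  obtain c d where cd: "rep_gen a b g = reflection X ((theta D)(0 := c))"
      "rep_gen a b h = reflection X ((theta D)(0 := d))"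
    using gh by (auto simp: rep_gen_def rep_vec_def)
  let ?\<alpha> = "simple_root X 1"
  have \<theta>: "theta D = (\<lambda>j. 2 * unit_vec 1 j)" using highest_root_C[OF D] D by simp
  have \<alpha>: "?\<alpha> = (\<lambda>j. unit_vec 1 j - unit_vec 2 j)" using D n by (simp add: numeral_2_eq_2)
  have X: "X = TypeC n" using D by simp
  have pairings: "pairing X (theta D) ?\<alpha> = 2" "pairing X ?\<alpha> (theta D) = 1" "pairing X ?\<alpha> ?\<alpha> = 2"
      "pairing X (theta D) (theta D) = 2"
    unfolding \<theta> \<alpha> unfolding X
    using n by (simp_all add: pairing_def ip_linear ip_unit_left atLeastAtMost_iff) (simp_all add: unit_vec_apply)
  have "theta D 0 = 0" "?\<alpha> 0 = 0" unfolding \<theta> \<alpha> by (simp_all add: unit_vec_apply)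
  then have "reflection X ((theta D)(0 := c)) (reflection X ?\<alpha> (reflection X ((theta D)(0 := d)) (reflection X ?\<alpha> x))) =
      reflection X ?\<alpha> (reflection X ((theta D)(0 := d)) (reflection X ?\<alpha> (reflection X ((theta D)(0 := c)) x)))" for x
    unfolding reflection_upd reflection_upd_both
    by (simp add: pairing_reflection pairings fun_eq_iff) (simp add: reflection_def pairing_diff pairing_scale pairings)
  moreover have "rep_gen a b (T 1) = reflection X ?\<alpha>" by (simp add: rep_gen_def rep_vec_def)
  ultimately show ?thesis
    using nodes by (intro ext) (simp add: uv rep_word_append rep_word_pos rep_word_neg cd)
qed

lemma rep_relations:
  assumes "(u, v) \<in> relations D"
  shows "rep_word a b u = rep_word a b v"
proof -
  consider (braid) "(u, v) \<in> braid_relations (nodes D) (edges D)"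
    | (central) "(u, v) \<in> central_relations (nodes D) (central_word D)" | (extra) "(u, v) \<in> extra_relations D"
    using assms by (auto simp: relations_def)
  then show ?thesis
  proof cases
    case braid
    then obtain g h where gh: "g \<in> nodes D" "h \<in> nodes D" "g \<noteq> h" "edges D g h < 4"
      and uv: "u = alternating (braid_length (edges D g h)) g h" "v = alternating (braid_length (edges D g h)) h g"
      by (auto simp: braid_relations_def)
    show ?thesis unfolding uv rep_word_alternating[OF gh(1,2)] rep_word_alternating[OF gh(2,1)]
      using gh rep_edges[OF gh] rep_gen_norm by (intro reflection_prod_alt_braid) auto
  next
    case central
    then show ?thesis
      using central_word_words by (auto simp: central_relations_def rep_word_append rep_central)
  qed (rule rep_extra)
qed

definition rep :: "real \<Rightarrow> real \<Rightarrow> gen word set \<Rightarrow> vec \<Rightarrow> vec" where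
  "rep a b = BG.pres_lift BijVec (rep_gen a b)"

lemma rep_hom: "rep a b \<in> hom (braid_group D) BijVec"
  unfolding rep_def braid_group_eq
  by (intro BG.pres_lift_hom group_BijGroup rep_gen_funcset rep_relations)

lemma rep_elt: "w \<in> words (nodes D) \<Longrightarrow> rep a b (elt D w) = rep_word a b w"
  unfolding rep_def elt_eq
  by (intro BG.pres_lift_cls group_BijGroup rep_gen_funcset rep_relations)

section \<open>The action on the parameters of the representations\<close>

lemma a_word_words: "g \<in> nodes D \<Longrightarrow> a_word D g \<in> words (nodes D)"
  and b_word_words: "g \<in> nodes D \<Longrightarrow> b_word D g \<in> words (nodes D)"
  using phi_words theta_words by (cases g; cases D; auto simp: nodes_def)+

text \<open>With three affine nodes, the reflection in \<theta> + a + b sends \<theta> + a to the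
  negative of \<theta> + a + 2 b. With two, conjugation by \<Phi>_0 \<Phi> shifts \<theta> + a by b
  times the pairing of \<theta> with \<phi>, which is 1.\<close>

lemma rep_a_word:
  assumes g: "g \<in> nodes D"
  shows "rep_word a b (a_word D g) = rep_gen (a + b) b g"
proof -
  have 0: "theta D 0 = 0" "highest_root X 0 = 0" using root_0 theta_root highest_root(1) by auto
  note simps = rep_gen_def rep_vec_def reflection_upd reflection_upd_both pairing_reflection
    pairing_self theta_norm 0 reflection_0
  show ?thesis
  proof (cases D)
    case (Triple Y)
    then have nodes: "Theta01 \<in> nodes D" "Theta02 \<in> nodes D" "Theta03 \<in> nodes D" by (auto simp: nodes_def)
    have "g \<in> {Theta01, Theta02, Theta03} \<or> (\<exists>i. g = T i)"
      using g by (auto simp: nodes_def Triple)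
    moreover have "level D = 1" by (simp add: Triple)
    ultimately show ?thesis
      using g nodes by (auto simp: rep_word_append rep_word_pos rep_word_neg simps fun_eq_iff algebra_simps)
  next
    case (Umlaut Y)
    then have nodes: "Theta0 \<in> nodes D" "Phi0 \<in> nodes D" by (auto simp: nodes_def)
    have "q \<noteq> 1" using umlaut_q[OF Umlaut] Umlaut by auto
    then have "pairing X (theta D) (highest_root X) = 1" using short_long_pairing Umlaut by simp
    moreover have "g \<in> {Theta0, Phi0} \<or> (\<exists>i. g = T i)"
      using g by (auto simp: nodes_def Umlaut)
    ultimately show ?thesis
      using g nodes phi_words
      by (auto simp: rep_word_append rep_word_pos rep_word_neg rep_word_Phi rep_word_inv_Phi simps
        fun_eq_iff algebra_simps)
  qed
qed

text \<open>With two affine nodes the shift of \<phi> + b involves the pairing of \<phi> with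
  \<theta>, which is the level; this is the factor in the matrix of u2^r.\<close>

lemma rep_b_word:
  assumes g: "g \<in> nodes D"
  shows "rep_word a b (b_word D g) = rep_gen a (b - real (level D) * a) g"
proof -
  have 0: "theta D 0 = 0" "highest_root X 0 = 0" using root_0 theta_root highest_root(1) by auto
  note simps = rep_gen_def rep_vec_def reflection_upd reflection_upd_both pairing_reflection
    pairing_self theta_norm 0 reflection_0
  show ?thesis
  proof (cases D)
    case (Triple Y)
    then have nodes: "Theta01 \<in> nodes D" "Theta02 \<in> nodes D" "Theta03 \<in> nodes D" by (auto simp: nodes_def)
    have "g \<in> {Theta01, Theta02, Theta03} \<or> (\<exists>i. g = T i)"
      using g by (auto simp: nodes_def Triple)
    moreover have "level D = 1" by (simp add: Triple)
    ultimately show ?thesis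
      using g nodes by (auto simp: rep_word_append rep_word_pos rep_word_neg simps fun_eq_iff algebra_simps)
  next
    case (Umlaut Y)
    then have nodes: "Theta0 \<in> nodes D" "Phi0 \<in> nodes D" by (auto simp: nodes_def)
    have "q \<noteq> 1" using umlaut_q[OF Umlaut] Umlaut by auto
    then have "pairing X (highest_root X) (theta D) = level D"
      using short_long_pairing umlaut_q[OF Umlaut] Umlaut by simp
    moreover have "g \<in> {Theta0, Phi0} \<or> (\<exists>i. g = T i)"
      using g by (auto simp: nodes_def Umlaut)
    ultimately show ?thesis
      using g nodes theta_words
      by (auto simp: rep_word_append rep_word_pos rep_word_neg rep_word_Theta rep_word_inv_Theta simps
        fun_eq_iff algebra_simps)
  qed
qed

text \<open>Applied to \<gamma>, the reflection in \<gamma> + c changes the coordinate 0 by -2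
  c.\<close>

lemma rep_inject:
  assumes "\<And>g. g \<in> nodes D \<Longrightarrow> rep_gen a b g = rep_gen a' b' g"
  shows "a = a' \<and> b = b'"
proof -
  have eq: "c = d" if "reflection X (\<gamma>(0 := c)) = reflection X (\<gamma>(0 := d))" "ip X \<gamma> \<gamma> \<noteq> 0" for \<gamma> c d
    using fun_cong[OF fun_cong[OF that(1), of \<gamma>], of 0] that(2) by (simp add: reflection_def pairing_self)
  show ?thesis
  proof (cases "Theta01 \<in> nodes D")
    case True
    then have "Theta03 \<in> nodes D" by (cases D) (auto simp: nodes_def)
    then show ?thesis
      using assms[of Theta01] assms[of Theta03] True theta_norm
      by (auto simp: rep_gen_def rep_vec_def intro: eq)
  next
    case False
    then have "Theta0 \<in> nodes D" "Phi0 \<in> nodes D" by (cases D; auto simp: nodes_def)+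
    then show ?thesis
      using assms[of Theta0] assms[of Phi0] theta_norm
      by (auto simp: rep_gen_def rep_vec_def intro: eq)
  qed
qed

end

section \<open>Artin groups of rank two and the groups \<open>\<Gamma>\<^sub>1(r)\<close>\<close>

lemma words_UNIV [simp]: "w \<in> words UNIV"
  by (simp add: words_def)

lemma (in group) word_value_alternating:
  "f g \<in> carrier G \<Longrightarrow> f h \<in> carrier G \<Longrightarrow>
    word_value G f (alternating k g h) = list_value G (\<lambda>x. x) (alt k (f g) (f h))"
  by (induction k arbitrary: g h) (simp_all add: pos_def word_value_Cons letter_def)

lemma (in presentation) cls_pos_list:
  "set gs \<subseteq> S \<Longrightarrow> cls (concat (map pos gs)) = list_value PG (\<lambda>g. cls (pos g)) gs"
proof (induction gs)
  case (Cons g gs)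
  moreover have "concat (map pos gs) \<in> words S"
    using Cons.prems by (induction gs) auto
  ultimately show ?case by (simp flip: mult_cls)
qed (simp add: one_PG)

text \<open>The values 3, 4 and 6 for r = 1, 2, 3 are the Coxeter numbers of A2, B2 and G2.\<close>

definition artin_length :: "nat \<Rightarrow> nat" where
  "artin_length r = (if r = 1 then 3 else 2 * r)"

definition artin_relations :: "nat \<Rightarrow> (ugen word \<times> ugen word) set" where
  "artin_relations r = {(alternating (artin_length r) U1 U2, alternating (artin_length r) U2 U1)}"

definition artin_pair :: "('a, 'b) monoid_scheme \<Rightarrow> nat \<Rightarrow> 'a \<Rightarrow> 'a \<Rightarrow> bool" where
  "artin_pair G r a b \<longleftrightarrow> list_value G (\<lambda>x. x) (alt (artin_length r) a b) =
     list_value G (\<lambda>x. x) (alt (artin_length r) b a)"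

lemma artin_relations_1: "artin_relations 1 = u_relations"
  by (simp add: artin_relations_def u_relations_def artin_length_def numeral_3_eq_3)

interpretation Braid: presentation UNIV u_relations
  by unfold_locales simp

lemma Gamma_tilde_1_eq: "Gamma_tilde_1 = Braid.PG"
  by (simp add: Gamma_tilde_1_def)

lemma u_closed [simp]: "u1 \<in> carrier Gamma_tilde_1" "u2 \<in> carrier Gamma_tilde_1"
  by (simp_all add: u1_def u2_def Gamma_tilde_1_eq)

lemma group_Gamma_tilde_1: "group Gamma_tilde_1"
  unfolding Gamma_tilde_1_eq by (rule Braid.group_PG)

interpretation GT: group Gamma_tilde_1
  by (rule group_Gamma_tilde_1)

lemma u_braid: "u1 \<otimes>\<^bsub>Gamma_tilde_1\<^esub> u2 \<otimes>\<^bsub>Gamma_tilde_1\<^esub> u1 = u2 \<otimes>\<^bsub>Gamma_tilde_1\<^esub> u1 \<otimes>\<^bsub>Gamma_tilde_1\<^esub> u2"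
  using Braid.cls_relation[of "pos U1 @ pos U2 @ pos U1" "pos U2 @ pos U1 @ pos U2"]
  by (simp add: u1_def u2_def Gamma_tilde_1_eq Braid.mult_cls) (simp add: u_relations_def)

text \<open>Both sides are brought to the form \<open>\<Delta>\<^sup>k w\<close> with \<open>\<Delta> = xyx\<close> and \<open>w\<close> not divisible by \<open>\<Delta>\<close>.\<close>

lemma (in group) artin_pair_power:
  assumes x [simp]: "x \<in> carrier G" and y [simp]: "y \<in> carrier G"
    and braid: "x \<otimes> y \<otimes> x = y \<otimes> x \<otimes> y" and r: "r = 1 \<or> r = 2 \<or> r = 3"
  shows "artin_pair G r x (y [^] r)"
proof -
  define E where "E b = x \<otimes> (y \<otimes> (x \<otimes> b))" for b
  have E_closed [simp]: "E b \<in> carrier G" if "b \<in> carrier G" for b using that by (simp add: E_def)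
  have fold1: "x \<otimes> (y \<otimes> (x \<otimes> b)) = E b" for b by (simp add: E_def)
  have fold2: "y \<otimes> (x \<otimes> (y \<otimes> b)) = E b" if "b \<in> carrier G" for b
    using braid that by (simp add: E_def flip: m_assoc)
  \<comment> \<open>E is left multiplication by \<Delta>; a letter that moves past \<Delta> is
    exchanged with the other one.\<close>
  have move1: "x \<otimes> E b = E (y \<otimes> b)" if "b \<in> carrier G" for b
    unfolding fold2[OF that, symmetric] by (simp only: fold1)
  have move2: "y \<otimes> E b = E (x \<otimes> b)" if "b \<in> carrier G" for b
    unfolding E_def[of b] using that by (intro fold2) simp
  note rules = fold1 fold2 move1 move2
  have "y \<otimes> (x \<otimes> y) = E \<one>" "x \<otimes> (y \<otimes> x) = E \<one>"
    using fold1[of \<one>] fold2[of \<one>] by simp_all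
  then show ?thesis
    using r by (elim disjE) (simp_all add: artin_pair_def artin_length_def numeral_eq_Suc m_assoc rules)
qed

context group
begin

lemma artin_pair_1:
  "a \<in> carrier G \<Longrightarrow> b \<in> carrier G \<Longrightarrow> artin_pair G 1 a b \<longleftrightarrow> a \<otimes> b \<otimes> a = b \<otimes> a \<otimes> b"
  by (simp add: artin_pair_def artin_length_def numeral_3_eq_3 m_assoc)

lemma artin_pair_2_3:
  "r = 2 \<or> r = 3 \<Longrightarrow> a \<in> carrier G \<Longrightarrow> b \<in> carrier G \<Longrightarrow>
    artin_pair G r a b \<longleftrightarrow> (a \<otimes> b) [^] r = (b \<otimes> a) [^] r"
  by (elim disjE) (simp_all add: artin_pair_def artin_length_def numeral_eq_Suc m_assoc)

text \<open>Inverting both sides reverses the words. The arguments appear in the order in which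
  \<eta> takes its values.\<close>

lemma artin_pair_inv:
  assumes "r = 1 \<or> r = 2 \<or> r = 3" and [simp]: "a \<in> carrier G" "b \<in> carrier G"
    and pair: "artin_pair G r a b"
  shows "artin_pair G r (inv b) (inv a)"
proof -
  show ?thesis
  proof (cases "r = 1")
    case True
    then have "a \<otimes> b \<otimes> a = b \<otimes> a \<otimes> b"
      using pair artin_pair_1[of a b] assms(2,3) by (simp only: simp_thms)
    then have "inv (a \<otimes> b \<otimes> a) = inv (b \<otimes> a \<otimes> b)" by (rule arg_cong)
    then have "inv a \<otimes> inv b \<otimes> inv a = inv b \<otimes> inv a \<otimes> inv b"
      by (simp add: inv_mult_group m_assoc)
    then show ?thesis unfolding True by (subst artin_pair_1) simp_all
  next
    case False
    then have r: "r = 2 \<or> r = 3" using assms(1) by simp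
    then have "(a \<otimes> b) [^] r = (b \<otimes> a) [^] r"
      using pair artin_pair_2_3[OF r, of a b] assms(2,3) by (simp only: simp_thms)
    then have "inv ((a \<otimes> b) [^] r) = inv ((b \<otimes> a) [^] r)" by (rule arg_cong)
    then have "(inv b \<otimes> inv a) [^] r = (inv a \<otimes> inv b) [^] r"
      by (simp add: inv_mult_group flip: nat_pow_inv)
    then show ?thesis using artin_pair_2_3[OF r, of "inv b" "inv a"] by simp
  qed
qed

end

text \<open>Maps out of \<open>Art\<close> can be prescribed on x and v; through
  \<open>cover\<close> its elements stand for those of \<open>Gamma_tilde r\<close>.\<close>

locale artin =
  fixes r :: nat
  assumes r: "r = 1 \<or> r = 2 \<or> r = 3"
begin

sublocale A: presentation UNIV "artin_relations r"
  by unfold_locales simp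

abbreviation "Art \<equiv> A.PG"

definition "x = A.cls (pos U1)"
definition "v = A.cls (pos U2)"

lemma xv_closed [simp]: "x \<in> carrier Art" "v \<in> carrier Art"
  by (simp_all add: x_def v_def)

lemma xv_pair: "artin_pair Art r x v"
proof -
  have "A.cls (alternating (artin_length r) U1 U2) = A.cls (alternating (artin_length r) U2 U1)"
    by (rule A.cls_relation) (simp add: artin_relations_def)
  then show ?thesis
    unfolding A.cls_conv_word_value[OF words_UNIV, of "alternating _ _ _"]
    by (simp add: A.PG.word_value_alternating artin_pair_def x_def v_def)
qed

lemma Art_induct [consumes 1, case_names one x v inv_x inv_v]:
  assumes "g \<in> carrier Art" "P \<one>\<^bsub>Art\<^esub>"
    and "\<And>g. g \<in> carrier Art \<Longrightarrow> P g \<Longrightarrow> P (x \<otimes>\<^bsub>Art\<^esub> g)"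
    and "\<And>g. g \<in> carrier Art \<Longrightarrow> P g \<Longrightarrow> P (v \<otimes>\<^bsub>Art\<^esub> g)"
    and "\<And>g. g \<in> carrier Art \<Longrightarrow> P g \<Longrightarrow> P (inv\<^bsub>Art\<^esub> x \<otimes>\<^bsub>Art\<^esub> g)"
    and "\<And>g. g \<in> carrier Art \<Longrightarrow> P g \<Longrightarrow> P (inv\<^bsub>Art\<^esub> v \<otimes>\<^bsub>Art\<^esub> g)"
  shows "P g"
  using assms(1)
proof (induction rule: A.PG_induct)
  case (pos u g)
  then show ?case by (cases u rule: ugen.exhaust; use assms in \<open>auto simp: x_def v_def\<close>)
next
  case (neg u g)
  then show ?case by (cases u rule: ugen.exhaust; use assms in \<open>auto simp: x_def v_def\<close>)
qed (rule assms(2))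

lemma generate_Art:
  assumes "g \<in> carrier Art"
  shows "g \<in> generate Art {x, v}"
  using assms by (induction rule: Art_induct) (auto intro: generate.intros)

definition lift :: "('a, 'b) monoid_scheme \<Rightarrow> 'a \<Rightarrow> 'a \<Rightarrow> ugen word set \<Rightarrow> 'a" where
  "lift H a b = A.pres_lift H (case_ugen a b)"

lemma lift:
  assumes "group H" "a \<in> carrier H" "b \<in> carrier H" "artin_pair H r a b"
  shows "lift H a b \<in> hom Art H" "lift H a b x = a" "lift H a b v = b"
proof -
  have f: "case_ugen a b \<in> UNIV \<rightarrow> carrier H"
    using assms by (auto split: ugen.split)
  have rels: "word_value H (case_ugen a b) u = word_value H (case_ugen a b) w"
    if "(u, w) \<in> artin_relations r" for u w
    using assms that by (auto simp: artin_relations_def artin_pair_def group.word_value_alternating)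
  show "lift H a b \<in> hom Art H"
    unfolding lift_def by (rule A.pres_lift_hom[OF assms(1) f rels])
  show "lift H a b x = a" "lift H a b v = b"
    unfolding lift_def x_def v_def using A.pres_lift_pos[OF assms(1) f rels] by auto
qed

lemma Art_hom_eqI:
  assumes "group H" "h \<in> hom Art H" "k \<in> hom Art H" "h x = k x" "h v = k v" "g \<in> carrier Art"
  shows "h g = k g"
proof (rule A.hom_eqI[OF assms(1-3,6)])
  show "h (A.cls (pos u)) = k (A.cls (pos u))" for u
    using assms(4,5) by (cases u) (simp_all add: x_def v_def)
qed

abbreviation "M\<^sub>x \<equiv> mat2 1 (-1) 0 1"
abbreviation "M\<^sub>v \<equiv> mat2 1 0 (int r) 1"

definition "mtx = lift SL2Z M\<^sub>x M\<^sub>v"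
text \<open>The weight of v is 1 although v covers the r-th power of \<open>u2\<close>: equal
  weights are what makes \<open>dual_map\<close> negate the degree.\<close>

definition "degree = lift integer_group 1 1"

lemma mtx_pair: "artin_pair SL2Z r M\<^sub>x M\<^sub>v"
  using r by (auto simp: artin_pair_def artin_length_def numeral_eq_Suc mat_1_conv_mat2)

lemma mtx_hom: "mtx \<in> hom Art SL2Z" and mtx_x: "mtx x = M\<^sub>x" and mtx_v: "mtx v = M\<^sub>v"
  using lift[OF group_SL2Z _ _ mtx_pair] unfolding mtx_def by (simp_all add: SL2Z_carrier)

lemma degree_hom: "degree \<in> hom Art integer_group" and degree_x: "degree x = 1" and degree_v: "degree v = 1"
proof -
  have "artin_pair integer_group r 1 1" by (simp add: artin_pair_def)
  then show "degree \<in> hom Art integer_group" "degree x = 1" "degree v = 1"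
    using lift[of integer_group 1 1] by (simp_all add: degree_def)
qed

theorem matrix_degree_kernel:
  assumes "g \<in> carrier Art" "mtx g = mat 1" "degree g = 0"
  shows "g = \<one>\<^bsub>Art\<^esub>"
proof (cases "r = 1")
  case True
  then have "x \<otimes>\<^bsub>Art\<^esub> v \<otimes>\<^bsub>Art\<^esub> x = v \<otimes>\<^bsub>Art\<^esub> x \<otimes>\<^bsub>Art\<^esub> v"
    using xv_pair A.PG.artin_pair_1[OF xv_closed] by (simp only:)
  moreover have "mtx v = mat2 1 0 1 1" unfolding mtx_v by (simp add: True)
  ultimately show ?thesis
    using A.PG.matrix_kernel_braid[of x v mtx degree g] assms generate_Art
    by (simp add: mtx_hom mtx_x degree_hom degree_x degree_v)
next
  case False
  then have r': "r = 2 \<or> r = 3" using r by simp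
  then have "(x \<otimes>\<^bsub>Art\<^esub> v) [^]\<^bsub>Art\<^esub> r = (v \<otimes>\<^bsub>Art\<^esub> x) [^]\<^bsub>Art\<^esub> r"
    using xv_pair A.PG.artin_pair_2_3[OF _ xv_closed] by simp
  then show ?thesis
    using A.PG.matrix_kernel_even[of r x v mtx degree g] r' assms generate_Art
    by (simp add: mtx_hom mtx_x mtx_v degree_hom degree_x degree_v)
qed

text \<open>This is \<eta>: conjugation by e turns the action of x into that of v^-1 and the action
  of v into that of x^-1.\<close>

definition "dual_map = lift Art (inv\<^bsub>Art\<^esub> v) (inv\<^bsub>Art\<^esub> x)"

lemma dual_pair: "artin_pair Art r (inv\<^bsub>Art\<^esub> v) (inv\<^bsub>Art\<^esub> x)"
  using A.PG.artin_pair_inv r xv_pair by simp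

lemma dual_map_hom: "dual_map \<in> hom Art Art" and dual_map_x: "dual_map x = inv\<^bsub>Art\<^esub> v"
  and dual_map_v: "dual_map v = inv\<^bsub>Art\<^esub> x"
  unfolding dual_map_def using lift[OF A.group_PG _ _ dual_pair] by simp_all

interpretation dual_map: group_hom Art Art dual_map
  using dual_map_hom A.group_PG by (simp add: group_hom_def group_hom_axioms_def)

interpretation mtx: group_hom Art SL2Z mtx
  using mtx_hom A.group_PG group_SL2Z by (simp add: group_hom_def group_hom_axioms_def)

interpretation degree: group_hom Art integer_group degree
  using degree_hom A.group_PG by (simp add: group_hom_def group_hom_axioms_def)

lemma degree_dual_map: "g \<in> carrier Art \<Longrightarrow> degree (dual_map g) = - degree g"
proof (induction rule: Art_induct)
qed (simp_all add: dual_map_x dual_map_v degree_x degree_v)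

abbreviation "J \<equiv> mat2 0 1 (int r) 0"

text \<open>J intertwines \<open>M\<^sub>x\<close> with the inverse of \<open>M\<^sub>v\<close> and
  vice versa. Since J has determinant -r, the identity is kept free of its inverse.\<close>

lemma mtx_dual_map: "g \<in> carrier Art \<Longrightarrow> J ** mtx g = mtx (dual_map g) ** J"
proof (induction rule: Art_induct)
  case one
  then show ?case by simp
next
  case (x g)
  have "J ** M\<^sub>x = mat2 1 0 (- int r) 1 ** J" by simp
  then have "J ** (M\<^sub>x ** mtx g) = mat2 1 0 (- int r) 1 ** (J ** mtx g)"
    by (simp only: matrix_mul_assoc)
  then show ?case
    using x by (simp add: mtx_x mtx_v dual_map_x inv_SL2Z_mat2 matrix_mul_assoc del: mat2_mult)
next
  case (v g)
  have "J ** M\<^sub>v = mat2 1 1 0 1 ** J" by simp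
  then have "J ** (M\<^sub>v ** mtx g) = mat2 1 1 0 1 ** (J ** mtx g)"
    by (simp only: matrix_mul_assoc)
  then show ?case
    using v by (simp add: mtx_x mtx_v dual_map_v inv_SL2Z_mat2 matrix_mul_assoc del: mat2_mult)
next
  case (inv_x g)
  have "J ** mat2 1 1 0 1 = M\<^sub>v ** J" by simp
  then have "J ** (mat2 1 1 0 1 ** mtx g) = M\<^sub>v ** (J ** mtx g)"
    by (simp only: matrix_mul_assoc)
  then show ?case
    using inv_x by (simp add: mtx_x mtx_v dual_map_x inv_SL2Z_mat2 matrix_mul_assoc del: mat2_mult)
next
  case (inv_v g)
  have "J ** mat2 1 0 (- int r) 1 = M\<^sub>x ** J" by simp
  then have "J ** (mat2 1 0 (- int r) 1 ** mtx g) = M\<^sub>x ** (J ** mtx g)"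
    by (simp only: matrix_mul_assoc)
  then show ?case
    using inv_v by (simp add: mtx_x mtx_v dual_map_v inv_SL2Z_mat2 matrix_mul_assoc del: mat2_mult)
qed

text \<open>Comparing entries in J M = N J expresses N, the matrix of \<open>dual_map g\<close>,
  through M = \<open>mtx g\<close>; N = M^-1 then leaves the single equation c = -r b.\<close>

lemma dual_map_eq_inverse_iff:
  assumes g: "g \<in> carrier Art"
  shows "mtx (dual_map g \<otimes>\<^bsub>Art\<^esub> g) = mat 1 \<longleftrightarrow> mtx g $ 2 $ 1 = - int r * mtx g $ 1 $ 2"
proof -
  obtain a b c d where M: "mtx g = mat2 a b c d" using mat2_eta by blast
  obtain a' b' c' d' where N: "mtx (dual_map g) = mat2 a' b' c' d'" using mat2_eta by blast
  have det: "a * d - b * c = 1" using mtx.hom_closed[OF g] by (simp add: SL2Z_carrier M)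
  have "mat2 c d (int r * a) (int r * b) = mat2 (b' * int r) a' (d' * int r) c'"
    using mtx_dual_map[OF g] by (simp add: M N)
  then have *: "c = b' * int r" "d = a'" "int r * a = d' * int r" "int r * b = c'"
    by (auto simp: mat2_eq_iff)
  have "mtx (dual_map g \<otimes>\<^bsub>Art\<^esub> g) = mat2 a' b' c' d' ** mat2 a b c d"
    using g by (simp add: M N del: mat2_mult)
  also have "\<dots> = mat 1 \<longleftrightarrow> mat2 a' b' c' d' = inv\<^bsub>SL2Z\<^esub> (mat2 a b c d)"
  proof
    have carrier: "mat2 a' b' c' d' \<in> carrier SL2Z" "mat2 a b c d \<in> carrier SL2Z"
      using mtx.hom_closed[OF g] mtx.hom_closed[OF dual_map.hom_closed[OF g]] by (simp_all add: M N)
    show "mat2 a' b' c' d' = inv\<^bsub>SL2Z\<^esub> (mat2 a b c d)" if "mat2 a' b' c' d' ** mat2 a b c d = mat 1"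
      using that carrier SL2Z.inv_equality by (simp del: mat2_mult)
    show "mat2 a' b' c' d' ** mat2 a b c d = mat 1" if "mat2 a' b' c' d' = inv\<^bsub>SL2Z\<^esub> (mat2 a b c d)"
      using that SL2Z.l_inv[OF carrier(2)] by (simp del: mat2_mult)
  qed
  also have "\<dots> \<longleftrightarrow> mat2 a' b' c' d' = mat2 d (- b) (- c) a"
    using inv_SL2Z_mat2[OF det] by simp
  also have "\<dots> \<longleftrightarrow> c = - int r * b"
    using * r by (auto simp: mat2_eq_iff)
  finally show ?thesis by (simp add: M)
qed

lemma Gamma1_mtx: "g \<in> carrier Art \<Longrightarrow> mtx g \<in> Gamma1 r"
proof -
  have mult: "M ** N \<in> Gamma1 r" if "M \<in> Gamma1 r" "N \<in> Gamma1 r" for M N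
  proof -
    obtain a b c d where M: "M = mat2 a b c d" using mat2_eta by blast
    obtain a' b' c' d' where N: "N = mat2 a' b' c' d'" using mat2_eta by blast
    have "[a * a' + b * c' = 1 * 1 + b * 0] (mod int r)" "[c * a' + d * c' = 0 * a' + d * 0] (mod int r)"
      "[c * b' + d * d' = 0 * b' + 1 * 1] (mod int r)"
      using that unfolding M N Gamma1_def by (intro cong_add cong_mult; simp add: cong_def)+
    moreover have "M ** N \<in> carrier SL2Z"
      using that SL2Z.m_closed unfolding Gamma1_def by auto
    ultimately show ?thesis by (simp add: Gamma1_def M N)
  qed
  have gens: "mat2 1 b c 1 \<in> Gamma1 r" if "b = 0 \<or> c = 0" "int r dvd c" for b c
    using that by (auto simp: Gamma1_def SL2Z_carrier cong_0_iff)
  show "mtx g \<in> Gamma1 r" if "g \<in> carrier Art"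
    using that
  proof (induction rule: Art_induct)
    case one
    show ?case using gens[of 0 0] by (simp add: mat_1_conv_mat2)
  qed (auto simp: mtx_x mtx_v inv_SL2Z_mat2 simp del: mat2_mult intro!: mult gens)
qed

definition "cover = lift Gamma_tilde_1 u1 (u2 [^]\<^bsub>Gamma_tilde_1\<^esub> r)"

lemma cover_hom: "cover \<in> hom Art Gamma_tilde_1" and cover_x: "cover x = u1"
  and cover_v: "cover v = u2 [^]\<^bsub>Gamma_tilde_1\<^esub> r"
  unfolding cover_def
  using lift[OF group_Gamma_tilde_1 _ _ GT.artin_pair_power[OF _ _ u_braid r]] by simp_all

sublocale cover: group_hom Art Gamma_tilde_1 cover
  using cover_hom A.group_PG group_Gamma_tilde_1 by (simp add: group_hom_def group_hom_axioms_def)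

lemma cover_image: "cover ` carrier Art = carrier (Gamma_tilde r)"
proof -
  have carrier: "carrier (Gamma_tilde r) = generate Gamma_tilde_1 {u1, u2 [^]\<^bsub>Gamma_tilde_1\<^esub> r}"
    by (simp add: Gamma_tilde_def carrier_subgroup_generated Int_absorb1)
  have "cover g \<in> carrier (Gamma_tilde r)" if "g \<in> carrier Art" for g
    using that unfolding carrier
    by (induction rule: Art_induct) (auto simp: cover_x cover_v intro: generate.intros)
  moreover have "\<gamma> \<in> cover ` carrier Art" if "\<gamma> \<in> generate Gamma_tilde_1 {u1, u2 [^]\<^bsub>Gamma_tilde_1\<^esub> r}" for \<gamma>
    using that
  proof (induction rule: generate.induct)
    case one
    show ?case by (rule image_eqI[of _ _ "\<one>\<^bsub>Art\<^esub>"]) simp_all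
  next
    case (incl h)
    then show ?case using cover_x cover_v by (auto intro: image_eqI[of _ _ x] image_eqI[of _ _ v])
  next
    case (inv h)
    then show ?case
      using cover_x cover_v by (auto intro: image_eqI[of _ _ "inv\<^bsub>Art\<^esub> x"] image_eqI[of _ _ "inv\<^bsub>Art\<^esub> v"])
  next
    case (eng h1 h2)
    then obtain g1 g2 where "g1 \<in> carrier Art" "h1 = cover g1" "g2 \<in> carrier Art" "h2 = cover g2" by auto
    then show ?case by (intro image_eqI[of _ _ "g1 \<otimes>\<^bsub>Art\<^esub> g2"]) simp_all
  qed
  ultimately show ?thesis using carrier by auto
qed

lemma cover_closed: "g \<in> carrier Art \<Longrightarrow> cover g \<in> carrier (Gamma_tilde r)"
  using cover_image by auto

lemma cover_hom_Gamma_tilde: "cover \<in> hom Art (Gamma_tilde r)"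
  using cover_closed by (intro homI) (simp_all add: Gamma_tilde_def)

lemma inv_cover:
  assumes "g \<in> carrier Art"
  shows "inv\<^bsub>Gamma_tilde r\<^esub> (cover g) = cover (inv\<^bsub>Art\<^esub> g)"
  using GT.inv_subgroup_generated cover_closed[OF assms] assms by (simp add: Gamma_tilde_def)

end

interpretation artin_1: artin 1
  by unfold_locales simp

text \<open>For r = 1 the group \<open>Art\<close> is \<open>Gamma_tilde_1\<close> itself:
  \<open>mtx\<close> gives existence, agreement on the generators gives uniqueness.\<close>

lemma proj: "proj \<in> hom Gamma_tilde_1 SL2Z" "proj u1 = mat2 1 (-1) 0 1" "proj u2 = mat2 1 0 1 1"
proof -
  let ?P = "\<lambda>\<pi>. \<pi> \<in> hom Gamma_tilde_1 SL2Z \<and> \<pi> \<in> extensional (carrier Gamma_tilde_1) \<and>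
    \<pi> u1 = mat2 1 (-1) 0 1 \<and> \<pi> u2 = mat2 1 0 1 1"
  have eq: "artin_1.Art = Gamma_tilde_1" "artin_1.x = u1" "artin_1.v = u2"
    by (simp_all add: Gamma_tilde_1_eq artin_1.x_def artin_1.v_def u1_def u2_def artin_relations_1 del: One_nat_def)
  have "?P (restrict artin_1.mtx (carrier Gamma_tilde_1))"
    using artin_1.mtx_hom artin_1.mtx_x artin_1.mtx_v unfolding eq by (simp add: hom_def Pi_iff)
  moreover have "\<pi> = \<pi>'" if "?P \<pi>" "?P \<pi>'" for \<pi> \<pi>'
  proof (rule extensionalityI[of _ "carrier Gamma_tilde_1"])
    show "\<pi> g = \<pi>' g" if "g \<in> carrier Gamma_tilde_1" for g
      using artin_1.Art_hom_eqI[OF group_SL2Z, of \<pi> \<pi>' g, unfolded eq] that \<open>?P \<pi>\<close> \<open>?P \<pi>'\<close> by simp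
  qed (use that in auto)
  ultimately have "\<exists>!\<pi>. ?P \<pi>" by blast
  then have "?P proj" unfolding proj_def by (rule theI')
  then show "proj \<in> hom Gamma_tilde_1 SL2Z" "proj u1 = mat2 1 (-1) 0 1" "proj u2 = mat2 1 0 1 1" by auto
qed

lemma (in artin) proj_cover:
  assumes "g \<in> carrier Art"
  shows "proj (cover g) = mtx g"
proof -
  interpret p: group_hom Gamma_tilde_1 SL2Z proj
    using proj(1) group_SL2Z group_Gamma_tilde_1 by (simp add: group_hom_def group_hom_axioms_def)
  have "proj (u2 [^]\<^bsub>Gamma_tilde_1\<^esub> r) = M\<^sub>v"
    using r by (auto simp: numeral_2_eq_2 numeral_3_eq_3 proj(3) mat_1_conv_mat2)
  then have "(proj \<circ> cover) x = mtx x" "(proj \<circ> cover) v = mtx v"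
    by (simp_all add: cover_x cover_v proj mtx_x mtx_v)
  moreover have "proj \<circ> cover \<in> hom Art SL2Z"
    using hom_compose[OF cover_hom proj(1)] by simp
  ultimately show ?thesis
    using Art_hom_eqI[OF group_SL2Z _ mtx_hom, of "proj \<circ> cover" g] assms by simp
qed

section \<open>Duality of root systems\<close>

text \<open>The map \<open>F\<close> is a similarity on the span of the roots that exchanges long and short roots up
  to scaling, so it conjugates the reflection in the highest root into the reflection in the
  dominant short root of the dual system.\<close>

locale root_duality = P: root_datum X s q \<rho> + Q: root_datum X' s' q' \<rho>'
  for X s q \<rho> X' s' q' \<rho>' +
  fixes F :: "vec \<Rightarrow> vec" and e :: "nat \<Rightarrow> nat" and c :: "nat \<Rightarrow> real"
  assumes F_linear: "linear_vec F" and F_bij: "bij F"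
    and e: "bij_betw e {1..rank X} {1..rank X'}"
    and F_simple: "i \<in> {1..rank X} \<Longrightarrow> c i > 0 \<and> F (simple_root X i) = (\<lambda>j. c i * simple_root X' (e i) j)"
    and F_pairing: "i \<in> {1..rank X} \<Longrightarrow> pairing X' (F x) (F (simple_root X i)) = pairing X x (simple_root X i)"
    and long_short: "i \<in> {1..rank X} \<Longrightarrow> ip X (simple_root X i) (simple_root X i) = q * s \<Longrightarrow>
      ip X' (simple_root X' (e i)) (simple_root X' (e i)) = s'"
    and short_long: "i \<in> {1..rank X} \<Longrightarrow> ip X (simple_root X i) (simple_root X i) = s \<Longrightarrow>
      ip X' (simple_root X' (e i)) (simple_root X' (e i)) = q' * s'"
begin

lemma e_closed: "i \<in> P.I \<Longrightarrow> e i \<in> Q.I"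
  using e by (auto simp: bij_betw_def)

lemma F_reflection:
  assumes "i \<in> P.I"
  shows "F (reflection X (simple_root X i) x) = reflection X' (simple_root X' (e i)) (F x)"
  using reflection_conj[OF F_linear, of X' "simple_root X i" X x] F_pairing[OF assms] F_simple[OF assms]
    reflection_scale[of "c i" X' "simple_root X' (e i)"] by simp

lemma F_weyl: "set is \<subseteq> P.I \<Longrightarrow> F (weyl_prod X is x) = weyl_prod X' (map e is) (F x)"
  by (induction "is") (simp_all add: weyl_prod_Cons F_reflection)

lemma map_e_closed: "set is \<subseteq> P.I \<Longrightarrow> set (map e is) \<subseteq> Q.I"
  using e_closed by auto

lemma map_e_surj:
  assumes "set js \<subseteq> Q.I"
  shows "\<exists>is. set is \<subseteq> P.I \<and> js = map e is"
proof -
  have js: "j \<in> e ` P.I" if "j \<in> set js" for j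
    using assms that e by (auto simp: bij_betw_def)
  have "map e (map (inv_into P.I e) js) = js"
    using js by (simp add: map_idI f_inv_into_f)
  moreover have "set (map (inv_into P.I e) js) \<subseteq> P.I"
    using js by (auto intro: inv_into_into)
  ultimately show ?thesis by metis
qed

text \<open>A competing word on the dual side is the image of a word on the original side, and
  injectivity of F carries the equality of products back.\<close>

lemma reduced_map_e:
  assumes "P.reduced is"
  shows "Q.reduced (map e is)"
proof -
  note I = P.reduced_set[OF assms]
  have "length is \<le> length js" if js: "set js \<subseteq> Q.I" "weyl_prod X' js = weyl_prod X' (map e is)" for js
  proof -
    obtain ks where ks: "set ks \<subseteq> P.I" "js = map e ks" using map_e_surj js by blast
    have "F (weyl_prod X ks x) = F (weyl_prod X is x)" for x
      using js ks I by (simp add: F_weyl)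
    then have "weyl_prod X ks = weyl_prod X is"
      using F_bij by (auto simp: bij_def inj_def)
    then show ?thesis using P.reduced_length_le[OF assms ks(1)] ks(2) by simp
  qed
  then show ?thesis
    using map_e_closed[OF I] by (auto simp: Q.reduced_def reduced_expression_def)
qed

text \<open>The scaling factor and the lengths of a root and its dual are read off from a simple
  root in its Weyl orbit.\<close>

lemma F_root:
  assumes \<beta>: "\<beta> \<in> roots X"
  shows "\<exists>i\<in>P.I. \<exists>\<gamma>\<in>roots X'. F \<beta> = (\<lambda>j. c i * \<gamma> j) \<and> ip X \<beta> \<beta> = ip X (simple_root X i) (simple_root X i) \<and>
    ip X' \<gamma> \<gamma> = ip X' (simple_root X' (e i)) (simple_root X' (e i)) \<and>
    (\<forall>x. pairing X' (F x) (F \<beta>) = pairing X x \<beta>)"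
proof -
  obtain js i where *: "set js \<subseteq> P.I" "i \<in> P.I" "\<beta> = weyl_prod X js (simple_root X i)"
    using \<beta> by (rule P.rootE)
  let ?\<gamma> = "weyl_prod X' (map e js) (simple_root X' (e i))"
  have js': "set (map e js) \<subseteq> Q.I" using map_e_closed * by blast
  have "F \<beta> = (\<lambda>j. c i * ?\<gamma> j)"
    using * F_simple[of i] by (simp add: F_weyl linear_vec_scale[OF linear_vec_weyl_prod])
  moreover have "pairing X' (F x) (F \<beta>) = pairing X x \<beta>" for x
  proof -
    define y where "y = weyl_prod X (rev js) x"
    have x: "x = weyl_prod X js y" using * by (simp add: y_def)
    have "pairing X' (F x) (F \<beta>) = pairing X' (F y) (F (simple_root X i))"
      using js' * by (simp add: x F_weyl pairing_def Q.short.ip_weyl)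
    also have "\<dots> = pairing X x \<beta>"
      using * by (simp add: x F_pairing) (simp add: pairing_def P.short.ip_weyl)
    finally show ?thesis .
  qed
  ultimately show ?thesis
    using * js' Q.rootI[OF js' e_closed] by (intro bexI[of _ i] bexI[of _ ?\<gamma>]) (auto simp: P.short.ip_weyl Q.short.ip_weyl)
qed

text \<open>Signs of pairings with simple roots survive, because F preserves these pairings and
  rescales roots by positive factors.\<close>

lemma F_dominant_root:
  assumes \<beta>: "\<beta> \<in> roots X" "P.short.dominant \<beta>"
  shows "\<exists>\<gamma>\<in>roots X'. Q.short.dominant \<gamma> \<and>
    (ip X \<beta> \<beta> = s \<longrightarrow> ip X' \<gamma> \<gamma> = q' * s') \<and> (ip X \<beta> \<beta> = q * s \<longrightarrow> ip X' \<gamma> \<gamma> = s') \<and>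
    (\<forall>x. F (reflection X \<beta> x) = reflection X' \<gamma> (F x))"
proof -
  obtain i \<gamma> where i: "i \<in> P.I" and \<gamma>: "\<gamma> \<in> roots X'" "F \<beta> = (\<lambda>j. c i * \<gamma> j)"
      "ip X \<beta> \<beta> = ip X (simple_root X i) (simple_root X i)"
      "ip X' \<gamma> \<gamma> = ip X' (simple_root X' (e i)) (simple_root X' (e i))"
    and pairing: "\<And>x. pairing X' (F x) (F \<beta>) = pairing X x \<beta>"
    using F_root[OF \<beta>(1)] by blast
  have ci: "c i > 0" using F_simple i by simp
  have "pairing X' \<gamma> (simple_root X' k) \<ge> 0" if k: "k \<in> Q.I" for k
  proof -
    have "k \<in> e ` P.I" using k e by (simp add: bij_betw_def)
    then obtain l where l: "l \<in> P.I" "k = e l" by blast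
    have "0 \<le> pairing X \<beta> (simple_root X l)" using \<beta>(2) l P.dominant_iff_pairing by simp
    also have "\<dots> = pairing X' (F \<beta>) (F (simple_root X l))" using F_pairing[OF l(1)] by simp
    also have "\<dots> = c i / c l * pairing X' \<gamma> (simple_root X' k)"
      using F_simple[OF l(1)] l(2) by (simp add: \<gamma>(2) pairing_scale pairing_scale_root)
    finally show ?thesis using ci F_simple[OF l(1)] by (simp add: zero_le_mult_iff zero_le_divide_iff)
  qed
  then have "Q.short.dominant \<gamma>" by (simp add: Q.dominant_iff_pairing)
  moreover have "F (reflection X \<beta> x) = reflection X' \<gamma> (F x)" for x
    using reflection_conj[OF F_linear, of X' \<beta> X x] pairing reflection_scale[of "c i" X' \<gamma>] ci by (simp add: \<gamma>(2))
  ultimately show ?thesis using \<gamma> long_short[OF i] short_long[OF i] by (intro bexI[of _ \<gamma>]) auto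
qed

lemma F_reflection_highest:
  "F (reflection X (highest_root X) x) = reflection X' (dominant_short_root X') (F x)"
  using F_dominant_root[OF P.highest_root(1,2)] P.highest_root(3) Q.dominant_short_root_eq by auto

lemma F_reflection_short:
  "F (reflection X (dominant_short_root X) x) = reflection X' (highest_root X') (F x)"
  using F_dominant_root[OF P.dominant_short_root(1,2)] P.dominant_short_root(3) Q.highest_root_eq by auto

text \<open>The word is reversed because the anti-isomorphism reverses products. A reflection is an
  involution, so the reversal of a reduced word for it is again one.\<close>

lemma reduced_dual:
  assumes "P.reduced is" "weyl_prod X is = reflection X \<beta>" "ip X \<beta> \<beta> \<noteq> 0"
    and F: "\<And>x. F (reflection X \<beta> x) = reflection X' \<gamma> (F x)"
  shows "Q.reduced (map e (rev is)) \<and> weyl_prod X' (map e (rev is)) = reflection X' \<gamma>"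
proof -
  note I = P.reduced_set[OF assms(1)]
  have "weyl_prod X (rev is) x = weyl_prod X is x" for x
    using P.weyl_prod_rev[OF I, of "weyl_prod X is x"] assms(2,3) by simp
  then have rev: "weyl_prod X (rev is) = weyl_prod X is" by blast
  then have "P.reduced (rev is)" using P.reduced_cong[OF assms(1)] I by simp
  moreover have "weyl_prod X' (map e (rev is)) y = reflection X' \<gamma> y" for y
  proof -
    obtain x where "y = F x" using F_bij by (metis bij_pointE)
    then show ?thesis using F_weyl[of "rev is" x] I rev assms(2) F by simp
  qed
  ultimately show ?thesis using reduced_map_e by auto
qed

end

text \<open>On the first four coordinates a similarity of ratio sqrt 2 that exchanges long and short
  roots of F4 up to scaling. Its first block serves B2 = C2.\<close>

definition block_map :: "vec \<Rightarrow> vec" where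
  "block_map v = (\<lambda>j. if j = 1 then v 1 + v 2 else if j = 2 then v 1 - v 2 else
    if j = 3 then v 3 + v 4 else if j = 4 then v 3 - v 4 else v j)"

definition block_map2 :: "vec \<Rightarrow> vec" where
  "block_map2 v = (\<lambda>j. if j = 1 then v 1 + v 2 else if j = 2 then v 1 - v 2 else v j)"

text \<open>On the plane of coordinate sum zero, which contains the roots of G2, a similarity of
  ratio sqrt 3; the orthogonal line is preserved, so pairings with roots agree for all
  vectors.\<close>

definition circulant_map :: "vec \<Rightarrow> vec" where
  "circulant_map v = (\<lambda>j. if j = 1 then 2 * v 2 + v 3 else if j = 2 then 2 * v 1 + v 2 else
    if j = 3 then v 1 + 2 * v 3 else v j)"

lemma linear_maps: "linear_vec block_map" "linear_vec block_map2" "linear_vec circulant_map" "linear_vec id"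
  by (auto simp: linear_vec_def block_map_def block_map2_def circulant_map_def fun_eq_iff algebra_simps)

lemma bij_block_map: "bij block_map"
  by (rule o_bij[of "\<lambda>v j. if j = 1 then (v 1 + v 2) / 2 else if j = 2 then (v 1 - v 2) / 2 else
      if j = 3 then (v 3 + v 4) / 2 else if j = 4 then (v 3 - v 4) / 2 else v j"])
     (auto simp: block_map_def fun_eq_iff field_simps)

lemma bij_block_map2: "bij block_map2"
  by (rule o_bij[of "\<lambda>v j. if j = 1 then (v 1 + v 2) / 2 else if j = 2 then (v 1 - v 2) / 2 else v j"])
     (auto simp: block_map2_def fun_eq_iff field_simps)

lemma bij_circulant_map: "bij circulant_map"
  by (rule o_bij[of "\<lambda>v j. if j = 1 then (4 * v 2 + v 3 - 2 * v 1) / 9 else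
      if j = 2 then (4 * v 1 + v 2 - 2 * v 3) / 9 else if j = 3 then (4 * v 3 - 2 * v 2 + v 1) / 9 else v j"])
     (auto simp: circulant_map_def fun_eq_iff field_simps)

lemma ip_2: "ambient_dim X = 2 \<Longrightarrow> ip X x y = x 1 * y 1 + x 2 * y 2"
  by (simp add: ip_def numeral_2_eq_2)

lemma ip_F4: "ip TypeF4 x y = x 1 * y 1 + x 2 * y 2 + x 3 * y 3 + x 4 * y 4"
proof -
  have "{1..4} = {1, 2, 3, 4 :: nat}" by auto
  then show ?thesis by (simp only: ip_def ambient_dim.simps) simp
qed

lemma ip_G2: "ip TypeG2 x y = x 1 * y 1 + x 2 * y 2 + x 3 * y 3"
proof -
  have "{1..3} = {1, 2, 3 :: nat}" by auto
  then show ?thesis by (simp only: ip_def ambient_dim.simps) simp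
qed

lemma bij_betw_diff: "bij_betw (\<lambda>i. Suc n - i) {1..n} {1..n}"
  by (rule bij_betw_byWitness[where f' = "\<lambda>i. Suc n - i"]) auto

text \<open>The long root e_1 - e_2 goes to 2 e_2 and the short root e_2 to e_1 - e_2.\<close>

lemma root_duality_B2:
  "root_duality (TypeB 2) 1 2 (\<lambda>j. real (2 + 1) - real j) (TypeB 2) 1 2 (\<lambda>j. real (2 + 1) - real j)
    block_map2 (\<lambda>i. 3 - i) (\<lambda>i. if i = 1 then 2 else 1)"
proof (intro root_duality.intro root_datum_B root_duality_axioms.intro linear_maps bij_block_map2, goal_cases)
  case 3
  then show ?case using bij_betw_diff[of 2] by (simp add: numeral_3_eq_3 numeral_2_eq_2)
next
  case (4 i)
  then have "i = 1 \<or> i = 2" by auto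
  then show ?case by (elim disjE) (simp_all add: block_map2_def unit_vec_def fun_eq_iff)
next
  case (5 i x)
  then have "i = 1 \<or> i = 2" by auto
  then show ?case by (elim disjE) (simp_all add: block_map2_def pairing_def ip_2 unit_vec_def field_simps)
next
  case (6 i)
  then have "i = 1 \<or> i = 2" by auto
  then show ?case using 6 by (elim disjE) (simp_all add: ip_2 unit_vec_def)
next
  case (7 i)
  then have "i = 1 \<or> i = 2" by auto
  then show ?case using 7 by (elim disjE) (simp_all add: ip_2 unit_vec_def)
qed simp_all

lemma root_duality_C2:
  "root_duality (TypeC 2) 2 2 (\<lambda>j. real (2 + 1) - real j) (TypeC 2) 2 2 (\<lambda>j. real (2 + 1) - real j)
    block_map2 (\<lambda>i. 3 - i) (\<lambda>i. if i = 1 then 1 else 2)"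
proof (intro root_duality.intro root_datum_C root_duality_axioms.intro linear_maps bij_block_map2, goal_cases)
  case 3
  then show ?case using bij_betw_diff[of 2] by (simp add: numeral_3_eq_3 numeral_2_eq_2)
next
  case (4 i)
  then have "i = 1 \<or> i = 2" by auto
  then show ?case by (elim disjE) (simp_all add: block_map2_def unit_vec_def fun_eq_iff)
next
  case (5 i x)
  then have "i = 1 \<or> i = 2" by auto
  then show ?case by (elim disjE) (simp_all add: block_map2_def pairing_def ip_2 unit_vec_def field_simps)
next
  case (6 i)
  then have "i = 1 \<or> i = 2" by auto
  then show ?case using 6 by (elim disjE) (simp_all add: ip_2 unit_vec_def)
next
  case (7 i)
  then have "i = 1 \<or> i = 2" by auto
  then show ?case using 7 by (elim disjE) (simp_all add: ip_2 unit_vec_def)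
qed simp_all

lemma ip_B_C: "ip (TypeB n) = ip (TypeC n)"
  by (simp add: ip_def fun_eq_iff)

text \<open>B_n and C_n differ only in the scaling of the last simple root, so the identity map is
  the duality.\<close>

lemma root_duality_BC:
  assumes "n \<ge> 3"
  shows "root_duality (TypeB n) 1 2 (\<lambda>j. real (n + 1) - real j) (TypeC n) 2 2 (\<lambda>j. real (n + 1) - real j)
    id (\<lambda>i. i) (\<lambda>i. if i = n then 1 / 2 else 1)"
proof (intro root_duality.intro root_datum_B root_datum_C root_duality_axioms.intro linear_maps bij_id, goal_cases)
  case (5 i x)
  then show ?case by (simp add: pairing_def ip_B_C)
next
  case (6 i)
  then show ?case by (auto simp: ip_linear ip_unit_left split: if_splits) (auto simp: unit_vec_apply)
next
  case (7 i)
  then show ?case by (auto simp: ip_linear ip_unit_left split: if_splits) (auto simp: unit_vec_apply split: if_splits)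
qed (use assms in \<open>auto simp: bij_betw_def\<close>)

lemma root_duality_CB:
  assumes "n \<ge> 3"
  shows "root_duality (TypeC n) 2 2 (\<lambda>j. real (n + 1) - real j) (TypeB n) 1 2 (\<lambda>j. real (n + 1) - real j)
    id (\<lambda>i. i) (\<lambda>i. if i = n then 2 else 1)"
proof (intro root_duality.intro root_datum_B root_datum_C root_duality_axioms.intro linear_maps bij_id, goal_cases)
  case (5 i x)
  then show ?case by (simp add: pairing_def ip_B_C)
next
  case (6 i)
  then show ?case by (auto simp: ip_linear ip_unit_left split: if_splits) (auto simp: unit_vec_apply split: if_splits)
next
  case (7 i)
  then show ?case by (auto simp: ip_linear ip_unit_left split: if_splits) (auto simp: unit_vec_apply split: if_splits)
qed (use assms in \<open>auto simp: bij_betw_def\<close>)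

lemma root_duality_F4:
  "root_duality TypeF4 1 2 (\<lambda>j. if j = 1 then 11 else if j = 2 then 5 else if j = 3 then 3 else 1)
    TypeF4 1 2 (\<lambda>j. if j = 1 then 11 else if j = 2 then 5 else if j = 3 then 3 else 1)
    block_map (\<lambda>i. 5 - i) (\<lambda>i. if i \<le> 2 then 2 else 1)"
proof (intro root_duality.intro root_datum_F4 root_duality_axioms.intro linear_maps bij_block_map, goal_cases)
  case 1
  then show ?case using bij_betw_diff[of 4] by simp
next
  case (2 i)
  then have i: "i = 1 \<or> i = 2 \<or> i = 3 \<or> i = 4" by auto
  have "block_map (simple_root TypeF4 i) j = (if i \<le> 2 then 2 else 1) * simple_root TypeF4 (5 - i) j" for j
  proof -
    have "j = 1 \<or> j = 2 \<or> j = 3 \<or> j = 4 \<or> j \<notin> {1, 2, 3, 4}" by auto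
    then show ?thesis using i
      by (elim disjE) (simp_all add: block_map_def unit_vec_def)
  qed
  then show ?case by auto
next
  case (3 i x)
  then have "i = 1 \<or> i = 2 \<or> i = 3 \<or> i = 4" by auto
  then show ?case by (elim disjE) (simp_all add: block_map_def pairing_def ip_F4 unit_vec_def field_simps)
next
  case (4 i)
  then have "i = 1 \<or> i = 2 \<or> i = 3 \<or> i = 4" by auto
  then show ?case using 4 by (elim disjE) (simp_all add: ip_F4 unit_vec_def)
next
  case (5 i)
  then have "i = 1 \<or> i = 2 \<or> i = 3 \<or> i = 4" by auto
  then show ?case using 5 by (elim disjE) (simp_all add: ip_F4 unit_vec_def)
qed

lemma root_duality_G2:
  "root_duality TypeG2 2 3 (\<lambda>j. if j = 1 then -1 else if j = 2 then -2 else 3)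
    TypeG2 2 3 (\<lambda>j. if j = 1 then -1 else if j = 2 then -2 else 3)
    circulant_map (\<lambda>i. 3 - i) (\<lambda>i. if i = 1 then 1 else 3)"
proof (intro root_duality.intro root_datum_G2 root_duality_axioms.intro linear_maps bij_circulant_map, goal_cases)
  case 1
  then show ?case using bij_betw_diff[of 2] by (simp add: numeral_3_eq_3 numeral_2_eq_2)
next
  case (2 i)
  then have "i = 1 \<or> i = 2" by auto
  then show ?case by (elim disjE) (simp_all add: circulant_map_def unit_vec_def fun_eq_iff)
next
  case (3 i x)
  then have "i = 1 \<or> i = 2" by auto
  then show ?case by (elim disjE) (simp_all add: circulant_map_def pairing_def ip_G2 unit_vec_def field_simps)
next
  case (4 i)
  then have "i = 1 \<or> i = 2" by auto
  then show ?case using 4 by (elim disjE) (simp_all add: ip_G2 unit_vec_def)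
next
  case (5 i)
  then have "i = 1 \<or> i = 2" by auto
  then show ?case using 5 by (elim disjE) (simp_all add: ip_G2 unit_vec_def)
qed

section \<open>The action and the anti-involution\<close>

lemma diagram_datum_exists:
  assumes "admissible D"
  shows "\<exists>s q \<rho>. diagram_datum D s q \<rho>"
proof (cases D)
  case (Triple Y)
  have "\<exists>s q \<rho>. root_datum Y s q \<rho>"
  proof (cases Y)
    case (TypeA n)
    then have "n \<ge> 1" using assms Triple by simp
    then show ?thesis unfolding TypeA by (intro exI) (rule root_datum_A)
  next
    case (TypeB n)
    then have "n \<ge> 2" using assms Triple by simp
    then show ?thesis unfolding TypeB by (intro exI) (rule root_datum_B)
  next
    case (TypeC n)
    then have "n \<ge> 2" using assms Triple by simp
    then show ?thesis unfolding TypeC by (intro exI) (rule root_datum_C)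
  next
    case (TypeD n)
    then have "n \<ge> 4" using assms Triple by simp
    then show ?thesis unfolding TypeD by (intro exI) (rule root_datum_D)
  next
    case TypeE6
    show ?thesis unfolding TypeE6 by (intro exI) (rule root_datum_E; simp add: fun_eq_iff)
  next
    case TypeE7
    show ?thesis unfolding TypeE7 by (intro exI) (rule root_datum_E; simp add: fun_eq_iff)
  next
    case TypeE8
    show ?thesis unfolding TypeE8 by (intro exI) (rule root_datum_E; simp add: fun_eq_iff)
  next
    case TypeF4
    show ?thesis unfolding TypeF4 by (intro exI) (rule root_datum_F4)
  next
    case TypeG2
    show ?thesis unfolding TypeG2 by (intro exI) (rule root_datum_G2)
  qed
  then show ?thesis using assms by (simp add: diagram_datum_def diagram_datum_axioms_def Triple)
next
  case (Umlaut Y)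
  have "\<exists>s \<rho>. root_datum Y s (level D) \<rho>"
  proof (cases Y)
    case (TypeB n)
    then have "n \<ge> 2" "level D = 2" using assms Umlaut by simp_all
    then show ?thesis unfolding TypeB by (simp only:) (intro exI, rule root_datum_B)
  next
    case (TypeC n)
    then have "n \<ge> 2" "level D = 2" using assms Umlaut by simp_all
    then show ?thesis unfolding TypeC by (simp only:) (intro exI, rule root_datum_C)
  next
    case TypeF4
    then have "level D = 2" using Umlaut by simp
    then show ?thesis unfolding TypeF4 by (simp only:) (intro exI, rule root_datum_F4)
  next
    case TypeG2
    then have "level D = 3" using Umlaut by simp
    then show ?thesis unfolding TypeG2 by (simp only:) (intro exI, rule root_datum_G2)
  qed (use assms Umlaut in simp_all)
  then show ?thesis using assms by (auto simp: diagram_datum_def diagram_datum_axioms_def Umlaut simp del: level.simps)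
qed

lemma (in root_duality) reduced_expression_dual:
  shows "reduced_expression X (reflection X (highest_root X)) is \<Longrightarrow>
      reduced_expression X' (reflection X' (dominant_short_root X')) (map e (rev is))"
    and "reduced_expression X (reflection X (dominant_short_root X)) is \<Longrightarrow>
      reduced_expression X' (reflection X' (highest_root X')) (map e (rev is))"
proof -
  have *: "reduced_expression X' (reflection X' \<gamma>) (map e (rev is))"
    if "reduced_expression X (reflection X \<beta>) is" "\<beta> \<in> roots X" "\<And>x. F (reflection X \<beta> x) = reflection X' \<gamma> (F x)"
    for \<beta> \<gamma>
  proof -
    have w: "weyl_prod X is = reflection X \<beta>" using that(1) by (simp add: reduced_expression_def)
    then have "P.reduced is" using that(1) by (simp add: P.reduced_def)
    from reduced_dual[OF this w _ that(3)] show ?thesis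
      unfolding Q.reduced_def using P.root_norm_pos[OF that(2)] by (metis less_irrefl)
  qed
  show "reduced_expression X (reflection X (highest_root X)) is \<Longrightarrow>
      reduced_expression X' (reflection X' (dominant_short_root X')) (map e (rev is))"
    by (rule *) (use P.highest_root F_reflection_highest in auto)
  show "reduced_expression X (reflection X (dominant_short_root X)) is \<Longrightarrow>
      reduced_expression X' (reflection X' (highest_root X')) (map e (rev is))"
    by (rule *) (use P.dominant_short_root F_reflection_short in auto)
qed

lemma umlaut_duality:
  assumes "admissible D" "D = Umlaut X"
  shows "\<exists>s q \<rho> s' q' \<rho>' F c. root_duality X s q \<rho> (finite_type (dual D)) s' q' \<rho>' F (e_index D) c"
proof (cases X)
  case (TypeB n)
  show ?thesis
  proof (cases "n = 2")
    case True
    then have "e_index D = (\<lambda>i. 3 - i)" "finite_type (dual D) = TypeB 2" using assms TypeB by auto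
    then show ?thesis unfolding True TypeB by (simp only:) (intro exI, rule root_duality_B2)
  next
    case False
    then have "e_index D = (\<lambda>i. i)" "finite_type (dual D) = TypeC n" "n \<ge> 3" using assms TypeB by auto
    then show ?thesis unfolding TypeB by (simp only:) (intro exI, rule root_duality_BC)
  qed
next
  case (TypeC n)
  show ?thesis
  proof (cases "n = 2")
    case True
    then have "e_index D = (\<lambda>i. 3 - i)" "finite_type (dual D) = TypeC 2" using assms TypeC by auto
    then show ?thesis unfolding True TypeC by (simp only:) (intro exI, rule root_duality_C2)
  next
    case False
    then have "e_index D = (\<lambda>i. i)" "finite_type (dual D) = TypeB n" "n \<ge> 3" using assms TypeC by auto
    then show ?thesis unfolding TypeC by (simp only:) (intro exI, rule root_duality_CB)
  qed
next
  case TypeF4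
  then have "e_index D = (\<lambda>i. 5 - i)" "finite_type (dual D) = TypeF4" using assms by auto
  then show ?thesis unfolding TypeF4 by (simp only:) (intro exI, rule root_duality_F4)
next
  case TypeG2
  then have "e_index D = (\<lambda>i. 3 - i)" "finite_type (dual D) = TypeG2" using assms by auto
  then show ?thesis unfolding TypeG2 by (simp only:) (intro exI, rule root_duality_G2)
qed (use assms in auto)

lemma dual_dual: "admissible D \<Longrightarrow> dual (dual D) = D"
  by (induction D rule: dual.induct) auto

lemma admissible_dual: "admissible D \<Longrightarrow> admissible (dual D)"
  by (induction D rule: dual.induct) auto

lemma level_dual: "admissible D \<Longrightarrow> level (dual D) = level D"
  by (induction D rule: dual.induct) auto

lemma rank_dual: "rank (finite_type (dual D)) = rank (finite_type D)"
  by (induction D rule: dual.induct) auto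

lemma affine_nodes_dual: "affine_nodes (dual D) = affine_nodes D"
  by (induction D rule: dual.induct) auto

lemma e_index_closed:
  "admissible D \<Longrightarrow> i \<in> {1..rank (finite_type D)} \<Longrightarrow> e_index D i \<in> {1..rank (finite_type D)}"
  by (induction D i rule: e_index.induct) auto

lemma e_index_dual:
  "admissible D \<Longrightarrow> i \<in> {1..rank (finite_type D)} \<Longrightarrow> e_index (dual D) (e_index D i) = i"
  by (induction D i rule: e_index.induct) auto

lemma e_gen_nodes:
  assumes "admissible D" "g \<in> nodes D"
  shows "e_gen D g \<in> nodes (dual D)"
proof (cases g)
  case (T i)
  then have "i \<in> {1..rank (finite_type D)}" using assms(2) by (cases D) (auto simp: nodes_def)
  then show ?thesis using e_index_closed[OF assms(1)] T by (simp add: nodes_def rank_dual)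
qed (use assms(2) in \<open>cases D; auto simp: nodes_def affine_nodes_dual\<close>)+

lemma e_gen_dual:
  assumes "admissible D" "g \<in> nodes D"
  shows "e_gen (dual D) (e_gen D g) = g"
proof (cases g)
  case (T i)
  then have "i \<in> {1..rank (finite_type D)}" using assms(2) by (cases D) (auto simp: nodes_def)
  then show ?thesis using e_index_dual[OF assms(1)] T by simp
qed auto

lemma (in group) cancel_left:
  "a \<in> carrier G \<Longrightarrow> b \<in> carrier G \<Longrightarrow> inv a \<otimes> (a \<otimes> b) = b"
  "a \<in> carrier G \<Longrightarrow> b \<in> carrier G \<Longrightarrow> a \<otimes> (inv a \<otimes> b) = b"
  by (simp_all flip: m_assoc)

section \<open>Weyl group elements in the braid group\<close>

context diagram_datum
begin

lemma cls_append: "u \<in> words (nodes D) \<Longrightarrow> w \<in> words (nodes D) \<Longrightarrow> BG.cls (u @ w) = BG.cls u \<otimes>\<^bsub>BG.PG\<^esub> BG.cls w"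
  by (simp add: BG.mult_cls)

lemma cls_neg: "g \<in> nodes D \<Longrightarrow> BG.cls (neg g) = inv\<^bsub>BG.PG\<^esub> (BG.cls (pos g))"
  by (simp add: BG.inv_cls)

lemma cls_inv_word: "w \<in> words (nodes D) \<Longrightarrow> BG.cls (inv_word w) = inv\<^bsub>BG.PG\<^esub> (BG.cls w)"
  by (simp add: BG.inv_cls)

lemma cls_T_list:
  assumes "set is \<subseteq> I"
  shows "BG.cls (T_list is) = list_value BG.PG (\<lambda>i. BG.cls (pos (T i))) is"
proof -
  have eq: "T_list is = concat (map pos (map T is))" by (simp add: T_list_def comp_def)
  have "set (map T is) \<subseteq> nodes D" using assms by (auto simp: T_in_nodes)
  then have "BG.cls (T_list is) = list_value BG.PG (\<lambda>g. BG.cls (pos g)) (map T is)"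
    unfolding eq by (rule BG.cls_pos_list)
  also have "\<dots> = list_value BG.PG (\<lambda>i. BG.cls (pos (T i))) is"
    by (induction "is") simp_all
  finally show ?thesis .
qed

lemma T_list_alt: "T_list (alt k i j) = alternating k (T i) (T j)"
  by (induction k arbitrary: i j) (simp_all add: T_list_def)

lemma edges_T: "edges D (T i) (T j) = bond X (simple_root X i) (simple_root X j)"
  by (cases D) (simp_all add: edges_def)

text \<open>Matsumoto's theorem for the generators \<open>T i\<close>, whose braid relations are
  among the defining ones.\<close>

lemma cls_T_list_reduced:
  assumes "reduced is" "reduced js" "weyl_prod X is = weyl_prod X js"
  shows "BG.cls (T_list is) = BG.cls (T_list js)"
proof -
  have "list_value BG.PG (\<lambda>i. BG.cls (pos (T i))) is = list_value BG.PG (\<lambda>i. BG.cls (pos (T i))) js"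
  proof (rule matsumoto[OF BG.group_PG _ _ assms])
    show "BG.cls (pos (T i)) \<in> carrier BG.PG" if "i \<in> I" for i
      using that by (simp add: T_in_nodes)
    fix i j assume ij: "i \<in> I" "j \<in> I" "i \<noteq> j"
    have "(alternating (coxeter i j) (T i) (T j), alternating (coxeter i j) (T j) (T i)) \<in>
        braid_relations (nodes D) (edges D)"
      unfolding braid_relations_def mem_Collect_eq
      using ij simple_bond_less[OF ij]
      by (intro exI[of _ "T i"] exI[of _ "T j"]) (simp add: T_in_nodes coxeter_def edges_T)
    then have "(alternating (coxeter i j) (T i) (T j), alternating (coxeter i j) (T j) (T i)) \<in> relations D"
      by (simp add: relations_def)
    then have "BG.cls (T_list (alt (coxeter i j) i j)) = BG.cls (T_list (alt (coxeter i j) j i))"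
      unfolding T_list_alt by (rule BG.cls_relation)
    moreover have "set (alt k i j) \<subseteq> I" "set (alt k j i) \<subseteq> I" for k
      using set_alt[of k i j] set_alt[of k j i] ij by auto
    ultimately show "list_value BG.PG (\<lambda>i. BG.cls (pos (T i))) (alt (coxeter i j) i j) =
        list_value BG.PG (\<lambda>i. BG.cls (pos (T i))) (alt (coxeter i j) j i)"
      by (simp add: cls_T_list)
  qed
  then show ?thesis using assms(1,2) reduced_set by (simp add: cls_T_list)
qed

lemma reduced_expressionD:
  assumes "reduced_expression X w is"
  shows "reduced is" "weyl_prod X is = w"
  using assms by (simp_all add: reduced_def reduced_expression_def)

lemma cls_T_word:
  assumes "reduced_expression X w is"
  shows "BG.cls (T_word X w) = BG.cls (T_list is)"
proof -
  note w = reduced_expressionD[OF assms]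
  then have "weyl_element w" using reduced_set by (auto simp: weyl_element_def)
  then obtain js where "reduced js" "weyl_prod X js = w" "T_word X w = T_list js"
    using T_word_reduced by blast
  then show ?thesis using cls_T_list_reduced[of js "is"] w by simp
qed

lemma reduced_expression_exists:
  assumes "\<beta> \<in> roots X"
  shows "\<exists>is. reduced_expression X (reflection X \<beta>) is"
  using T_word_reduced[OF weyl_element_reflection[OF assms]] by (auto simp: reduced_def)

end

section \<open>The anti-isomorphism between dual braid groups\<close>

locale anti_isomorphism = P: diagram_datum D s q \<rho> + Q: diagram_datum D' s' q' \<rho>'
  for D s q \<rho> D' s' q' \<rho>' +
  fixes e
  assumes D': "D' = dual D" and e: "is_anti_involution D e"
begin

abbreviation "B \<equiv> P.BG.PG"
abbreviation "B' \<equiv> Q.BG.PG"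

lemma e_closed [simp]: "y \<in> carrier B \<Longrightarrow> e y \<in> carrier B'"
  using e by (auto simp: is_anti_involution_def P.braid_group_eq Q.braid_group_eq bij_betw_def simp flip: D')

lemma e_mult [simp]: "y \<in> carrier B \<Longrightarrow> z \<in> carrier B \<Longrightarrow> e (y \<otimes>\<^bsub>B\<^esub> z) = e z \<otimes>\<^bsub>B'\<^esub> e y"
  using e by (auto simp: is_anti_involution_def P.braid_group_eq Q.braid_group_eq simp flip: D')

lemma e_pos: "g \<in> nodes D \<Longrightarrow> e (P.BG.cls (pos g)) = Q.BG.cls (pos (e_gen D g))"
  using e by (auto simp: is_anti_involution_def P.elt_eq Q.elt_eq simp flip: D')

lemma e_one [simp]: "e \<one>\<^bsub>B\<^esub> = \<one>\<^bsub>B'\<^esub>"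
proof -
  have "e \<one>\<^bsub>B\<^esub> \<otimes>\<^bsub>B'\<^esub> e \<one>\<^bsub>B\<^esub> = e \<one>\<^bsub>B\<^esub>"
    using e_mult[of "\<one>\<^bsub>B\<^esub>" "\<one>\<^bsub>B\<^esub>"] by simp
  then show ?thesis by simp
qed

lemma e_inv [simp]:
  assumes "y \<in> carrier B"
  shows "e (inv\<^bsub>B\<^esub> y) = inv\<^bsub>B'\<^esub> (e y)"
proof -
  have "e (inv\<^bsub>B\<^esub> y) \<otimes>\<^bsub>B'\<^esub> e y = \<one>\<^bsub>B'\<^esub>"
    using e_mult[of y "inv\<^bsub>B\<^esub> y"] assms by simp
  then show ?thesis using assms by (intro Q.BG.PG.inv_equality[symmetric]) simp_all
qed

lemma e_gen_node: "g \<in> nodes D \<Longrightarrow> e_gen D g \<in> nodes D'"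
  using e_gen_nodes[OF P.admissible] D' by simp

lemma e_index_I: "set is \<subseteq> P.I \<Longrightarrow> set (map (e_index D) is) \<subseteq> Q.I"
  using e_index_closed[OF P.admissible] by (auto simp: D' rank_dual)

lemma e_T_list:
  "set is \<subseteq> P.I \<Longrightarrow> e (P.BG.cls (P.T_list is)) = Q.BG.cls (Q.T_list (map (e_index D) (rev is)))"
proof (induction "is")
  case Nil
  then show ?case by (simp add: P.T_list_def Q.T_list_def flip: P.BG.one_PG Q.BG.one_PG)
next
  case (Cons i "is")
  have i: "T i \<in> nodes D" "P.T_list is \<in> words (nodes D)" using Cons.prems P.T_in_nodes P.T_list_words by auto
  have j: "T (e_index D i) \<in> nodes D'" using e_gen_node[OF i(1)] by simp
  have js: "Q.T_list (map (e_index D) (rev is)) \<in> words (nodes D')"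
    unfolding Q.T_list_words using e_index_I[of "rev is"] Cons.prems by simp
  have "P.T_list (i # is) = pos (T i) @ P.T_list is" by (simp add: P.T_list_def)
  moreover have "Q.T_list (map (e_index D) (rev (i # is))) = Q.T_list (map (e_index D) (rev is)) @ pos (T (e_index D i))"
    by (simp add: Q.T_list_def)
  ultimately show ?case using Cons i j js by (simp add: P.cls_append Q.cls_append e_pos)
qed

text \<open>Reversed and relabelled, a reduced word for the reflection in \<phi> is one for the
  reflection in the dual \<theta>. Reduced words for one element agree in the braid group, whichever
  of them was chosen.\<close>

lemma e_Phi_Theta:
  assumes "D = Umlaut Y"
  shows "e (P.BG.cls (Phi_word D)) = Q.BG.cls (Theta_word D')"
    and "e (P.BG.cls (Theta_word D)) = Q.BG.cls (Phi_word D')"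
proof -
  obtain t p \<tau> t' p' \<tau>' F c where "root_duality P.X t p \<tau> Q.X t' p' \<tau>' F (e_index D) c"
    using umlaut_duality[OF P.admissible assms] by (auto simp: D' assms)
  then interpret R: root_duality P.X t p \<tau> Q.X t' p' \<tau>' F "e_index D" c .
  have umlaut': "theta D' = dominant_short_root Q.X" "theta D = dominant_short_root P.X"
    using assms by (simp_all add: D') (cases Y; simp)
  have *: "e (P.BG.cls (T_word P.X w)) = Q.BG.cls (T_word Q.X w')"
    if "reduced_expression P.X w is" "reduced_expression Q.X w' (map (e_index D) (rev is))" for w w' "is"
    using that P.cls_T_word[OF that(1)] Q.cls_T_word[OF that(2)] e_T_list[of "is"]
      P.reduced_set[OF P.reduced_expressionD(1)[OF that(1)]] by simp
  obtain "is" where "reduced_expression P.X (reflection P.X (highest_root P.X)) is"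
    using P.reduced_expression_exists P.highest_root by blast
  then show "e (P.BG.cls (Phi_word D)) = Q.BG.cls (Theta_word D')"
    unfolding Phi_word_def Theta_word_def umlaut' using R.reduced_expression_dual by (intro *) auto
  obtain js where "reduced_expression P.X (reflection P.X (dominant_short_root P.X)) js"
    using P.reduced_expression_exists P.dominant_short_root by blast
  then show "e (P.BG.cls (Theta_word D)) = Q.BG.cls (Phi_word D')"
    unfolding Phi_word_def Theta_word_def umlaut' using R.reduced_expression_dual by (intro *) auto
qed

end

lemma carrier_AutoGroup: "f \<in> carrier (AutoGroup G) \<Longrightarrow> f \<in> hom G G"
  by (simp add: AutoGroup_def auto_def)

lemma mult_AutoGroup:
  "f \<in> carrier (AutoGroup G) \<Longrightarrow> g \<in> carrier (AutoGroup G) \<Longrightarrow> y \<in> carrier G \<Longrightarrow> (f \<otimes>\<^bsub>AutoGroup G\<^esub> g) y = f (g y)"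
  by (simp add: AutoGroup_def BijGroup_def auto_def compose_def)

lemma one_AutoGroup: "y \<in> carrier G \<Longrightarrow> \<one>\<^bsub>AutoGroup G\<^esub> y = y"
  by (simp add: AutoGroup_def BijGroup_def)

section \<open>The action pulled back to the Artin group\<close>

locale braid_action = diagram_datum D s q \<rho> + ar: artin r for D s q \<rho> r +
  fixes act
  assumes r: "r = level D" and act: "is_action D act"
begin

definition A :: "ugen word set \<Rightarrow> gen word set \<Rightarrow> gen word set" where
  "A g = act (ar.cover g)"

lemma A_hom: "A \<in> hom ar.Art (AutoGroup BG.PG)"
proof -
  have "A = act \<circ> ar.cover" by (simp add: fun_eq_iff A_def)
  moreover have "act \<in> hom (Gamma_tilde r) (AutoGroup BG.PG)"
    using act by (simp add: is_action_def braid_group_eq r)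
  ultimately show ?thesis using hom_compose[OF ar.cover_hom_Gamma_tilde] by simp
qed

lemma A_carrier: "g \<in> carrier ar.Art \<Longrightarrow> A g \<in> carrier (AutoGroup BG.PG)"
  using A_hom by (auto simp: hom_def)

lemma A_aut_hom: "g \<in> carrier ar.Art \<Longrightarrow> A g \<in> hom BG.PG BG.PG"
  using A_carrier carrier_AutoGroup by blast

lemma A_closed [simp]: "g \<in> carrier ar.Art \<Longrightarrow> y \<in> carrier BG.PG \<Longrightarrow> A g y \<in> carrier BG.PG"
  using A_aut_hom by (auto simp: hom_def)

lemma A_mult_arg [simp]:
  "g \<in> carrier ar.Art \<Longrightarrow> y \<in> carrier BG.PG \<Longrightarrow> z \<in> carrier BG.PG \<Longrightarrow>
    A g (y \<otimes>\<^bsub>BG.PG\<^esub> z) = A g y \<otimes>\<^bsub>BG.PG\<^esub> A g z"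
  using A_aut_hom by (auto simp: hom_def)

lemma A_inv_arg [simp]:
  "g \<in> carrier ar.Art \<Longrightarrow> y \<in> carrier BG.PG \<Longrightarrow> A g (inv\<^bsub>BG.PG\<^esub> y) = inv\<^bsub>BG.PG\<^esub> (A g y)"
  using A_aut_hom hom_inv[OF BG.group_PG BG.group_PG] by blast

lemma A_mult [simp]:
  "g \<in> carrier ar.Art \<Longrightarrow> h \<in> carrier ar.Art \<Longrightarrow> y \<in> carrier BG.PG \<Longrightarrow> A (g \<otimes>\<^bsub>ar.Art\<^esub> h) y = A g (A h y)"
  using hom_mult[OF A_hom, of g h] mult_AutoGroup[OF A_carrier A_carrier] by simp

lemma A_one [simp]: "y \<in> carrier BG.PG \<Longrightarrow> A \<one>\<^bsub>ar.Art\<^esub> y = y"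
  using hom_one[OF A_hom ar.A.group_PG BG.PG.AutoGroup] one_AutoGroup by simp

lemma A_inv_cancel:
  "g \<in> carrier ar.Art \<Longrightarrow> y \<in> carrier BG.PG \<Longrightarrow> A g (A (inv\<^bsub>ar.Art\<^esub> g) y) = y"
  "g \<in> carrier ar.Art \<Longrightarrow> y \<in> carrier BG.PG \<Longrightarrow> A (inv\<^bsub>ar.Art\<^esub> g) (A g y) = y"
  using A_mult[of g "inv\<^bsub>ar.Art\<^esub> g" y] A_mult[of "inv\<^bsub>ar.Art\<^esub> g" g y] by simp_all

lemma A_x: "g \<in> nodes D \<Longrightarrow> A ar.x (BG.cls (pos g)) = BG.cls (a_word D g)"
  and A_v: "g \<in> nodes D \<Longrightarrow> A ar.v (BG.cls (pos g)) = BG.cls (b_word D g)"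
  using act by (simp_all add: is_action_def elt_eq A_def ar.cover_x ar.cover_v flip: r)

lemma rep_hom': "rep a b \<in> hom BG.PG BijVec"
  using rep_hom by (simp add: braid_group_eq)

lemma rep_A_x:
  assumes "y \<in> carrier BG.PG"
  shows "rep a b (A ar.x y) = rep (a + b) b y"
proof -
  have "(rep a b \<circ> A ar.x) y = rep (a + b) b y"
  proof (rule BG.hom_eqI[OF group_BijGroup _ rep_hom' assms])
    show "rep a b \<circ> A ar.x \<in> hom BG.PG BijVec"
      using hom_compose[OF A_aut_hom rep_hom'] by simp
    show "(rep a b \<circ> A ar.x) (BG.cls (pos g)) = rep (a + b) b (BG.cls (pos g))" if "g \<in> nodes D" for g
      using that a_word_words[OF that] rep_elt[of "pos g" "a + b" b] rep_elt[of "a_word D g" a b]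
      by (simp add: A_x rep_a_word rep_word_pos elt_eq)
  qed
  then show ?thesis by simp
qed

lemma rep_A_v:
  assumes "y \<in> carrier BG.PG"
  shows "rep a b (A ar.v y) = rep a (b - real r * a) y"
proof -
  have "(rep a b \<circ> A ar.v) y = rep a (b - real r * a) y"
  proof (rule BG.hom_eqI[OF group_BijGroup _ rep_hom' assms])
    show "rep a b \<circ> A ar.v \<in> hom BG.PG BijVec"
      using hom_compose[OF A_aut_hom rep_hom'] by simp
    show "(rep a b \<circ> A ar.v) (BG.cls (pos g)) = rep a (b - real r * a) (BG.cls (pos g))" if "g \<in> nodes D" for g
      using that b_word_words[OF that] rep_elt[of "pos g" a "b - real r * a"] rep_elt[of "b_word D g" a b]
      by (simp add: A_v rep_b_word rep_word_pos elt_eq flip: r)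
  qed
  then show ?thesis by simp
qed

text \<open>For determinant 1 this is p -> M^-1 p, written with the adjugate. The inverse reflects
  that composing a representation with the action reverses products.\<close>

definition twist :: "int^2^2 \<Rightarrow> real \<times> real \<Rightarrow> real \<times> real" where
  "twist M p = (fst p * of_int (M $ 2 $ 2) - snd p * of_int (M $ 1 $ 2),
    snd p * of_int (M $ 1 $ 1) - fst p * of_int (M $ 2 $ 1))"

lemma twist_mult: "twist (M ** N) p = twist N (twist M p)"
  by (simp add: twist_def matrix_matrix_mult_def sum_2 algebra_simps)

lemma twist_one: "twist (mat 1) p = p"
  by (simp add: twist_def mat_def)

abbreviation "rep2 p \<equiv> rep (fst p) (snd p)"

lemma rep2_generators:
  assumes "y \<in> carrier BG.PG"
  shows "rep2 p (A ar.x y) = rep2 (twist (ar.mtx ar.x) p) y" "rep2 p (A ar.v y) = rep2 (twist (ar.mtx ar.v) p) y"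
  using rep_A_x[OF assms] rep_A_v[OF assms] by (simp_all add: twist_def ar.mtx_x ar.mtx_v mult.commute)

lemma rep_A:
  assumes "g \<in> carrier ar.Art" "y \<in> carrier BG.PG"
  shows "rep2 p (A g y) = rep2 (twist (ar.mtx g) p) y"
proof -
  interpret m: group_hom ar.Art SL2Z ar.mtx
    using ar.mtx_hom ar.A.group_PG group_SL2Z by (simp add: group_hom_def group_hom_axioms_def)
  have step: "rep2 p (A (h \<otimes>\<^bsub>ar.Art\<^esub> g) y) = rep2 (twist (ar.mtx (h \<otimes>\<^bsub>ar.Art\<^esub> g)) p) y"
    if "h \<in> carrier ar.Art" "g \<in> carrier ar.Art" "y \<in> carrier BG.PG"
      "\<And>p y. y \<in> carrier BG.PG \<Longrightarrow> rep2 p (A h y) = rep2 (twist (ar.mtx h) p) y"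
      "\<And>p y. y \<in> carrier BG.PG \<Longrightarrow> rep2 p (A g y) = rep2 (twist (ar.mtx g) p) y" for h g y p
    using that by (simp add: twist_mult)
  have inverse: "rep2 p (A (inv\<^bsub>ar.Art\<^esub> h) y) = rep2 (twist (ar.mtx (inv\<^bsub>ar.Art\<^esub> h)) p) y"
    if h: "h \<in> carrier ar.Art" and y: "y \<in> carrier BG.PG"
      and rep: "\<And>p y. y \<in> carrier BG.PG \<Longrightarrow> rep2 p (A h y) = rep2 (twist (ar.mtx h) p) y" for h y p
  proof -
    \<comment> \<open>From the parameter already twisted by the inverse, the formula for h leads
      back to p.\<close>
    let ?p = "twist (ar.mtx (inv\<^bsub>ar.Art\<^esub> h)) p"
    have "ar.mtx (inv\<^bsub>ar.Art\<^esub> h) ** ar.mtx h = mat 1"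
      using h m.hom_mult[of "inv\<^bsub>ar.Art\<^esub> h" h] by simp
    then have "twist (ar.mtx h) ?p = p" by (simp add: twist_one flip: twist_mult)
    then have "rep2 ?p (A h (A (inv\<^bsub>ar.Art\<^esub> h) y)) = rep2 p (A (inv\<^bsub>ar.Art\<^esub> h) y)"
      using rep[of "A (inv\<^bsub>ar.Art\<^esub> h) y" ?p] h y by simp
    then show ?thesis using h y by (simp add: A_inv_cancel)
  qed
  show ?thesis
    using assms
  proof (induction g arbitrary: p y rule: ar.Art_induct)
    case one
    then show ?case by (simp add: twist_one)
  next
    case (x g)
    show ?case by (rule step) (use x rep2_generators in auto)
  next
    case (v g)
    show ?case by (rule step) (use v rep2_generators in auto)
  next
    case (inv_x g)
    show ?case by (rule step) (use inv_x rep2_generators inverse in auto)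
  next
    case (inv_v g)
    show ?case by (rule step) (use inv_v rep2_generators inverse in auto)
  qed
qed

text \<open>The representations at p and at the twisted p coincide, hence so do the parameters; the
  two unit vectors then read off the matrix.\<close>

lemma trivial_action_imp_mtx:
  assumes g: "g \<in> carrier ar.Art" and triv: "\<And>y. y \<in> carrier BG.PG \<Longrightarrow> A g y = y"
  shows "ar.mtx g = mat 1"
proof -
  have eq: "twist (ar.mtx g) p = p" for p
  proof -
    have "rep_gen (fst (twist (ar.mtx g) p)) (snd (twist (ar.mtx g) p)) k = rep_gen (fst p) (snd p) k"
      if k: "k \<in> nodes D" for k
    proof -
      have "BG.cls (pos k) \<in> carrier BG.PG" using k by simp
      then have "rep2 (twist (ar.mtx g) p) (BG.cls (pos k)) = rep2 p (BG.cls (pos k))"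
        using rep_A[OF g, of "BG.cls (pos k)" p] triv by simp
      then show ?thesis using rep_elt[of "pos k"] k by (simp add: elt_eq rep_word_pos)
    qed
    from rep_inject[OF this] show ?thesis by (simp add: prod_eq_iff)
  qed
  from eq[of "(1, 0)"] eq[of "(0, 1)"] show ?thesis
    by (simp add: twist_def mat_1_conv_mat2 mat2_eq_iff)
qed

lemma A_T_list:
  assumes "g = ar.x \<or> g = ar.v" "set is \<subseteq> I"
  shows "A g (BG.cls (T_list is)) = BG.cls (T_list is)"
  using assms(2)
proof (induction "is")
  case Nil
  have "g \<in> carrier ar.Art" using assms(1) by auto
  then show ?case using hom_one[OF A_aut_hom BG.group_PG BG.group_PG] by (simp add: T_list_def flip: BG.one_PG)
next
  case (Cons i "is")
  have i: "T i \<in> nodes D" "T_list is \<in> words (nodes D)" using Cons.prems T_in_nodes T_list_words by auto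
  have "A g (BG.cls (pos (T i))) = BG.cls (pos (T i))" using assms(1) i A_x A_v by auto
  moreover have "T_list (i # is) = pos (T i) @ T_list is" by (simp add: T_list_def)
  moreover have "g \<in> carrier ar.Art" using assms(1) by auto
  ultimately show ?case using Cons i by (simp add: cls_append)
qed

text \<open>Both are words in the \<open>T i\<close>, which the action fixes.\<close>

lemma A_Theta_Phi:
  assumes "g = ar.x \<or> g = ar.v"
  shows "A g (BG.cls (Theta_word D)) = BG.cls (Theta_word D)" "A g (BG.cls (Phi_word D)) = BG.cls (Phi_word D)"
proof -
  have *: "A g (BG.cls (T_word X w)) = BG.cls (T_word X w)" if "weyl_element w" for w
    using T_word_reduced[OF that] A_T_list[OF assms] reduced_set by auto
  show "A g (BG.cls (Theta_word D)) = BG.cls (Theta_word D)" "A g (BG.cls (Phi_word D)) = BG.cls (Phi_word D)"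
    unfolding Theta_word_def Phi_word_def
    using weyl_element_reflection theta_root highest_root(1) by (simp_all add: *)
qed

end

section \<open>Conjugating the action by the anti-isomorphism\<close>

locale basic_involution = P: braid_action D s q \<rho> r act + Q: braid_action D' s' q' \<rho>' r act' +
    e: anti_isomorphism D s q \<rho> D' s' q' \<rho>' e + e': anti_isomorphism D' s' q' \<rho>' D s q \<rho> e'
  for D s q \<rho> r act D' s' q' \<rho>' act' e e'
begin

abbreviation "B \<equiv> P.BG.PG"
abbreviation "B' \<equiv> Q.BG.PG"

lemma e_e': "y \<in> carrier B' \<Longrightarrow> e (e' y) = y"
proof -
  assume y: "y \<in> carrier B'"
  have "(e \<circ> e') y = id y"
  proof (rule Q.BG.hom_eqI[OF Q.BG.group_PG _ _ y])
    show "e \<circ> e' \<in> hom B' B'" "id \<in> hom B' B'" by (auto intro!: homI)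
    show "(e \<circ> e') (Q.BG.cls (pos g)) = id (Q.BG.cls (pos g))" if "g \<in> nodes D'" for g
      using that e_gen_dual[OF Q.admissible that] by (simp add: e'.e_pos e.e_pos e'.e_gen_node flip: e'.D')
  qed
  then show ?thesis by simp
qed

lemma e'_e: "y \<in> carrier B \<Longrightarrow> e' (e y) = y"
proof -
  assume y: "y \<in> carrier B"
  have "(e' \<circ> e) y = id y"
  proof (rule P.BG.hom_eqI[OF P.BG.group_PG _ _ y])
    show "e' \<circ> e \<in> hom B B" "id \<in> hom B B" by (auto intro!: homI)
    show "(e' \<circ> e) (P.BG.cls (pos g)) = id (P.BG.cls (pos g))" if "g \<in> nodes D" for g
      using that e_gen_dual[OF P.admissible that] by (simp add: e'.e_pos e.e_pos e.e_gen_node flip: e.D')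
  qed
  then show ?thesis by simp
qed

text \<open>Supplies with each kind of node what the computation on generators needs: which affine
  nodes exist and, if there are two, the exchange of the words for \<Theta> and \<Phi>.\<close>

lemma nodes_cases:
  assumes "g \<in> nodes D'"
  obtains (T) i where "g = T i" "i \<in> Q.I"
  | (Theta01) "g = Theta01" "{Theta01, Theta02, Theta03} \<subseteq> nodes D" "{Theta01, Theta02, Theta03} \<subseteq> nodes D'"
  | (Theta02) "g = Theta02" "{Theta01, Theta02, Theta03} \<subseteq> nodes D" "{Theta01, Theta02, Theta03} \<subseteq> nodes D'"
  | (Theta03) "g = Theta03" "{Theta01, Theta02, Theta03} \<subseteq> nodes D" "{Theta01, Theta02, Theta03} \<subseteq> nodes D'"
  | (Theta0) "g = Theta0" "e (P.BG.cls (Phi_word D)) = Q.BG.cls (Theta_word D')"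
      "e (P.BG.cls (Theta_word D)) = Q.BG.cls (Phi_word D')" "{Theta0, Phi0} \<subseteq> nodes D" "{Theta0, Phi0} \<subseteq> nodes D'"
  | (Phi0) "g = Phi0" "e (P.BG.cls (Phi_word D)) = Q.BG.cls (Theta_word D')"
      "e (P.BG.cls (Theta_word D)) = Q.BG.cls (Phi_word D')" "{Theta0, Phi0} \<subseteq> nodes D" "{Theta0, Phi0} \<subseteq> nodes D'"
proof -
  have "affine_nodes D' = affine_nodes D" using affine_nodes_dual e.D' by simp
  then have nodes: "g \<in> T ` Q.I \<union> affine_nodes D" "affine_nodes D \<subseteq> nodes D" "affine_nodes D \<subseteq> nodes D'"
    using assms by (auto simp: nodes_def)
  show ?thesis
  proof (cases D)
    case (Triple Y)
    then have "affine_nodes D = {Theta01, Theta02, Theta03}" by simp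
    then show ?thesis using nodes that(1-4) by auto
  next
    case (Umlaut Y)
    then have "affine_nodes D = {Theta0, Phi0}" by simp
    then show ?thesis using nodes that(1,5,6) e.e_Phi_Theta[OF Umlaut] by auto
  qed
qed

lemma conj_hom:
  assumes "g \<in> carrier P.ar.Art" "h \<in> carrier P.ar.Art"
  shows "(\<lambda>y. Q.A h (e (P.A g (e' y)))) \<in> hom B' B'"
  using assms by (intro homI) simp_all

text \<open>This is e a e = b^-1 without an explicit inverse of b. Two anti-homomorphisms compose to
  a homomorphism, so it suffices to check generators.\<close>

lemma conj_x:
  assumes "y \<in> carrier B'"
  shows "Q.A P.ar.v (e (P.A P.ar.x (e' y))) = y"
proof -
  have "(\<lambda>y. Q.A P.ar.v (e (P.A P.ar.x (e' y)))) y = id y"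
  proof (rule Q.BG.hom_eqI[OF Q.BG.group_PG conj_hom _ assms])
    show "id \<in> hom B' B'" by (auto intro!: homI)
    fix g assume g: "g \<in> nodes D'"
    note simps = e.e_pos e'.e_pos P.A_x Q.A_v P.cls_append Q.cls_append P.cls_neg Q.cls_neg P.cls_inv_word
      Q.cls_inv_word Q.BG.PG.inv_mult_group Q.BG.PG.m_assoc Q.BG.PG.cancel_left P.phi_words Q.theta_words
      Q.A_Theta_Phi
    from g show "Q.A P.ar.v (e (P.A P.ar.x (e' (Q.BG.cls (pos g))))) = id (Q.BG.cls (pos g))"
    proof (cases rule: nodes_cases)
      case (T i)
      then have "T (e_index D' i) \<in> nodes D" "e_index D (e_index D' i) = i"
        using e'.e_gen_node[OF g] e_index_dual[OF Q.admissible, of i] by (simp_all flip: e'.D')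
      then show ?thesis using T g by (simp add: simps)
    qed (simp_all add: simps)
  qed simp_all
  then show ?thesis by simp
qed

lemma conj_v:
  assumes "y \<in> carrier B'"
  shows "Q.A P.ar.x (e (P.A P.ar.v (e' y))) = y"
proof -
  have "(\<lambda>y. Q.A P.ar.x (e (P.A P.ar.v (e' y)))) y = id y"
  proof (rule Q.BG.hom_eqI[OF Q.BG.group_PG conj_hom _ assms])
    show "id \<in> hom B' B'" by (auto intro!: homI)
    fix g assume g: "g \<in> nodes D'"
    note simps = e.e_pos e'.e_pos P.A_v Q.A_x P.cls_append Q.cls_append P.cls_neg Q.cls_neg P.cls_inv_word
      Q.cls_inv_word Q.BG.PG.inv_mult_group Q.BG.PG.m_assoc Q.BG.PG.cancel_left P.theta_words Q.phi_words
      Q.A_Theta_Phi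
    from g show "Q.A P.ar.x (e (P.A P.ar.v (e' (Q.BG.cls (pos g))))) = id (Q.BG.cls (pos g))"
    proof (cases rule: nodes_cases)
      case (T i)
      then have "T (e_index D' i) \<in> nodes D" "e_index D (e_index D' i) = i"
        using e'.e_gen_node[OF g] e_index_dual[OF Q.admissible, of i] by (simp_all flip: e'.D')
      then show ?thesis using T g by (simp add: simps)
    qed (simp_all add: simps)
  qed simp_all
  then show ?thesis by simp
qed

text \<open>Conjugation is multiplicative in g, since e' e can be inserted between two factors; so
  the formula spreads from x and v to all of \<open>Art\<close>.\<close>

lemma conj_A:
  assumes "g \<in> carrier P.ar.Art" "y \<in> carrier B'"
  shows "e (P.A g (e' y)) = Q.A (P.ar.dual_map g) y"
proof -
  interpret d: group_hom P.ar.Art P.ar.Art P.ar.dual_map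
    using P.ar.dual_map_hom P.ar.A.group_PG by (simp add: group_hom_def group_hom_axioms_def)
  have step: "e (P.A (h \<otimes>\<^bsub>P.ar.Art\<^esub> g) (e' y)) = Q.A (P.ar.dual_map (h \<otimes>\<^bsub>P.ar.Art\<^esub> g)) y"
    if "h \<in> carrier P.ar.Art" "g \<in> carrier P.ar.Art" "y \<in> carrier B'"
      "\<And>y. y \<in> carrier B' \<Longrightarrow> e (P.A h (e' y)) = Q.A (P.ar.dual_map h) y"
      "\<And>y. y \<in> carrier B' \<Longrightarrow> e (P.A g (e' y)) = Q.A (P.ar.dual_map g) y" for h g y
  proof -
    have "e (P.A (h \<otimes>\<^bsub>P.ar.Art\<^esub> g) (e' y)) = e (P.A h (e' (e (P.A g (e' y)))))"
      using that(1-3) by (simp add: e'_e)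
    also have "\<dots> = Q.A (P.ar.dual_map h) (Q.A (P.ar.dual_map g) y)"
      unfolding that(5)[OF that(3)] using that(2,3) by (intro that(4)) simp
    finally show ?thesis using that(1-3) by simp
  qed
  \<comment> \<open>Solves k (e h e') = 1 for e h e', the form in which \<open>conj_x\<close> and
    \<open>conj_v\<close> are available.\<close>
  have gen: "e (P.A h (e' y)) = Q.A (P.ar.dual_map h) y"
    if "k \<in> carrier P.ar.Art" "h \<in> carrier P.ar.Art" "P.ar.dual_map h = inv\<^bsub>P.ar.Art\<^esub> k" "y \<in> carrier B'"
      "\<And>y. y \<in> carrier B' \<Longrightarrow> Q.A k (e (P.A h (e' y))) = y" for h k y
  proof -
    have "Q.A (inv\<^bsub>P.ar.Art\<^esub> k) (Q.A k (e (P.A h (e' y)))) = Q.A (inv\<^bsub>P.ar.Art\<^esub> k) y"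
      using that by simp
    moreover have "e (P.A h (e' y)) \<in> carrier B'" using that by simp
    ultimately show ?thesis using that Q.A_inv_cancel(2)[of k "e (P.A h (e' y))"] by simp
  qed
  have inverse: "e (P.A (inv\<^bsub>P.ar.Art\<^esub> h) (e' y)) = Q.A (P.ar.dual_map (inv\<^bsub>P.ar.Art\<^esub> h)) y"
    if h: "h \<in> carrier P.ar.Art" and y: "y \<in> carrier B'"
      and eq: "\<And>y. y \<in> carrier B' \<Longrightarrow> e (P.A h (e' y)) = Q.A (P.ar.dual_map h) y" for h y
  proof (rule gen[of "P.ar.dual_map h"])
    show "Q.A (P.ar.dual_map h) (e (P.A (inv\<^bsub>P.ar.Art\<^esub> h) (e' y))) = y" if y: "y \<in> carrier B'" for y
    proof -
      have "Q.A (P.ar.dual_map h) (e (P.A (inv\<^bsub>P.ar.Art\<^esub> h) (e' y))) =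
          e (P.A h (e' (e (P.A (inv\<^bsub>P.ar.Art\<^esub> h) (e' y)))))"
        using h y by (intro eq[symmetric]) simp
      also have "\<dots> = y" using h y by (simp add: e'_e P.A_inv_cancel e_e')
      finally show ?thesis .
    qed
  qed (use h y in auto)
  note gens = gen[OF P.ar.xv_closed(2,1) P.ar.dual_map_x _ conj_x] gen[OF P.ar.xv_closed P.ar.dual_map_v _ conj_v]
  show ?thesis
    using assms
  proof (induction g arbitrary: y rule: P.ar.Art_induct)
    case one
    then show ?case by (simp add: e_e')
  next
    case (x g)
    show ?case by (rule step) (use x gens in auto)
  next
    case (v g)
    show ?case by (rule step) (use v gens in auto)
  next
    case (inv_x g)
    show ?case by (rule step) (use inv_x gens inverse in auto)
  next
    case (inv_v g)
    show ?case by (rule step) (use inv_v gens inverse in auto)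
  qed
qed

lemma induces_iff:
  assumes g: "g \<in> carrier P.ar.Art"
  shows "induces_basic_involution D act act' e e' (P.ar.cover g) \<longleftrightarrow>
    P.ar.mtx g $ 2 $ 1 = - int r * P.ar.mtx g $ 1 $ 2"
proof -
  interpret d: group_hom P.ar.Art P.ar.Art P.ar.dual_map
    using P.ar.dual_map_hom P.ar.A.group_PG by (simp add: group_hom_def group_hom_axioms_def)
  interpret deg: group_hom P.ar.Art integer_group P.ar.degree
    using P.ar.degree_hom P.ar.A.group_PG by (simp add: group_hom_def group_hom_axioms_def)
  let ?k = "P.ar.dual_map g \<otimes>\<^bsub>P.ar.Art\<^esub> g"
  have k: "?k \<in> carrier P.ar.Art" using g by simp
  have "induces_basic_involution D act act' e e' (P.ar.cover g) \<longleftrightarrow>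
      (\<forall>y\<in>carrier B'. Q.A (P.ar.dual_map g) y = Q.A (inv\<^bsub>P.ar.Art\<^esub> g) y)"
  proof -
    have "act' (inv\<^bsub>Gamma_tilde (level D)\<^esub> (P.ar.cover g)) = Q.A (inv\<^bsub>P.ar.Art\<^esub> g)"
      by (simp only: Q.A_def P.ar.inv_cover[OF g] flip: P.r)
    moreover have "act (P.ar.cover g) = P.A g" by (simp only: P.A_def)
    ultimately show ?thesis
      using g by (simp add: induces_basic_involution_def conj_A Q.braid_group_eq flip: e.D')
  qed
  also have "\<dots> \<longleftrightarrow> (\<forall>y\<in>carrier B'. Q.A ?k y = y)"
  proof (intro iffI ballI)
    show "Q.A ?k y = y" if "\<forall>y\<in>carrier B'. Q.A (P.ar.dual_map g) y = Q.A (inv\<^bsub>P.ar.Art\<^esub> g) y" "y \<in> carrier B'" for y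
      using that g by (simp add: Q.A_inv_cancel)
    show "Q.A (P.ar.dual_map g) y = Q.A (inv\<^bsub>P.ar.Art\<^esub> g) y"
      if *: "\<forall>y\<in>carrier B'. Q.A ?k y = y" and y: "y \<in> carrier B'" for y
    proof -
      have "Q.A ?k (Q.A (inv\<^bsub>P.ar.Art\<^esub> g) y) = Q.A (inv\<^bsub>P.ar.Art\<^esub> g) y"
        using * y g by (simp del: Q.A_mult)
      then show ?thesis using y g by (simp add: Q.A_inv_cancel)
    qed
  qed
  also have "\<dots> \<longleftrightarrow> P.ar.mtx ?k = mat 1"
  proof
    show "P.ar.mtx ?k = mat 1" if "\<forall>y\<in>carrier B'. Q.A ?k y = y"
      using Q.trivial_action_imp_mtx[OF k] that by blast
    show "\<forall>y\<in>carrier B'. Q.A ?k y = y" if "P.ar.mtx ?k = mat 1"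
    proof -
      \<comment> \<open>With degree 0 the kernel theorem makes the element trivial already in
        \<open>Art\<close>, before any action is considered.\<close>
      have "P.ar.degree ?k = 0" using g by (simp add: P.ar.degree_dual_map)
      then have "?k = \<one>\<^bsub>P.ar.Art\<^esub>" using P.ar.matrix_degree_kernel[OF k that] by blast
      then show ?thesis by (metis Q.A_one)
    qed
  qed
  also have "\<dots> \<longleftrightarrow> P.ar.mtx g $ 2 $ 1 = - int r * P.ar.mtx g $ 1 $ 2"
    by (rule P.ar.dual_map_eq_inverse_iff[OF g])
  finally show ?thesis .
qed

text \<open>\<open>cover_image\<close> lets \<gamma> range over \<open>Art\<close>; since a, b and d
  are free, the existential is an equation between two entries.\<close>

lemma induces_set:
  "{\<gamma> \<in> carrier (Gamma_tilde r). induces_basic_involution D act act' e e' \<gamma>} =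
    {\<gamma> \<in> carrier (Gamma_tilde r). proj \<gamma> \<in> Gamma1 r \<and>
       (\<exists>a b d. proj \<gamma> = mat2 a b (- int r * b) d)}"
proof -
  have "induces_basic_involution D act act' e e' \<gamma> \<longleftrightarrow> proj \<gamma> \<in> Gamma1 r \<and>
      (\<exists>a b d. proj \<gamma> = mat2 a b (- int r * b) d)"
    if \<gamma>: "\<gamma> \<in> carrier (Gamma_tilde r)" for \<gamma>
  proof -
    obtain g where g: "g \<in> carrier P.ar.Art" "\<gamma> = P.ar.cover g"
      using \<gamma> unfolding P.ar.cover_image[symmetric] by blast
    have "(\<exists>a b d. P.ar.mtx g = mat2 a b (- int r * b) d) \<longleftrightarrow>
        P.ar.mtx g $ 2 $ 1 = - int r * P.ar.mtx g $ 1 $ 2"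
      unfolding mat2_eq_iff by blast
    then show ?thesis
      unfolding g(2) induces_iff[OF g(1)] P.ar.proj_cover[OF g(1)]
      using P.ar.Gamma1_mtx[OF g(1)] by blast
  qed
  then show ?thesis by blast
qed

end

theorem theorem4:
  fixes D :: diagram
    and \<rho> \<rho>' :: "ugen word set \<Rightarrow> gen word set \<Rightarrow> gen word set"
    and e e' :: "gen word set \<Rightarrow> gen word set"
  assumes "admissible D"
    and "is_action D \<rho>"
    and "is_action (dual D) \<rho>'"
    and "is_anti_involution D e"
    and "is_anti_involution (dual D) e'"
  shows "{\<gamma> \<in> carrier (Gamma_tilde (level D)). induces_basic_involution D \<rho> \<rho>' e e' \<gamma>} =
    {\<gamma> \<in> carrier (Gamma_tilde (level D)).
       proj \<gamma> \<in> Gamma1 (level D) \<and>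
       (\<exists>a b d :: int. proj \<gamma> = vector [vector [a, b], vector [- int (level D) * b, d]])}"
proof -
  obtain s q r1 where 1: "diagram_datum D s q r1" using diagram_datum_exists assms(1) by blast
  obtain s' q' r2 where 2: "diagram_datum (dual D) s' q' r2"
    using diagram_datum_exists admissible_dual assms(1) by blast
  have 3: "artin (level D)" by unfold_locales (cases D; simp)
  have "basic_involution D s q r1 (level D) \<rho> (dual D) s' q' r2 \<rho>' e e'"
  proof (intro basic_involution.intro)
    show "braid_action D s q r1 (level D) \<rho>"
      by (rule braid_action.intro[OF 1 3 braid_action_axioms.intro[OF _ assms(2)]]) simp
    show "braid_action (dual D) s' q' r2 (level D) \<rho>'"
      by (rule braid_action.intro[OF 2 3 braid_action_axioms.intro[OF _ assms(3)]])
        (rule level_dual[OF assms(1), symmetric])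
    show "anti_isomorphism D s q r1 (dual D) s' q' r2 e"
      by (intro anti_isomorphism.intro anti_isomorphism_axioms.intro 1 2 assms(4) HOL.refl)
    show "anti_isomorphism (dual D) s' q' r2 D s q r1 e'"
      by (intro anti_isomorphism.intro anti_isomorphism_axioms.intro 1 2 assms(5) dual_dual[OF assms(1), symmetric])
  qed
  then show ?thesis by (rule basic_involution.induces_set)
qed

end
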